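(* Let $M$ be a smooth manifold, $L$ a twisted Dirac structure on $M$ (with twist a closed 3-form $H$), and $N\subseteq M$ a closed, embedded, and connected submanifold of codimension $>1$. If $L$ lifts to a twisted Dirac structure on the real projective blowup $\mathrm{Blup}(M,N)$, then one of the following two conditions holds. - $N\subseteq M$ is a transversal for $L$. In this case, the blowdown map $p:\mathrm{Blup}(M,N)\to M$ is a backward Dirac map. - $N\subseteq M$ is an invariant submanifold for $L$. In this case, the blowdown map $p$ is a forward Dirac map.
   Context: Blowup. For a closed embedded submanifold $N\subseteq M$ with normal bundle $\nu_N(M)=TM|_N/TN$, the real projective blowup is, as a set, $\mathrm{Blup}(M,N)=(M\setminus N)\sqcup\mathbb{P}(\nu_N(M))$, where $\mathbb{P}(\nu_N(M))$ is the projectivised normal bundle. The blowdown map $p:\mathrm{Blup}(M,N)\to M$ is the identity on $M\setminus N$ and the bundle projection on $\mathbb{P}(\nu_N(M))\to N$. The smooth structure is determined by charts: for a submanifold chart $(U,(x,y))$ with $U\cap N=\{x=0\}$ and $1\le i\le \operatorname{codim}N$, the set $U_i=p^{-1}(\{x_i\neq0\})\cup\{[v]\in\mathbb{P}(\nu_N(M))|_{U\cap N}:dx_i(v)\neq0\}$ has coordinates $(\tilde x,y)$ in which $p(\tilde x,y)=(x,y)$ with $x_i=\tilde x_i$ and $x_j=\tilde x_i\tilde x_j$ for $j\ne i$; thus $\mathbb{P}(\nu_N(M))\cap U_i=\{\tilde x_i=0\}$. Dirac structures. $\mathbb{T}M=TM\oplus T^*M$ carries the pairing $\langle(v,\xi),(w,\eta)\rangle=\frac12(\xi(w)+\eta(v))$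 and, for a closed 3-form $H$, the bracket $[(X,\alpha),(Y,\beta)]=([X,Y],\mathcal{L}_X\beta-i_Yd\alpha+i_Yi_XH)$. An $H$-twisted Dirac structure is a smooth subbundle $L\subseteq\mathbb{T}M$ which is maximally isotropic and whose sections are closed under this bracket. A smooth map $f:(B,L_B)\to(M,L_M)$ (with twists $H_B=f^*H_M$) is forward Dirac if $(L_M)_{f(b)}=\{(T_bf(w),\xi):(w,(T_bf)^*\xi)\in(L_B)_b\}$ for all $b\in B$, and backward Dirac if $(L_B)_b=\{(w,(T_bf)^*\xi):(T_bf(w),\xi)\in(L_M)_{f(b)}\}$ for all $b\in B$. Lifting. $L$ lifts to $\mathrm{Blup}(M,N)$ if there is a ($p^*H$-twisted) Dirac structure $\tilde L$ on $\mathrm{Blup}(M,N)$ whose restriction to $\mathrm{Blup}(M,N)\setminus\mathbb{P}(\nu_N(M))$ equals $p^*(L|_{M\setminus N})$, i.e. the transport of $L|_{M\setminus N}$ by the diffeomorphism $p$. Such an $\tilde L$ is unique; the forward/backward Dirac property of $p$ is with respect to $\tilde L$ and $L$. $N$ is invariant for $L$ if $\mathrm{pr}_{TM}(L_q)\subseteq T_qN$ for all $q\in N$; it is a transversal if $T_qN+\mathrm{pr}_{TM}(L_q)=T_qM$ for all $q\in N$. *)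

theory Defs
  imports "HOL-Analysis.Analysis" "HOL-Library.Function_Algebras"
begin

text \<open>
  Pointwise real vector space structure on function types. Tangent and cotangent vectors are
  modelled as functions, so that the library notions \<^const>\<open>subspace\<close>, \<^const>\<open>span\<close> and
  \<^const>\<open>dependent\<close> apply to them.
\<close>

instantiation "fun" :: (type, real_vector) real_vector
begin

definition scaleR_fun :: "real \<Rightarrow> ('a \<Rightarrow> 'b) \<Rightarrow> 'a \<Rightarrow> 'b" where
  "scaleR_fun r f = (\<lambda>x. r *\<^sub>R f x)"

instance
  by standard (simp_all add: scaleR_fun_def fun_eq_iff scaleR_add_right scaleR_add_left)

end

section \<open>Smooth maps between open subsets of Euclidean spaces\<close>

text \<open>For open \<open>S\<close>, \<open>differentiable_upto k S f\<close> says that \<open>f\<close> is of class \<open>C\<^sup>k\<close> on \<open>S\<close>.\<close>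

primrec differentiable_upto ::
  "nat \<Rightarrow> 'a::real_normed_vector set \<Rightarrow> ('a \<Rightarrow> 'b::real_normed_vector) \<Rightarrow> bool" where
  "differentiable_upto 0 S f \<longleftrightarrow> continuous_on S f"
| "differentiable_upto (Suc k) S f \<longleftrightarrow>
     (\<forall>x\<in>S. f differentiable (at x)) \<and>
     (\<forall>v. differentiable_upto k S (\<lambda>x. frechet_derivative f (at x) v))"

definition smooth_on :: "'a::real_normed_vector set \<Rightarrow> ('a \<Rightarrow> 'b::real_normed_vector) \<Rightarrow> bool" where
  "smooth_on S f \<longleftrightarrow> (\<forall>k. differentiable_upto k S f)"

section \<open>Smooth manifolds\<close>

text \<open>
  A chart is a domain together with a coordinate map; values of the coordinate map
  outside the domain are irrelevant. A smooth manifold is given by its maximal atlas.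
  The underlying set is the union of the chart domains and the topology is the one for which
  the charts are homeomorphisms onto open subsets of Euclidean space.
\<close>

type_synonym ('a, 'n) chart = "'a set \<times> ('a \<Rightarrow> real^'n)"

abbreviation chart_dom :: "('a, 'n::finite) chart \<Rightarrow> 'a set" where
  "chart_dom c \<equiv> fst c"

abbreviation coords :: "('a, 'n::finite) chart \<Rightarrow> 'a \<Rightarrow> real^'n" where
  "coords c \<equiv> snd c"

definition chart_inv :: "('a, 'n::finite) chart \<Rightarrow> real^'n \<Rightarrow> 'a" where
  "chart_inv c = inv_into (chart_dom c) (coords c)"

definition is_chart :: "('a, 'n::finite) chart \<Rightarrow> bool" where
  "is_chart c \<longleftrightarrow> inj_on (coords c) (chart_dom c) \<and> open (coords c ` chart_dom c)"

definition smoothly_compatible :: "('a, 'n::finite) chart \<Rightarrow> ('a, 'n) chart \<Rightarrow> bool" where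
  "smoothly_compatible c d \<longleftrightarrow>
     (let W = chart_dom c \<inter> chart_dom d in
        open (coords c ` W) \<and> open (coords d ` W) \<and>
        smooth_on (coords c ` W) (coords d \<circ> chart_inv c) \<and>
        smooth_on (coords d ` W) (coords c \<circ> chart_inv d))"

text \<open>All charts on \<open>S\<close> compatible with a given collection of charts; if the latter is an
  atlas of \<open>S\<close>, this is the maximal atlas determined by it.\<close>

definition smooth_structure :: "'a set \<Rightarrow> ('a, 'n::finite) chart set \<Rightarrow> ('a, 'n) chart set" where
  "smooth_structure S A0 =
     {c. is_chart c \<and> chart_dom c \<subseteq> S \<and> (\<forall>d\<in>A0. smoothly_compatible c d)}"

definition points :: "('a, 'n::finite) chart set \<Rightarrow> 'a set" where
  "points A = (\<Union>c\<in>A. chart_dom c)"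

definition manifold_topology :: "('a, 'n::finite) chart set \<Rightarrow> 'a topology" where
  "manifold_topology A =
     topology (\<lambda>W. W \<subseteq> points A \<and> (\<forall>c\<in>A. open (coords c ` (W \<inter> chart_dom c))))"

text \<open>The equation below says that \<open>A\<close> consists of pairwise compatible charts and is maximal.\<close>

definition smooth_manifold :: "('a, 'n::finite) chart set \<Rightarrow> bool" where
  "smooth_manifold A \<longleftrightarrow>
     A = smooth_structure (points A) A \<and>
     Hausdorff_space (manifold_topology A) \<and>
     second_countable (manifold_topology A)"

definition charts_at :: "('a, 'n::finite) chart set \<Rightarrow> 'a \<Rightarrow> ('a, 'n) chart set" where
  "charts_at A q = {c \<in> A. q \<in> chart_dom c}"

definition smooth_map ::
  "('b, 'm::finite) chart set \<Rightarrow> ('a, 'n::finite) chart set \<Rightarrow> ('b \<Rightarrow> 'a) \<Rightarrow> bool" where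
  "smooth_map B A f \<longleftrightarrow>
     f ` points B \<subseteq> points A \<and>
     (\<forall>c\<in>B. \<forall>d\<in>A. let W = chart_dom c \<inter> f -` chart_dom d in
        open (coords c ` W) \<and> smooth_on (coords c ` W) (coords d \<circ> f \<circ> chart_inv c))"

section \<open>Tangent and cotangent spaces\<close>

text \<open>
  A tangent vector at \<open>q\<close> is the family of its coordinate vectors with respect to all charts
  around \<open>q\<close>, related by the Jacobians of the transition maps (and set to \<open>0\<close> at all other charts).
  A cotangent vector at \<open>q\<close> is a linear functional on the tangent space at \<open>q\<close>
  (set to \<open>0\<close> off the tangent space).
\<close>

type_synonym ('a, 'n) tvec = "('a, 'n) chart \<Rightarrow> real^'n"
type_synonym ('a, 'n) covec = "('a, 'n) tvec \<Rightarrow> real"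

definition tangent_space ::
  "('a, 'n::finite) chart set \<Rightarrow> 'a \<Rightarrow> ('a, 'n) tvec set" where
  "tangent_space A q =
     {v. (\<forall>d. d \<notin> charts_at A q \<longrightarrow> v d = 0) \<and>
         (\<forall>c\<in>charts_at A q. \<forall>d\<in>charts_at A q.
            v d = frechet_derivative (coords d \<circ> chart_inv c) (at (coords c q)) (v c))}"

text \<open>The tangent vector at \<open>q\<close> with coordinate vector \<open>u\<close> in the chart \<open>c\<close>.\<close>

definition tangent_of ::
  "('a, 'n::finite) chart set \<Rightarrow> 'a \<Rightarrow> ('a, 'n) chart \<Rightarrow> real^'n \<Rightarrow> ('a, 'n) tvec" where
  "tangent_of A q c u =
     (\<lambda>d. if d \<in> charts_at A q
          then frechet_derivative (coords d \<circ> chart_inv c) (at (coords c q)) u else 0)"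

definition linear_over :: "'v::real_vector set \<Rightarrow> ('v \<Rightarrow> real) \<Rightarrow> bool" where
  "linear_over V f \<longleftrightarrow>
     (\<forall>x\<in>V. \<forall>y\<in>V. f (x + y) = f x + f y) \<and> (\<forall>r. \<forall>x\<in>V. f (r *\<^sub>R x) = r * f x)"

definition cotangent_space ::
  "('a, 'n::finite) chart set \<Rightarrow> 'a \<Rightarrow> ('a, 'n) covec set" where
  "cotangent_space A q =
     {\<xi>. linear_over (tangent_space A q) \<xi> \<and> (\<forall>w. w \<notin> tangent_space A q \<longrightarrow> \<xi> w = 0)}"

text \<open>The components of a cotangent vector at \<open>q\<close> in the chart \<open>c\<close>.\<close>

definition covec_coords ::
  "('a, 'n::finite) chart set \<Rightarrow> 'a \<Rightarrow> ('a, 'n) chart \<Rightarrow> ('a, 'n) covec \<Rightarrow> real^'n" where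
  "covec_coords A q c \<xi> = (\<chi> i. \<xi> (tangent_of A q c (axis i 1)))"

text \<open>The tangent map of a smooth \<open>f\<close> at \<open>b\<close>; the result does not depend on the chosen chart.\<close>

definition tangent_map ::
  "('b, 'm::finite) chart set \<Rightarrow> ('a, 'n::finite) chart set \<Rightarrow> ('b \<Rightarrow> 'a) \<Rightarrow> 'b \<Rightarrow>
   ('b, 'm) tvec \<Rightarrow> ('a, 'n) tvec" where
  "tangent_map B A f b w =
     (let c = (SOME c. c \<in> charts_at B b) in
        (\<lambda>d. if d \<in> charts_at A (f b)
             then frechet_derivative (coords d \<circ> f \<circ> chart_inv c) (at (coords c b)) (w c)
             else 0))"

definition cotangent_map ::
  "('b, 'm::finite) chart set \<Rightarrow> ('a, 'n::finite) chart set \<Rightarrow> ('b \<Rightarrow> 'a) \<Rightarrow> 'b \<Rightarrow>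
   ('a, 'n) covec \<Rightarrow> ('b, 'm) covec" where
  "cotangent_map B A f b \<xi> =
     (\<lambda>w. if w \<in> tangent_space B b then \<xi> (tangent_map B A f b w) else 0)"

section \<open>Closed 3-forms\<close>

type_synonym ('a, 'n) form3 =
  "'a \<Rightarrow> ('a, 'n) tvec \<Rightarrow> ('a, 'n) tvec \<Rightarrow> ('a, 'n) tvec \<Rightarrow> real"

text \<open>The coordinate expression of a 3-form in the chart \<open>c\<close>, on constant vectors.\<close>

definition form3_coords ::
  "('a, 'n::finite) chart set \<Rightarrow> ('a, 'n) form3 \<Rightarrow> ('a, 'n) chart \<Rightarrow>
   real^'n \<Rightarrow> real^'n \<Rightarrow> real^'n \<Rightarrow> real^'n \<Rightarrow> real" where
  "form3_coords A H c u v w z =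
     (let q = chart_inv c z in H q (tangent_of A q c u) (tangent_of A q c v) (tangent_of A q c w))"

text \<open>Linearity in the first two arguments follows from antisymmetry.\<close>

definition smooth_form3 :: "('a, 'n::finite) chart set \<Rightarrow> ('a, 'n) form3 \<Rightarrow> bool" where
  "smooth_form3 A H \<longleftrightarrow>
     (\<forall>q\<in>points A. \<forall>u\<in>tangent_space A q. \<forall>v\<in>tangent_space A q.
        linear_over (tangent_space A q) (H q u v) \<and>
        (\<forall>w\<in>tangent_space A q. H q v u w = - H q u v w \<and> H q u w v = - H q u v w)) \<and>
     (\<forall>c\<in>A. \<forall>u v w. smooth_on (coords c ` chart_dom c) (form3_coords A H c u v w))"

text \<open>\<open>dH = 0\<close>, evaluated on constant vector fields in charts.\<close>

definition closed_form3 :: "('a, 'n::finite) chart set \<Rightarrow> ('a, 'n) form3 \<Rightarrow> bool" where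
  "closed_form3 A H \<longleftrightarrow>
     smooth_form3 A H \<and>
     (\<forall>c\<in>A. \<forall>z\<in>coords c ` chart_dom c. \<forall>u0 u1 u2 u3.
        frechet_derivative (form3_coords A H c u1 u2 u3) (at z) u0
      - frechet_derivative (form3_coords A H c u0 u2 u3) (at z) u1
      + frechet_derivative (form3_coords A H c u0 u1 u3) (at z) u2
      - frechet_derivative (form3_coords A H c u0 u1 u2) (at z) u3 = 0)"

definition form3_pullback ::
  "('b, 'm::finite) chart set \<Rightarrow> ('a, 'n::finite) chart set \<Rightarrow> ('b \<Rightarrow> 'a) \<Rightarrow>
   ('a, 'n) form3 \<Rightarrow> ('b, 'm) form3" where
  "form3_pullback B A f H = (\<lambda>b u v w.
     H (f b) (tangent_map B A f b u) (tangent_map B A f b v) (tangent_map B A f b w))"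

section \<open>Dirac structures\<close>

type_synonym ('a, 'n) gtvec = "('a, 'n) tvec \<times> ('a, 'n) covec"

text \<open>The fibre of \<open>TM \<oplus> T\<^sup>*M\<close>, its pairing, and the coordinates of its elements.\<close>

definition gen_tangent_space ::
  "('a, 'n::finite) chart set \<Rightarrow> 'a \<Rightarrow> ('a, 'n) gtvec set" where
  "gen_tangent_space A q = tangent_space A q \<times> cotangent_space A q"

definition pairing :: "('a, 'n::finite) gtvec \<Rightarrow> ('a, 'n) gtvec \<Rightarrow> real" where
  "pairing e f = (snd e (fst f) + snd f (fst e)) / 2"

definition gtvec_coords ::
  "('a, 'n::finite) chart set \<Rightarrow> 'a \<Rightarrow> ('a, 'n) chart \<Rightarrow> ('a, 'n) gtvec \<Rightarrow> (real^'n) \<times> (real^'n)"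
  where "gtvec_coords A q c e = (fst e c, covec_coords A q c (snd e))"

definition smooth_section ::
  "('a, 'n::finite) chart set \<Rightarrow> 'a set \<Rightarrow> ('a \<Rightarrow> ('a, 'n) gtvec) \<Rightarrow> bool" where
  "smooth_section A W s \<longleftrightarrow>
     (\<forall>q\<in>W. s q \<in> gen_tangent_space A q) \<and>
     (\<forall>c\<in>A. smooth_on (coords c ` (W \<inter> chart_dom c))
        (\<lambda>z. gtvec_coords A (chart_inv c z) c (s (chart_inv c z))))"

text \<open>Smooth subbundles of \<open>TM \<oplus> T\<^sup>*M\<close>, by local frames.\<close>

definition smooth_subbundle ::
  "('a, 'n::finite) chart set \<Rightarrow> ('a \<Rightarrow> ('a, 'n) gtvec set) \<Rightarrow> bool" where
  "smooth_subbundle A L \<longleftrightarrow>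
     (\<forall>q\<in>points A. \<exists>W r s.
        openin (manifold_topology A) W \<and> q \<in> W \<and>
        (\<forall>i<(r::nat). smooth_section A W (s i)) \<and>
        (\<forall>x\<in>W. inj_on (\<lambda>i. s i x) {..<r} \<and> independent ((\<lambda>i. s i x) ` {..<r}) \<and>
               L x = span ((\<lambda>i. s i x) ` {..<r})))"

definition isotropic :: "('a, 'n::finite) gtvec set \<Rightarrow> bool" where
  "isotropic V \<longleftrightarrow> (\<forall>e\<in>V. \<forall>f\<in>V. pairing e f = 0)"

definition maximally_isotropic ::
  "('a, 'n::finite) chart set \<Rightarrow> 'a \<Rightarrow> ('a, 'n) gtvec set \<Rightarrow> bool" where
  "maximally_isotropic A q V \<longleftrightarrow>
     subspace V \<and> V \<subseteq> gen_tangent_space A q \<and> isotropic V \<and>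
     (\<forall>V'. subspace V' \<and> V' \<subseteq> gen_tangent_space A q \<and> isotropic V' \<and> V \<subseteq> V' \<longrightarrow> V' = V)"

text \<open>Lie bracket, Lie derivative of a 1-form and exterior derivative of a 1-form on open subsets
  of Euclidean space; 1-forms are given by their component vectors.\<close>

definition lie_bracket :: "(real^'n \<Rightarrow> real^'n) \<Rightarrow> (real^'n \<Rightarrow> real^'n) \<Rightarrow> real^'n \<Rightarrow> real^'n" where
  "lie_bracket X Y z = frechet_derivative Y (at z) (X z) - frechet_derivative X (at z) (Y z)"

definition lie_derivative1 ::
  "(real^'n \<Rightarrow> real^'n) \<Rightarrow> (real^'n \<Rightarrow> real^'n) \<Rightarrow> real^'n \<Rightarrow> real^'n \<Rightarrow> real" where
  "lie_derivative1 X \<beta> z w =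
     frechet_derivative \<beta> (at z) (X z) \<bullet> w + \<beta> z \<bullet> frechet_derivative X (at z) w"

definition ext_derivative1 ::
  "(real^'n \<Rightarrow> real^'n) \<Rightarrow> real^'n \<Rightarrow> real^'n \<Rightarrow> real^'n \<Rightarrow> real" where
  "ext_derivative1 \<alpha> z u w =
     frechet_derivative \<alpha> (at z) u \<bullet> w - frechet_derivative \<alpha> (at z) w \<bullet> u"

text \<open>The value at \<open>q\<close> of the \<open>H\<close>-twisted bracket
  \<open>([X,Y], \<L>\<^sub>X\<beta> - i\<^sub>Y d\<alpha> + i\<^sub>Y i\<^sub>X H)\<close> of the sections \<open>s = (X,\<alpha>)\<close> and \<open>t = (Y,\<beta>)\<close>, computed in the
  chart \<open>c\<close> around \<open>q\<close>; it does not depend on \<open>c\<close>.\<close>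

definition twisted_bracket ::
  "('a, 'n::finite) chart set \<Rightarrow> ('a, 'n) form3 \<Rightarrow> ('a, 'n) chart \<Rightarrow>
   ('a \<Rightarrow> ('a, 'n) gtvec) \<Rightarrow> ('a \<Rightarrow> ('a, 'n) gtvec) \<Rightarrow> 'a \<Rightarrow> ('a, 'n) gtvec" where
  "twisted_bracket A H c s t q =
     (let z = coords c q;
          X = (\<lambda>x. fst (s (chart_inv c x)) c);
          Y = (\<lambda>x. fst (t (chart_inv c x)) c);
          \<alpha> = (\<lambda>x. covec_coords A (chart_inv c x) c (snd (s (chart_inv c x))));
          \<beta> = (\<lambda>x. covec_coords A (chart_inv c x) c (snd (t (chart_inv c x))))
      in (tangent_of A q c (lie_bracket X Y z),
          \<lambda>w. if w \<in> tangent_space A q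
              then lie_derivative1 X \<beta> z (w c) - ext_derivative1 \<alpha> z (Y z) (w c)
                   + H q (fst (s q)) (fst (t q)) w
              else 0))"

definition section_of ::
  "('a, 'n::finite) chart set \<Rightarrow> ('a \<Rightarrow> ('a, 'n) gtvec set) \<Rightarrow> ('a \<Rightarrow> ('a, 'n) gtvec) \<Rightarrow> bool" where
  "section_of A L s \<longleftrightarrow> smooth_section A (points A) s \<and> (\<forall>q\<in>points A. s q \<in> L q)"

definition involutive ::
  "('a, 'n::finite) chart set \<Rightarrow> ('a, 'n) form3 \<Rightarrow> ('a \<Rightarrow> ('a, 'n) gtvec set) \<Rightarrow> bool" where
  "involutive A H L \<longleftrightarrow>
     (\<forall>s t. section_of A L s \<and> section_of A L t \<longrightarrow>
        (\<forall>q\<in>points A. \<forall>c\<in>charts_at A q. twisted_bracket A H c s t q \<in> L q))"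

definition dirac_structure ::
  "('a, 'n::finite) chart set \<Rightarrow> ('a, 'n) form3 \<Rightarrow> ('a \<Rightarrow> ('a, 'n) gtvec set) \<Rightarrow> bool" where
  "dirac_structure A H L \<longleftrightarrow>
     smooth_subbundle A L \<and> (\<forall>q\<in>points A. maximally_isotropic A q (L q)) \<and> involutive A H L"

definition backward_image ::
  "('b, 'm::finite) chart set \<Rightarrow> ('a, 'n::finite) chart set \<Rightarrow> ('b \<Rightarrow> 'a) \<Rightarrow>
   ('a \<Rightarrow> ('a, 'n) gtvec set) \<Rightarrow> 'b \<Rightarrow> ('b, 'm) gtvec set" where
  "backward_image B A f L b =
     {(w, cotangent_map B A f b \<xi>) | w \<xi>.
        w \<in> tangent_space B b \<and> \<xi> \<in> cotangent_space A (f b) \<and>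
        (tangent_map B A f b w, \<xi>) \<in> L (f b)}"

definition forward_image ::
  "('b, 'm::finite) chart set \<Rightarrow> ('a, 'n::finite) chart set \<Rightarrow> ('b \<Rightarrow> 'a) \<Rightarrow>
   ('b \<Rightarrow> ('b, 'm) gtvec set) \<Rightarrow> 'b \<Rightarrow> ('a, 'n) gtvec set" where
  "forward_image B A f L b =
     {(tangent_map B A f b w, \<xi>) | w \<xi>.
        w \<in> tangent_space B b \<and> \<xi> \<in> cotangent_space A (f b) \<and>
        (w, cotangent_map B A f b \<xi>) \<in> L b}"

definition backward_dirac ::
  "('b, 'm::finite) chart set \<Rightarrow> ('b \<Rightarrow> ('b, 'm) gtvec set) \<Rightarrow>
   ('a, 'n::finite) chart set \<Rightarrow> ('a \<Rightarrow> ('a, 'n) gtvec set) \<Rightarrow> ('b \<Rightarrow> 'a) \<Rightarrow> bool" where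
  "backward_dirac B LB A LA f \<longleftrightarrow>
     smooth_map B A f \<and> (\<forall>b\<in>points B. LB b = backward_image B A f LA b)"

definition forward_dirac ::
  "('b, 'm::finite) chart set \<Rightarrow> ('b \<Rightarrow> ('b, 'm) gtvec set) \<Rightarrow>
   ('a, 'n::finite) chart set \<Rightarrow> ('a \<Rightarrow> ('a, 'n) gtvec set) \<Rightarrow> ('b \<Rightarrow> 'a) \<Rightarrow> bool" where
  "forward_dirac B LB A LA f \<longleftrightarrow>
     smooth_map B A f \<and> (\<forall>b\<in>points B. LA (f b) = forward_image B A f LB b)"

section \<open>Submanifolds\<close>

text \<open>\<open>c\<close> is a submanifold chart for \<open>N\<close> of codimension \<open>k\<close>: in its domain \<open>N\<close> is given by the
  vanishing of the \<open>k\<close> coordinates with index in \<open>I\<close> (the \<open>x\<close>-coordinates).\<close>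

definition submanifold_chart ::
  "('a, 'n::finite) chart set \<Rightarrow> 'a set \<Rightarrow> nat \<Rightarrow> ('a, 'n) chart \<Rightarrow> 'n set \<Rightarrow> bool" where
  "submanifold_chart A N k c I \<longleftrightarrow>
     c \<in> A \<and> card I = k \<and> (\<forall>q\<in>chart_dom c. q \<in> N \<longleftrightarrow> (\<forall>i\<in>I. coords c q $ i = 0))"

definition embedded_submanifold ::
  "('a, 'n::finite) chart set \<Rightarrow> 'a set \<Rightarrow> nat \<Rightarrow> bool" where
  "embedded_submanifold A N k \<longleftrightarrow>
     N \<subseteq> points A \<and> k \<le> CARD('n) \<and>
     (\<forall>q\<in>N. \<exists>c I. q \<in> chart_dom c \<and> submanifold_chart A N k c I)"

text \<open>\<open>T\<^sub>qN\<close> as a subspace of \<open>T\<^sub>qM\<close>, for \<open>q \<in> N\<close>.\<close>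

definition submanifold_tangent_space ::
  "('a, 'n::finite) chart set \<Rightarrow> 'a set \<Rightarrow> nat \<Rightarrow> 'a \<Rightarrow> ('a, 'n) tvec set" where
  "submanifold_tangent_space A N k q =
     {v \<in> tangent_space A q.
        \<exists>c I. q \<in> chart_dom c \<and> submanifold_chart A N k c I \<and> (\<forall>i\<in>I. v c $ i = 0)}"

definition invariant_submanifold ::
  "('a, 'n::finite) chart set \<Rightarrow> 'a set \<Rightarrow> nat \<Rightarrow> ('a \<Rightarrow> ('a, 'n) gtvec set) \<Rightarrow> bool" where
  "invariant_submanifold A N k L \<longleftrightarrow>
     (\<forall>q\<in>N. fst ` L q \<subseteq> submanifold_tangent_space A N k q)"

definition transversal_submanifold ::
  "('a, 'n::finite) chart set \<Rightarrow> 'a set \<Rightarrow> nat \<Rightarrow> ('a \<Rightarrow> ('a, 'n) gtvec set) \<Rightarrow> bool" where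
  "transversal_submanifold A N k L \<longleftrightarrow>
     (\<forall>q\<in>N. {u + v | u v. u \<in> submanifold_tangent_space A N k q \<and> v \<in> fst ` L q}
             = tangent_space A q)"

section \<open>The real projective blowup\<close>

text \<open>Elements of the normal space \<open>T\<^sub>qM / T\<^sub>qN\<close> are cosets; \<open>normal_line A N k q v\<close> is the
  subspace of the normal space spanned by the class of \<open>v\<close>.\<close>

definition normal_class ::
  "('a, 'n::finite) chart set \<Rightarrow> 'a set \<Rightarrow> nat \<Rightarrow> 'a \<Rightarrow> ('a, 'n) tvec \<Rightarrow> ('a, 'n) tvec set" where
  "normal_class A N k q v = (\<lambda>u. v + u) ` submanifold_tangent_space A N k q"

definition normal_line ::
  "('a, 'n::finite) chart set \<Rightarrow> 'a set \<Rightarrow> nat \<Rightarrow> 'a \<Rightarrow> ('a, 'n) tvec \<Rightarrow> ('a, 'n) tvec set set" where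
  "normal_line A N k q v = range (\<lambda>r. normal_class A N k q (r *\<^sub>R v))"

type_synonym ('a, 'n) blowup_point = "'a + ('a \<times> ('a, 'n) tvec set set)"

definition projective_normal_bundle ::
  "('a, 'n::finite) chart set \<Rightarrow> 'a set \<Rightarrow> nat \<Rightarrow> ('a \<times> ('a, 'n) tvec set set) set" where
  "projective_normal_bundle A N k =
     {(q, normal_line A N k q v) | q v.
        q \<in> N \<and> v \<in> tangent_space A q - submanifold_tangent_space A N k q}"

definition blowup_set ::
  "('a, 'n::finite) chart set \<Rightarrow> 'a set \<Rightarrow> nat \<Rightarrow> ('a, 'n) blowup_point set" where
  "blowup_set A N k = (points A - N) <+> projective_normal_bundle A N k"

definition blowdown :: "('a, 'n::finite) blowup_point \<Rightarrow> 'a" where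
  "blowdown b = case_sum id fst b"

text \<open>A vector spanning the line \<open>l\<close> in the normal space at \<open>q\<close>.\<close>

definition line_representative ::
  "('a, 'n::finite) chart set \<Rightarrow> 'a set \<Rightarrow> nat \<Rightarrow> 'a \<Rightarrow> ('a, 'n) tvec set set \<Rightarrow> ('a, 'n) tvec" where
  "line_representative A N k q l =
     (SOME v. v \<in> tangent_space A q - submanifold_tangent_space A N k q \<and> l = normal_line A N k q v)"

text \<open>The chart on \<open>U\<^sub>i\<close> associated with the submanifold chart \<open>c = (U, (x, y))\<close>. Off the exceptional
  divisor its coordinates are \<open>x\<^sub>i\<close>, \<open>x\<^sub>j / x\<^sub>i\<close> (for \<open>j \<noteq> i\<close>) and \<open>y\<close>; at \<open>[v]\<close> they are
  \<open>0\<close>, \<open>dx\<^sub>j(v) / dx\<^sub>i(v)\<close> and \<open>y\<close>, the ratio being independent of the representative \<open>v\<close>.\<close>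

definition blowup_chart ::
  "('a, 'n::finite) chart set \<Rightarrow> 'a set \<Rightarrow> nat \<Rightarrow> ('a, 'n) chart \<Rightarrow> 'n set \<Rightarrow> 'n \<Rightarrow>
   (('a, 'n) blowup_point, 'n) chart" where
  "blowup_chart A N k c I i =
     ({q \<in> chart_dom c. coords c q $ i \<noteq> 0} <+>
      {(q, normal_line A N k q v) | q v.
         q \<in> chart_dom c \<inter> N \<and> v \<in> tangent_space A q \<and> v c $ i \<noteq> 0},
      \<lambda>b. case b of
        Inl q \<Rightarrow> (\<chi> j. if j \<in> I - {i} then coords c q $ j / coords c q $ i else coords c q $ j)
      | Inr (q, l) \<Rightarrow>
          (let v = line_representative A N k q l in
           (\<chi> j. if j \<in> I - {i} then v c $ j / v c $ i else coords c q $ j)))"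

definition blowup ::
  "('a, 'n::finite) chart set \<Rightarrow> 'a set \<Rightarrow> nat \<Rightarrow> (('a, 'n) blowup_point, 'n) chart set" where
  "blowup A N k =
     smooth_structure (blowup_set A N k)
       {blowup_chart A N k c I i | c I i. submanifold_chart A N k c I \<and> i \<in> I}"

text \<open>\<open>Lt\<close> is a lift of \<open>L\<close>: a Dirac structure on the blowup, twisted by the pullback of \<open>H\<close>, which
  off the exceptional divisor is the pullback of \<open>L\<close> under the diffeomorphism \<open>blowdown\<close>.\<close>

definition is_lift ::
  "('a, 'n::finite) chart set \<Rightarrow> ('a, 'n) form3 \<Rightarrow> 'a set \<Rightarrow> nat \<Rightarrow>
   ('a \<Rightarrow> ('a, 'n) gtvec set) \<Rightarrow>
   (('a, 'n) blowup_point \<Rightarrow> (('a, 'n) blowup_point, 'n) gtvec set) \<Rightarrow> bool" where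
  "is_lift A H N k L Lt \<longleftrightarrow>
     dirac_structure (blowup A N k) (form3_pullback (blowup A N k) A blowdown H) Lt \<and>
     (\<forall>q\<in>points A - N. Lt (Inl q) = backward_image (blowup A N k) A blowdown L (Inl q))"

end

theory Submission
  imports Defs
begin

text \<open>
  The blowup charts are mutually compatible because the coordinates \<open>x\<^sub>j\<close> of a second submanifold chart,
  pulled back to the blowup, are smoothly divisible by \<open>x\<^sub>i\<close> (Hadamard). In such charts everything
  becomes a limit of Lagrangian subspaces of \<open>\<real>\<^sup>n \<times> \<real>\<^sup>n\<close> at points of the exceptional divisor.
  Let \<open>b = [v]\<close> lie over \<open>q \<in> N\<close>. A section \<open>(X, \<xi>)\<close> of \<open>L\<close>, transported off the divisor along a
  curve through \<open>b\<close> with parameter \<open>t\<close>, has a vector component of order \<open>1/t\<close> along the fibre of \<open>P(\<nu>)\<close>.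
  Rescaling by \<open>t\<close> shows that the lift at \<open>b\<close> contains the fibre direction determined by \<open>X\<close>; if
  \<open>X \<in> im T\<^sub>b p\<close>, the limit exists without rescaling and lifts \<open>(X, \<xi>)\<close> to \<open>b\<close>. Since Lagrangian subspaces are
  maximal isotropic, this gives the forward Dirac property if \<open>pr L\<^sub>q \<subseteq> T\<^sub>q N\<close> and the backward Dirac
  property if \<open>pr L\<^sub>q + T\<^sub>q N = T\<^sub>q M\<close>. Letting \<open>[v]\<close> tend to a line in the image of \<open>pr L\<^sub>q\<close> in
  \<open>\<nu>\<^sub>q\<close> and using involutivity at \<open>q\<close> rules out every intermediate case. Both conditions are closed along \<open>N\<close>:
  for a limit of transversal points at an invariant point, a choice of the lines \<open>[v]\<close> (possible as
  the codimension exceeds 1) contradicts continuity of the lift. Connectedness of \<open>N\<close> then gives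
  the dichotomy.
\<close>

section \<open>Smooth functions\<close>

text \<open>The lift is never computed on the exceptional divisor. Its fibres are self-annihilating
  and contain the limits of elements of nearby fibres, so each argument produces such limits and
  lets two of them violate isotropy. In the intermediate case the obstacle is that a conormal
  \<open>\<zeta>\<close> in \<open>L\<close> leaves no trace in the limit: its pullback vanishes at
  every line annihilated by \<open>\<zeta>\<close>. Dividing by the parameter \<open>s\<close> of a
  family of nearby lines recovers \<open>dx\<^sub>i\<close>, at the price of a term of order
  \<open>1/s\<close> containing the derivative \<open>D X0\<close> of a section through
  \<open>(0, \<zeta>)\<close>. Involutivity puts exactly this term into the lift, so that it can be
  subtracted. For transversal points tending to an invariant one, elements are selected whose two
  components, interchanged, lie in the limiting fibre of \<open>L\<close>. The interchange turns the
  pairing into the Euclidean inner product, so that a unit vector would have norm 0. Since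
  \<open>involutive\<close> speaks of global sections, local sections are first extended by bump
  functions.\<close>

lemma differentiable_upto_subset:
  "differentiable_upto k S f \<Longrightarrow> T \<subseteq> S \<Longrightarrow> differentiable_upto k T f"
proof (induction k arbitrary: f)
  case 0
  then show ?case by (auto intro: continuous_on_subset)
next
  case (Suc k)
  then show ?case by auto
qed

lemma frechet_derivative_cong:
  assumes "open S" "x \<in> S" "\<And>y. y \<in> S \<Longrightarrow> f y = g y"
  shows "frechet_derivative f (at x) = frechet_derivative g (at x)"
proof -
  have "(f has_derivative D) (at x) \<longleftrightarrow> (g has_derivative D) (at x)" for D
    using has_derivative_transform_within_open[OF _ assms(1,2)] assms(3) by metis
  then show ?thesis by (simp add: frechet_derivative_def)
qed

lemma differentiable_cong:
  assumes "open S" "x \<in> S" "\<And>y. y \<in> S \<Longrightarrow> f y = g y" "f differentiable (at x)"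
  shows "g differentiable (at x)"
  using has_derivative_transform_within_open[OF _ assms(1,2)] assms(3,4)
  unfolding differentiable_def by metis

lemma differentiable_upto_cong:
  assumes "open S" "\<And>x. x \<in> S \<Longrightarrow> f x = g x" "differentiable_upto k S f"
  shows "differentiable_upto k S g"
  using assms(2,3)
proof (induction k arbitrary: f g)
  case 0
  then show ?case using continuous_on_cong by (metis differentiable_upto.simps(1))
next
  case (Suc k)
  have "g differentiable (at x)" if "x \<in> S" for x
    using differentiable_cong[OF assms(1) that, of f g] Suc.prems that by auto
  moreover have "differentiable_upto k S (\<lambda>x. frechet_derivative g (at x) v)" for v
  proof (rule Suc.IH)
    show "frechet_derivative f (at x) v = frechet_derivative g (at x) v" if "x \<in> S" for x
      using frechet_derivative_cong[OF assms(1) that, of f g] Suc.prems(1) by simp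
    show "differentiable_upto k S (\<lambda>x. frechet_derivative f (at x) v)"
      using Suc.prems by simp
  qed
  ultimately show ?case by simp
qed

lemma differentiable_upto_local:
  assumes "\<And>x. x \<in> S \<Longrightarrow> \<exists>T. open T \<and> x \<in> T \<and> differentiable_upto k T f"
  shows "differentiable_upto k S f"
  using assms
proof (induction k arbitrary: f)
  case 0
  have "isCont f x" if "x \<in> S" for x
    using 0[OF that] by (auto simp: continuous_on_eq_continuous_at)
  then show ?case by (auto intro: continuous_at_imp_continuous_on)
next
  case (Suc k)
  have "f differentiable (at x)" if "x \<in> S" for x
    using Suc.prems[OF that] by auto
  moreover have "differentiable_upto k S (\<lambda>x. frechet_derivative f (at x) v)" for v
    by (rule Suc.IH) (use Suc.prems in fastforce)
  ultimately show ?case by simp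
qed

lemma differentiable_upto_Suc_imp: "differentiable_upto (Suc k) S f \<Longrightarrow> differentiable_upto k S f"
proof (induction k arbitrary: f)
  case 0
  then have "f differentiable_on S"
    by (simp add: differentiable_on_def differentiable_at_withinI)
  then show ?case by (simp add: differentiable_imp_continuous_on)
next
  case (Suc k)
  then show ?case by (simp only: differentiable_upto.simps) auto
qed

lemma differentiable_upto_const: "differentiable_upto k S (\<lambda>x. c)"
  by (induction k arbitrary: c) (auto simp: frechet_derivative_const)

lemma frechet_derivative_eqI: "(f has_derivative D) (at x) \<Longrightarrow> frechet_derivative f (at x) = D"
  using frechet_derivative_at by metis

lemma has_derivative_frechet:
  "f differentiable (at x) \<Longrightarrow> (f has_derivative frechet_derivative f (at x)) (at x)"
  using frechet_derivative_works by blast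

lemma differentiable_upto_bounded_linear:
  assumes "bounded_linear f"
  shows "differentiable_upto k S f"
proof (cases k)
  case 0
  then show ?thesis using assms linear_continuous_on by auto
next
  case (Suc m)
  have "frechet_derivative f (at x) = f" for x
    by (rule frechet_derivative_eqI) (rule bounded_linear_imp_has_derivative[OF assms])
  then show ?thesis
    using Suc bounded_linear_imp_differentiable[OF assms] by (simp add: differentiable_upto_const)
qed

lemma differentiable_upto_add:
  assumes "open S" "differentiable_upto k S f" "differentiable_upto k S g"
  shows "differentiable_upto k S (\<lambda>x. f x + g x)"
  using assms(2,3)
proof (induction k arbitrary: f g)
  case 0
  then show ?case by (auto intro: continuous_intros)
next
  case (Suc k)
  have d: "((\<lambda>x. f x + g x) has_derivative
      (\<lambda>v. frechet_derivative f (at x) v + frechet_derivative g (at x) v)) (at x)" if "x \<in> S" for x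
    using Suc.prems that by (auto intro!: derivative_eq_intros has_derivative_frechet)
  have "differentiable_upto k S (\<lambda>x. frechet_derivative (\<lambda>x. f x + g x) (at x) v)" for v
  proof (rule differentiable_upto_cong[OF assms(1)])
    show "differentiable_upto k S (\<lambda>x. frechet_derivative f (at x) v + frechet_derivative g (at x) v)"
      using Suc by auto
  qed (simp add: frechet_derivative_eqI[OF d])
  then show ?case using differentiableI[OF d] by auto
qed

lemma differentiable_upto_bilinear:
  assumes "bounded_bilinear pr" "open S" "differentiable_upto k S f" "differentiable_upto k S g"
  shows "differentiable_upto k S (\<lambda>x. pr (f x) (g x))"
  using assms(3,4)
proof (induction k arbitrary: f g)
  case 0
  then show ?case by (auto intro: bounded_bilinear.continuous_on[OF assms(1)])
next
  case (Suc k)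
  have d: "((\<lambda>x. pr (f x) (g x)) has_derivative
      (\<lambda>v. pr (f x) (frechet_derivative g (at x) v) + pr (frechet_derivative f (at x) v) (g x))) (at x)"
    if "x \<in> S" for x
    using Suc.prems that by (intro bounded_bilinear.FDERIV[OF assms(1)] has_derivative_frechet) auto
  have "differentiable_upto k S (\<lambda>x. frechet_derivative (\<lambda>x. pr (f x) (g x)) (at x) v)" for v
  proof (rule differentiable_upto_cong[OF assms(2)])
    show "differentiable_upto k S (\<lambda>x. pr (f x) (frechet_derivative g (at x) v)
        + pr (frechet_derivative f (at x) v) (g x))"
      using Suc.prems differentiable_upto_Suc_imp[OF Suc.prems(1)]
        differentiable_upto_Suc_imp[OF Suc.prems(2)]
      by (intro differentiable_upto_add[OF assms(2)] Suc.IH) auto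
  qed (simp add: frechet_derivative_eqI[OF d])
  then show ?case using differentiableI[OF d] by auto
qed

lemma differentiable_upto_sum:
  assumes "open S" "\<And>i. i \<in> A \<Longrightarrow> differentiable_upto k S (f i)"
  shows "differentiable_upto k S (\<lambda>x. \<Sum>i\<in>A. f i x)"
  using assms(2)
  by (induction A rule: infinite_finite_induct)
    (auto simp: differentiable_upto_const intro: differentiable_upto_add[OF assms(1)])

text \<open>\<open>differentiable_upto\<close> iterates derivatives in fixed directions, but the
  derivative of \<open>g \<circ> f\<close> applies that of \<open>g\<close> to a direction varying
  with the point. Expanding this direction in the finite basis of the middle space restores fixed
  directions.\<close>

lemma differentiable_upto_compose:
  fixes g :: "'b::euclidean_space \<Rightarrow> 'c::real_normed_vector"
  assumes "open S" "open T" "differentiable_upto k S f" "differentiable_upto k T g" "f ` S \<subseteq> T"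
  shows "differentiable_upto k S (g \<circ> f)"
  using assms(3,4,5)
proof (induction k arbitrary: f g)
  case 0
  then have "continuous_on S (g \<circ> f)"
    by (intro continuous_on_compose) (auto intro: continuous_on_subset)
  then show ?case by simp
next
  case (Suc k)
  have d: "(g \<circ> f has_derivative
      (\<lambda>v. frechet_derivative g (at (f x)) (frechet_derivative f (at x) v))) (at x)"
    if "x \<in> S" for x
    using diff_chain_at[OF has_derivative_frechet has_derivative_frechet, of f x g] Suc.prems that
    by (auto simp: o_def)
  have "differentiable_upto k S (\<lambda>x. frechet_derivative (g \<circ> f) (at x) v)" for v
  proof (rule differentiable_upto_cong[OF assms(1)])
    show "differentiable_upto k S (\<lambda>x. \<Sum>b\<in>Basis. (frechet_derivative f (at x) v \<bullet> b) *\<^sub>R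
        (((\<lambda>y. frechet_derivative g (at y) b) \<circ> f) x))"
    proof (rule differentiable_upto_sum[OF assms(1)],
        rule differentiable_upto_bilinear[OF bounded_bilinear_scaleR assms(1)])
      fix b :: 'b
      show "differentiable_upto k S (\<lambda>x. frechet_derivative f (at x) v \<bullet> b)"
        using Suc.prems(1) by (intro differentiable_upto_bilinear[OF bounded_bilinear_inner assms(1)])
          (auto simp: differentiable_upto_const)
      have "differentiable_upto k S ((\<lambda>y. frechet_derivative g (at y) b) \<circ> f)"
        using Suc.prems differentiable_upto_Suc_imp[OF Suc.prems(1)] by (intro Suc.IH) auto
      then show "differentiable_upto k S (\<lambda>x. (((\<lambda>y. frechet_derivative g (at y) b) \<circ> f) x))"
        by (simp add: o_def)
    qed
  next
    fix x assume x: "x \<in> S"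
    then have lin: "linear (frechet_derivative g (at (f x)))"
      using Suc.prems by (auto simp: image_subset_iff intro: linear_frechet_derivative)
    have rep: "frechet_derivative g (at (f x)) w
      = (\<Sum>b\<in>Basis. (w \<bullet> b) *\<^sub>R frechet_derivative g (at (f x)) b)" for w
    proof -
      have "frechet_derivative g (at (f x)) w = frechet_derivative g (at (f x)) (\<Sum>b\<in>Basis. (w \<bullet> b) *\<^sub>R b)"
        by (simp only: euclidean_representation)
      also have "\<dots> = (\<Sum>b\<in>Basis. (w \<bullet> b) *\<^sub>R frechet_derivative g (at (f x)) b)"
        by (simp only: linear_sum[OF lin] linear_scale[OF lin])
      finally show ?thesis .
    qed
    show "(\<Sum>b\<in>Basis. (frechet_derivative f (at x) v \<bullet> b) *\<^sub>R
        (((\<lambda>y. frechet_derivative g (at y) b) \<circ> f) x)) = frechet_derivative (g \<circ> f) (at x) v"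
      unfolding frechet_derivative_eqI[OF d[OF x]] o_apply by (rule rep[symmetric])
  qed
  then show ?case using differentiableI[OF d] by (auto simp: o_def)
qed

text \<open>The derivative of \<open>inverse\<close> is a polynomial in \<open>inverse\<close>
  itself, so the induction closes without a statement about higher powers.\<close>

lemma differentiable_upto_inverse: "differentiable_upto k (- {0}) (inverse :: real \<Rightarrow> real)"
proof (induction k)
  case 0
  then show ?case by (auto intro: continuous_intros)
next
  case (Suc k)
  have o: "open (- {0::real})" by (rule open_Compl) simp
  have d: "(inverse has_derivative (\<lambda>v. - (inverse x * v * inverse x))) (at (x::real))" if "x \<noteq> 0" for x
    using that by (rule has_derivative_inverse')
  have "differentiable_upto k (- {0}) (\<lambda>x. frechet_derivative inverse (at (x::real)) v)" for v
  proof (rule differentiable_upto_cong[OF o])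
    show "differentiable_upto k (- {0}) (\<lambda>x. (- v) * (inverse x * inverse x))"
      by (intro differentiable_upto_bilinear[OF bounded_bilinear_mult o] differentiable_upto_const Suc)
  qed (simp add: frechet_derivative_eqI[OF d])
  then show ?case using differentiableI[OF d] by auto
qed

lemma smooth_on_subset: "smooth_on S f \<Longrightarrow> T \<subseteq> S \<Longrightarrow> smooth_on T f"
  unfolding smooth_on_def using differentiable_upto_subset by blast

lemma smooth_on_cong: "open S \<Longrightarrow> (\<And>x. x \<in> S \<Longrightarrow> f x = g x) \<Longrightarrow> smooth_on S f \<Longrightarrow> smooth_on S g"
  unfolding smooth_on_def using differentiable_upto_cong by blast

lemma smooth_on_local:
  assumes "\<And>x. x \<in> S \<Longrightarrow> \<exists>T. open T \<and> x \<in> T \<and> smooth_on T f"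
  shows "smooth_on S f"
  using assms unfolding smooth_on_def by (metis differentiable_upto_local)

lemma smooth_on_const: "smooth_on S (\<lambda>x. c)"
  by (simp add: smooth_on_def differentiable_upto_const)

lemma smooth_on_bounded_linear: "bounded_linear f \<Longrightarrow> smooth_on S f"
  by (simp add: smooth_on_def differentiable_upto_bounded_linear)

lemma smooth_on_add:
  "open S \<Longrightarrow> smooth_on S f \<Longrightarrow> smooth_on S g \<Longrightarrow> smooth_on S (\<lambda>x. f x + g x)"
  by (simp add: smooth_on_def differentiable_upto_add)

lemma smooth_on_bilinear:
  "bounded_bilinear pr \<Longrightarrow> open S \<Longrightarrow> smooth_on S f \<Longrightarrow> smooth_on S g \<Longrightarrow>
   smooth_on S (\<lambda>x. pr (f x) (g x))"
  by (simp add: smooth_on_def differentiable_upto_bilinear)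

lemmas smooth_on_mult = smooth_on_bilinear[OF bounded_bilinear_mult]
lemmas smooth_on_scaleR = smooth_on_bilinear[OF bounded_bilinear_scaleR]

lemma smooth_on_sum:
  "open S \<Longrightarrow> (\<And>i. i \<in> A \<Longrightarrow> smooth_on S (f i)) \<Longrightarrow> smooth_on S (\<lambda>x. \<Sum>i\<in>A. f i x)"
  by (simp add: smooth_on_def differentiable_upto_sum)

lemma smooth_on_compose:
  fixes g :: "'b::euclidean_space \<Rightarrow> 'c::real_normed_vector"
  shows "open S \<Longrightarrow> open T \<Longrightarrow> smooth_on S f \<Longrightarrow> smooth_on T g \<Longrightarrow> f ` S \<subseteq> T \<Longrightarrow> smooth_on S (g \<circ> f)"
  by (simp add: smooth_on_def differentiable_upto_compose)

lemma smooth_on_linear_comp: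
  fixes f :: "'a::real_normed_vector \<Rightarrow> 'b::euclidean_space"
  assumes "bounded_linear h" "open S" "smooth_on S f"
  shows "smooth_on S (\<lambda>x. h (f x))"
  using smooth_on_compose[OF assms(2) open_UNIV assms(3) smooth_on_bounded_linear[OF assms(1)]]
  by (simp add: o_def)

lemma smooth_on_divide:
  fixes f g :: "'a::real_normed_vector \<Rightarrow> real"
  assumes "open S" "smooth_on S f" "smooth_on S g" "\<And>x. x \<in> S \<Longrightarrow> g x \<noteq> 0"
  shows "smooth_on S (\<lambda>x. f x / g x)"
proof -
  have "smooth_on S (inverse \<circ> g)"
    by (rule smooth_on_compose[OF assms(1) _ assms(3), of "- {0}"])
      (auto simp: smooth_on_def differentiable_upto_inverse assms(4) open_Compl)
  then show ?thesis
    using smooth_on_mult[OF assms(1,2)] by (simp add: divide_inverse o_def)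
qed

lemma smooth_on_nth: "open S \<Longrightarrow> smooth_on S f \<Longrightarrow> smooth_on S (\<lambda>x. (f x :: real^'n::finite) $ j)"
  by (rule smooth_on_linear_comp[OF bounded_linear_vec_nth])

lemma smooth_on_vec:
  assumes "open S" "\<And>j. smooth_on S (\<lambda>x. f x $ j)"
  shows "smooth_on S (f :: _ \<Rightarrow> real^'n::finite)"
proof (rule smooth_on_cong[OF assms(1)])
  show "smooth_on S (\<lambda>x. \<Sum>j\<in>UNIV. (f x $ j) *\<^sub>R axis j 1)"
    by (intro smooth_on_sum smooth_on_scaleR smooth_on_const assms)
  show "(\<Sum>j\<in>UNIV. (f x $ j) *\<^sub>R axis j 1) = f x" for x
    using basis_expansion[of "f x"] by (simp add: scalar_mult_eq_scaleR)
qed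

lemma smooth_on_imp_differentiable: "smooth_on S f \<Longrightarrow> x \<in> S \<Longrightarrow> f differentiable (at x)"
  unfolding smooth_on_def by (metis differentiable_upto.simps(2))

lemma smooth_on_imp_continuous_on: "smooth_on S f \<Longrightarrow> continuous_on S f"
  unfolding smooth_on_def by (metis differentiable_upto.simps(1))

lemma smooth_on_frechet: "smooth_on S f \<Longrightarrow> smooth_on S (\<lambda>x. frechet_derivative f (at x) v)"
  unfolding smooth_on_def by (metis differentiable_upto.simps(2))

section \<open>Differentiation under the integral sign and Hadamard division\<close>

lemma differentiable_upto_integral:
  fixes \<Phi> :: "real \<times> 'a::euclidean_space \<Rightarrow> 'b::banach"
  assumes "open T" "open S" "{0..1} \<times> S \<subseteq> T" "differentiable_upto k T \<Phi>"
  shows "differentiable_upto k S (\<lambda>z. integral {0..1} (\<lambda>s. \<Phi> (s, z)))"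
  using assms(4)
proof (induction k arbitrary: \<Phi>)
  case 0
  have "continuous_on (S \<times> cbox 0 1) (\<lambda>(z, s). \<Phi> (s, z))"
    unfolding case_prod_unfold
    by (rule continuous_on_compose2[of T \<Phi>]) (use 0 assms(3) in \<open>auto intro!: continuous_intros\<close>)
  from integral_continuous_on_param[OF this] show ?case by simp
next
  case (Suc k)
  let ?F = "\<lambda>z. integral {0..1} (\<lambda>s. \<Phi> (s, z))"
  \<comment> \<open>The direction \<open>(0, v)\<close> fixes the integration variable, while
    \<open>\<lambda>p. ?D p v\<close> is still a function of the pair, so the induction hypothesis
    applies to it.\<close>
  let ?D = "\<lambda>p v. frechet_derivative \<Phi> (at p) (0, v)"
  have diff: "\<Phi> differentiable (at p)" if "p \<in> T" for p
    using Suc.prems that by simp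
  have cont\<Phi>: "continuous_on T \<Phi>"
    using diff by (auto intro!: differentiable_imp_continuous_on
        simp: differentiable_on_def differentiable_at_withinI)
  have lin: "bounded_linear (?D p)" if "p \<in> T" for p
  proof -
    have "bounded_linear (frechet_derivative \<Phi> (at p) \<circ> Pair 0)"
      unfolding o_def
      by (rule bounded_linear_compose[OF has_derivative_bounded_linear[OF has_derivative_frechet[OF diff[OF that]]]])
        (intro bounded_linear_Pair bounded_linear_zero bounded_linear_ident)
    then show ?thesis by (simp add: o_def)
  qed
  have contD: "continuous_on T (\<lambda>p. ?D p v)" for v
  proof -
    have "differentiable_upto k T (\<lambda>p. ?D p v)" using Suc.prems by simp
    then have "differentiable_upto 0 T (\<lambda>p. ?D p v)"
      by (induction k) (blast dest: differentiable_upto_Suc_imp)+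
    then show ?thesis by simp
  qed
  have der: "(?F has_derivative (\<lambda>v. integral {0..1} (\<lambda>s. ?D (s, z0) v))) (at z0)" if z0: "z0 \<in> S" for z0
  proof -
    obtain e where e: "e > 0" "ball z0 e \<subseteq> S" using assms(2) z0 open_contains_ball by blast
    have inT: "(s, z) \<in> T" if "z \<in> ball z0 e" "s \<in> cbox 0 1" for s z
      using that subsetD[OF e(2)] subsetD[OF assms(3), of "(s, z)"] by simp
    \<comment> \<open>\<open>leibniz_rule\<close> wants a continuous derivative with values in
      bounded linear maps; in finite dimension this reduces to continuity in each direction
      \<open>v\<close>.\<close>
    define fx where "fx z s = Blinfun (?D (s, z))" for z s
    have fx: "blinfun_apply (fx z s) = ?D (s, z)" if "z \<in> ball z0 e" "s \<in> cbox 0 1" for s z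
      unfolding fx_def by (rule bounded_linear_Blinfun_apply[OF lin[OF inT[OF that]]])
    have cfx: "continuous_on (ball z0 e \<times> cbox 0 1) (\<lambda>(z, s). fx z s)"
    proof (rule continuous_on_blinfun_componentwise)
      fix v :: 'a
      have "continuous_on (ball z0 e \<times> cbox 0 1) (\<lambda>x. ?D (snd x, fst x) v)"
        by (rule continuous_on_compose2[OF contD]) (auto intro!: continuous_intros inT)
      then show "continuous_on (ball z0 e \<times> cbox 0 1) (\<lambda>x. blinfun_apply (case x of (z, s) \<Rightarrow> fx z s) v)"
        by (rule continuous_on_eq) (auto simp: fx)
    qed
    have "((\<lambda>z. integral (cbox 0 1) (\<lambda>s. \<Phi> (s, z))) has_derivative integral (cbox 0 1) (fx z0)) (at z0 within ball z0 e)"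
    proof (rule leibniz_rule[OF _ _ cfx])
      fix z s assume zs: "z \<in> ball z0 e" "s \<in> cbox (0::real) 1"
      have *: "((\<lambda>z. \<Phi> (s, z)) has_derivative ?D (s, z)) (at z within ball z0 e)"
        by (rule has_derivative_compose[of "Pair s" "Pair 0" _ _ \<Phi>])
          (auto intro!: derivative_eq_intros has_derivative_frechet diff inT zs)
      show "((\<lambda>z. \<Phi> (s, z)) has_derivative blinfun_apply (fx z s)) (at z within ball z0 e)"
        unfolding fx[OF zs] by (rule *)
    next
      fix z assume z: "z \<in> ball z0 e"
      show "(\<lambda>s. \<Phi> (s, z)) integrable_on cbox 0 1"
        by (intro integrable_continuous continuous_on_compose2[OF cont\<Phi>])
          (use z in \<open>auto intro!: continuous_intros inT\<close>)
    qed (use e in auto)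
    then have *: "(?F has_derivative integral (cbox 0 1) (fx z0)) (at z0)"
      unfolding at_within_open[OF centre_in_ball[THEN iffD2, OF e(1)] open_ball] cbox_interval .
    have "fx z0 integrable_on cbox 0 1"
    proof (intro integrable_continuous)
      have "continuous_on (cbox 0 1) (\<lambda>s. case (z0, s) of (z, s) \<Rightarrow> fx z s)"
        by (rule continuous_on_compose2[OF cfx]) (use e in \<open>auto intro!: continuous_intros\<close>)
      then show "continuous_on (cbox 0 1) (fx z0)" by simp
    qed
    then have "blinfun_apply (integral (cbox 0 1) (fx z0)) v = integral {0..1} (\<lambda>s. ?D (s, z0) v)" for v
      using e by (subst blinfun_apply_integral) (auto intro!: integral_cong simp: fx)
    then have eq: "blinfun_apply (integral (cbox 0 1) (fx z0)) = (\<lambda>v. integral {0..1} (\<lambda>s. ?D (s, z0) v))"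
      by (rule ext)
    show ?thesis using * unfolding eq .
  qed
  have "differentiable_upto k S (\<lambda>z. frechet_derivative ?F (at z) v)" for v
  proof (rule differentiable_upto_cong[OF assms(2)])
    show "differentiable_upto k S (\<lambda>z. integral {0..1} (\<lambda>s. ?D (s, z) v))"
      using Suc.IH[of "\<lambda>p. ?D p v"] Suc.prems by simp
  qed (simp add: frechet_derivative_eqI[OF der])
  then show ?case using differentiableI[OF der] by auto
qed

lemma smooth_on_integral:
  fixes \<Phi> :: "real \<times> 'a::euclidean_space \<Rightarrow> 'b::banach"
  shows "open T \<Longrightarrow> open S \<Longrightarrow> {0..1} \<times> S \<subseteq> T \<Longrightarrow> smooth_on T \<Phi> \<Longrightarrow>
    smooth_on S (\<lambda>z. integral {0..1} (\<lambda>s. \<Phi> (s, z)))"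
  by (simp add: smooth_on_def differentiable_upto_integral)

definition divided_coord :: "'n \<Rightarrow> (real^'n::finite \<Rightarrow> real) \<Rightarrow> real^'n \<Rightarrow> real" where
  "divided_coord i F z =
     (if z $ i = 0 then frechet_derivative F (at z) (axis i 1) else F z / z $ i)"

text \<open>Hadamard's lemma: near the hyperplane the quotient is
  \<open>\<integral>\<^sub>0\<^sup>1 \<partial>\<^sub>i F (z - (1 - s) z\<^sub>i e\<^sub>i) ds\<close>.\<close>

lemma smooth_on_divided_coord:
  fixes F :: "real^'n::finite \<Rightarrow> real"
  assumes U: "open U" and F: "smooth_on U F" and zero: "\<And>z. z \<in> U \<Longrightarrow> z $ i = 0 \<Longrightarrow> F z = 0"
  shows "smooth_on U (divided_coord i F)"
proof (rule smooth_on_local)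
  fix z0 assume z0: "z0 \<in> U"
  have opn: "open {z :: real^'n. z $ i \<noteq> 0}"
    by (intro open_Collect_neq continuous_intros)
  show "\<exists>T. open T \<and> z0 \<in> T \<and> smooth_on T (divided_coord i F)"
  proof (cases "z0 $ i = 0")
    case False
    let ?T = "U \<inter> {z. z $ i \<noteq> 0}"
    have T: "open ?T" using U opn by blast
    have "smooth_on ?T (\<lambda>z. F z / z $ i)"
      by (rule smooth_on_divide[OF T])
        (auto intro: smooth_on_bounded_linear[OF bounded_linear_vec_nth] smooth_on_subset[OF F])
    then have "smooth_on ?T (divided_coord i F)"
      by (rule smooth_on_cong[OF T, rotated]) (auto simp: divided_coord_def)
    then show ?thesis using False z0 T by blast
  next
    case True
    obtain e where e: "e > 0" "ball z0 e \<subseteq> U" using U z0 open_contains_ball by blast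
    let ?\<gamma> = "\<lambda>p :: real \<times> (real^'n). snd p - ((1 - fst p) * snd p $ i) *\<^sub>R (axis i 1 :: real^'n)"
    let ?g = "\<lambda>z. frechet_derivative F (at z) (axis i 1)"
    let ?T = "?\<gamma> -` U :: (real \<times> (real^'n)) set"
    have T: "open ?T" by (intro open_vimage U continuous_intros)
    \<comment> \<open>As \<open>z0 $ i = 0\<close>, shrinking the \<open>i\<close>-th coordinate of
      \<open>z\<close> does not increase the distance to \<open>z0\<close>; the whole segment stays
      in the ball.\<close>
    have \<gamma>U: "?\<gamma> (s, z) \<in> U" if "z \<in> ball z0 e" "s \<in> {0..1}" for s z
    proof -
      have "norm (?\<gamma> (s, z) - z0) \<le> norm (z - z0)"
      proof (rule norm_le_componentwise_cart)
        fix j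
        have "\<bar>s * z $ i\<bar> \<le> \<bar>z $ i\<bar>" using that(2) by (simp add: abs_mult mult_left_le_one_le)
        then show "norm ((?\<gamma> (s, z) - z0) $ j) \<le> norm ((z - z0) $ j)"
          using True by (auto simp: axis_def algebra_simps)
      qed
      then have "?\<gamma> (s, z) \<in> ball z0 e" using that(1) by (simp add: dist_norm norm_minus_commute)
      then show ?thesis using e by blast
    qed
    have sub: "{0..1} \<times> ball z0 e \<subseteq> ?T"
    proof (intro subsetI vimageI2)
      fix p :: "real \<times> (real^'n)" assume "p \<in> {0..1} \<times> ball z0 e"
      then show "?\<gamma> p \<in> U" using \<gamma>U[of "snd p" "fst p"] by auto
    qed
    have "smooth_on ?T ?\<gamma>"
    proof -
      have 1: "smooth_on ?T (\<lambda>p. (1 + - fst p) * (snd p :: real^'n) $ i)"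
        by (intro smooth_on_mult T smooth_on_add smooth_on_const smooth_on_bounded_linear
            bounded_linear_minus bounded_linear_fst bounded_linear_compose[OF bounded_linear_vec_nth bounded_linear_snd])
      have 2: "smooth_on ?T (\<lambda>p. snd p + ((1 + - fst p) * snd p $ i) *\<^sub>R (- axis i 1 :: real^'n))"
        by (intro T smooth_on_add smooth_on_scaleR 1 smooth_on_const smooth_on_bounded_linear bounded_linear_snd)
      show ?thesis by (rule smooth_on_cong[OF T _ 2]) simp
    qed
    then have "smooth_on ?T (?g \<circ> ?\<gamma>)"
      by (intro smooth_on_compose[OF T U _ smooth_on_frechet[OF F]]) auto
    from smooth_on_integral[OF T open_ball sub this]
    have sm: "smooth_on (ball z0 e) (\<lambda>z. integral {0..1} (\<lambda>s. ?g (?\<gamma> (s, z))))" by simp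
    have "integral {0..1} (\<lambda>s. ?g (?\<gamma> (s, z))) = divided_coord i F z" if z: "z \<in> ball z0 e" for z
    proof (cases "z $ i = 0")
      case True
      then show ?thesis by (simp add: divided_coord_def)
    next
      case False
      have "((\<lambda>s. F (?\<gamma> (s, z))) has_vector_derivative (z $ i * ?g (?\<gamma> (s, z)))) (at s within {0..1})"
        if s: "s \<in> {0..1}" for s
      proof -
        have dF: "F differentiable (at (?\<gamma> (s, z)))"
          using smooth_on_imp_differentiable[OF F \<gamma>U[OF z s]] .
        have "((\<lambda>s. F (?\<gamma> (s, z))) has_derivative
            (\<lambda>h. frechet_derivative F (at (?\<gamma> (s, z))) ((h * z $ i) *\<^sub>R axis i 1))) (at s within {0..1})"
          by (rule has_derivative_compose[of "\<lambda>s. ?\<gamma> (s, z)" _ _ _ F, OF _ has_derivative_frechet[OF dF]])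
            (auto intro!: derivative_eq_intros)
        then show ?thesis
          unfolding has_vector_derivative_def
          using linear_scale[OF linear_frechet_derivative[OF dF]] by (simp add: mult.assoc)
      qed
      from fundamental_theorem_of_calculus[OF _ this]
      have hi: "((\<lambda>s. z $ i * ?g (?\<gamma> (s, z))) has_integral (F (?\<gamma> (1, z)) - F (?\<gamma> (0, z)))) {0..1}"
        by simp
      have "F (?\<gamma> (0, z)) = 0"
        by (rule zero[OF \<gamma>U[OF z]]) (auto simp: axis_def)
      then have "integral {0..1} (\<lambda>s. z $ i * ?g (?\<gamma> (s, z))) = F z"
        using integral_unique[OF hi] by simp
      then show ?thesis using False by (simp add: divided_coord_def field_simps)
    qed
    then have "smooth_on (ball z0 e) (divided_coord i F)"
      using smooth_on_cong[OF open_ball _ sm] by blast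
    then show ?thesis using e by (meson centre_in_ball open_ball)
  qed
qed

section \<open>A smooth bump function\<close>

definition bump_aux :: "nat \<Rightarrow> real \<Rightarrow> real" where
  "bump_aux m x = (if x > 0 then inverse x ^ m * exp (- inverse x) else 0)"

lemma bump_aux_tendsto_0: "(bump_aux m \<longlongrightarrow> 0) (at 0)"
proof -
  have "((\<lambda>x::real. inverse x ^ m * exp (- inverse x)) \<longlongrightarrow> 0) (at_right 0)"
  proof -
    have "((\<lambda>x::real. x ^ m / exp x) \<longlongrightarrow> 0) at_top" by (rule tendsto_power_div_exp_0)
    from filterlim_compose[OF this filterlim_inverse_at_top_right]
    show ?thesis by (simp add: exp_minus divide_inverse)
  qed
  then have "(bump_aux m \<longlongrightarrow> 0) (at_right 0)"
    by (rule Lim_transform_eventually) (auto simp: bump_aux_def eventually_at_filter)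
  moreover have "(bump_aux m \<longlongrightarrow> 0) (at_left 0)"
    by (rule Lim_transform_eventually[OF tendsto_const]) (auto simp: bump_aux_def eventually_at_filter)
  ultimately show ?thesis using filterlim_split_at by blast
qed

text \<open>The family is closed under differentiation: the derivative of member \<open>m\<close>
  combines members \<open>m + 1\<close> and \<open>m + 2\<close>. This is why
  \<open>bump_aux\<close> carries an exponent although the bump itself is built from
  \<open>m = 0\<close>.\<close>

lemma bump_aux_derivative:
  "(bump_aux m has_derivative (\<lambda>v. v * (- real m * bump_aux (Suc m) x + bump_aux (m + 2) x))) (at x)"
proof -
  consider "x > 0" | "x < 0" | "x = 0" by linarith
  then have "(bump_aux m has_real_derivative (- real m * bump_aux (Suc m) x + bump_aux (m + 2) x)) (at x)"
  proof cases
    case 1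
    have inv: "(inverse has_real_derivative - (inverse x * inverse x)) (at x)"
      using DERIV_inverse[of x] 1 by (simp add: power2_eq_square)
    have "((\<lambda>x. inverse x ^ m * exp (- inverse x)) has_real_derivative
        (real m * (- (inverse x * inverse x) * inverse x ^ (m - Suc 0)) * exp (- inverse x)
          + exp (- inverse x) * (inverse x * inverse x) * inverse x ^ m)) (at x)"
      using DERIV_mult[OF DERIV_power[OF inv, of m] DERIV_chain2[OF DERIV_exp DERIV_minus[OF inv]]]
      by (simp add: mult.assoc)
    also have "real m * (- (inverse x * inverse x) * inverse x ^ (m - Suc 0)) * exp (- inverse x)
          + exp (- inverse x) * (inverse x * inverse x) * inverse x ^ m
        = - real m * bump_aux (Suc m) x + bump_aux (m + 2) x"
      using 1 by (cases m) (simp_all add: bump_aux_def algebra_simps)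
    finally have "((\<lambda>x. inverse x ^ m * exp (- inverse x)) has_real_derivative
        (- real m * bump_aux (Suc m) x + bump_aux (m + 2) x)) (at x)" .
    then show ?thesis
      by (rule has_field_derivative_transform_within_open[where S = "{0<..}"])
        (use 1 in \<open>auto simp: bump_aux_def\<close>)
  next
    case 2
    have "((\<lambda>x. 0) has_real_derivative (- real m * bump_aux (Suc m) x + bump_aux (m + 2) x)) (at x)"
      using 2 by (simp add: bump_aux_def)
    then show ?thesis
      by (rule has_field_derivative_transform_within_open[where S = "{..<0}"])
        (use 2 in \<open>auto simp: bump_aux_def\<close>)
  next
    case 3
    \<comment> \<open>The difference quotient of member \<open>m\<close> at 0 is member
      \<open>m + 1\<close>, which tends to 0 from both sides.\<close>
    have "((\<lambda>h. (bump_aux m h - bump_aux m 0) / h) \<longlongrightarrow> 0) (at 0)"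
      by (rule Lim_transform_eventually[OF bump_aux_tendsto_0[of "Suc m"]])
        (auto simp: bump_aux_def eventually_at_filter divide_inverse)
    then show ?thesis using 3 by (simp add: has_field_derivative_iff bump_aux_def)
  qed
  then show ?thesis
    by (rule has_derivative_eq_rhs[OF has_field_derivative_imp_has_derivative]) (simp add: fun_eq_iff mult.commute)
qed

lemma differentiable_upto_bump_aux: "differentiable_upto k UNIV (bump_aux m)"
proof (induction k arbitrary: m)
  case 0
  have "isCont (bump_aux m) x" for x
    using bump_aux_derivative has_derivative_continuous by blast
  then show ?case by (simp add: continuous_at_imp_continuous_on)
next
  case (Suc k)
  have "differentiable_upto k UNIV (\<lambda>x. v * (- real m * bump_aux (Suc m) x + bump_aux (m + 2) x))" for v
    by (intro differentiable_upto_bilinear[OF bounded_bilinear_mult open_UNIV]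
        differentiable_upto_add[OF open_UNIV] differentiable_upto_const Suc)
  then show ?case
    using differentiableI[OF bump_aux_derivative] by (simp add: frechet_derivative_eqI[OF bump_aux_derivative])
qed

lemma smooth_bump_exists:
  fixes a :: "'a::euclidean_space"
  assumes "r > 0"
  obtains \<beta> :: "'a \<Rightarrow> real" where "smooth_on UNIV \<beta>" "\<beta> a = 1" "\<And>x. x \<notin> cball a r \<Longrightarrow> \<beta> x = 0"
proof
  \<comment> \<open>\<open>?h\<close> is positive exactly on the open ball of radius
    \<open>r\<close>, which localises the support; the second factor of \<open>?\<beta>\<close>
    normalises the value at \<open>a\<close>, where \<open>?h a = r\<^sup>2\<close>.\<close>
  let ?h = "\<lambda>x. r\<^sup>2 - (x - a) \<bullet> (x - a)"
  let ?\<beta> = "\<lambda>x. bump_aux 0 (?h x) * inverse (bump_aux 0 (r\<^sup>2))"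
  have "smooth_on UNIV (\<lambda>x. r\<^sup>2 + (- 1) * ((x + - a) \<bullet> (x + - a)))"
    by (intro smooth_on_add smooth_on_mult smooth_on_const smooth_on_bounded_linear bounded_linear_ident
        smooth_on_bilinear[OF bounded_bilinear_inner] open_UNIV)
  then have "smooth_on UNIV ?h" by simp
  moreover have "smooth_on UNIV (bump_aux 0)" by (simp add: smooth_on_def differentiable_upto_bump_aux)
  ultimately have "smooth_on UNIV (bump_aux 0 \<circ> ?h)"
    by (intro smooth_on_compose[OF open_UNIV open_UNIV]) auto
  then have "smooth_on UNIV (\<lambda>x. bump_aux 0 (?h x))" by (simp add: o_def)
  then show "smooth_on UNIV ?\<beta>" by (intro smooth_on_mult smooth_on_const open_UNIV)
  show "?\<beta> a = 1" using assms by (simp add: bump_aux_def)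
  show "?\<beta> x = 0" if "x \<notin> cball a r" for x
  proof -
    have "norm (x - a) > r" using that by (simp add: dist_norm norm_minus_commute)
    then have "(norm (x - a))\<^sup>2 > r\<^sup>2" using assms by (simp add: power_strict_mono)
    then show ?thesis by (simp add: bump_aux_def dot_square_norm)
  qed
qed

section \<open>Charts and tangent spaces\<close>

lemma scaleR_fun_apply [simp]: "(r *\<^sub>R f) x = r *\<^sub>R f x"
  by (simp add: scaleR_fun_def)

text \<open>The setting common to \<open>M\<close> and to its blowup: the tangent calculus below
  rests on pairwise compatibility and so serves both at once.\<close>

definition compatible_charts :: "('a, 'n::finite) chart set \<Rightarrow> bool" where
  "compatible_charts A \<longleftrightarrow> (\<forall>c\<in>A. is_chart c) \<and> (\<forall>c\<in>A. \<forall>d\<in>A. smoothly_compatible c d)"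

lemma chart_inv_coords [simp]: "is_chart c \<Longrightarrow> q \<in> chart_dom c \<Longrightarrow> chart_inv c (coords c q) = q"
  by (simp add: is_chart_def chart_inv_def)

lemma chart_inv_in_dom: "z \<in> coords c ` chart_dom c \<Longrightarrow> chart_inv c z \<in> chart_dom c"
  by (simp add: chart_inv_def inv_into_into)

lemma coords_chart_inv: "z \<in> coords c ` chart_dom c \<Longrightarrow> coords c (chart_inv c z) = z"
  by (simp add: chart_inv_def f_inv_into_f)

lemma open_chart_image: "is_chart c \<Longrightarrow> open (coords c ` chart_dom c)"
  by (simp add: is_chart_def)

lemma smoothly_compatibleD:
  assumes "smoothly_compatible c d"
  shows "open (coords c ` (chart_dom c \<inter> chart_dom d))"
    "smooth_on (coords c ` (chart_dom c \<inter> chart_dom d)) (coords d \<circ> chart_inv c)"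
    "open (coords d ` (chart_dom c \<inter> chart_dom d))"
    "smooth_on (coords d ` (chart_dom c \<inter> chart_dom d)) (coords c \<circ> chart_inv d)"
  using assms by (simp_all add: smoothly_compatible_def Let_def)

lemma smoothly_compatible_sym: "smoothly_compatible c d \<Longrightarrow> smoothly_compatible d c"
  by (simp add: smoothly_compatible_def Let_def Int_commute)

text \<open>Compatibility is not transitive: \<open>d\<close> controls the change from
  \<open>c\<close> to \<open>e\<close> only inside its own domain, hence the triple
  intersection.\<close>

lemma smoothly_compatible_compose:
  assumes c: "is_chart c" and d: "is_chart d" and e: "is_chart e"
    and cd: "smoothly_compatible c d" and de: "smoothly_compatible d e"
  shows "open (coords c ` (chart_dom c \<inter> chart_dom d \<inter> chart_dom e))" (is "open ?T")
    and "smooth_on (coords c ` (chart_dom c \<inter> chart_dom d \<inter> chart_dom e)) (coords e \<circ> chart_inv c)"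
proof -
  let ?S = "coords c ` (chart_dom c \<inter> chart_dom d)"
  let ?V = "coords d ` (chart_dom d \<inter> chart_dom e)"
  let ?f = "coords d \<circ> chart_inv c"
  have T: "?T = ?S \<inter> ?f -` ?V"
  proof (intro set_eqI iffI)
    fix z assume "z \<in> ?T"
    then show "z \<in> ?S \<inter> ?f -` ?V" using chart_inv_coords[OF c] by auto
  next
    fix z assume "z \<in> ?S \<inter> ?f -` ?V"
    then obtain q q' where "q \<in> chart_dom c" "q \<in> chart_dom d" "z = coords c q"
      "q' \<in> chart_dom d" "q' \<in> chart_dom e" "coords d q = coords d q'"
      using chart_inv_coords[OF c] by auto
    then show "z \<in> ?T" using chart_inv_coords[OF d] by (metis IntI imageI)
  qed
  have cont: "continuous_on ?S ?f"
    by (rule smooth_on_imp_continuous_on[OF smoothly_compatibleD(2)[OF cd]])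
  show op: "open ?T"
    unfolding T
    by (rule continuous_open_preimage[OF cont smoothly_compatibleD(1)[OF cd] smoothly_compatibleD(1)[OF de]])
  have "smooth_on ?T ((coords e \<circ> chart_inv d) \<circ> ?f)"
  proof (rule smooth_on_compose[OF op smoothly_compatibleD(1)[OF de] _ smoothly_compatibleD(2)[OF de]])
    show "smooth_on ?T ?f"
      by (rule smooth_on_subset[OF smoothly_compatibleD(2)[OF cd]]) auto
    show "?f ` ?T \<subseteq> ?V" unfolding T by auto
  qed
  then show "smooth_on ?T (coords e \<circ> chart_inv c)"
  proof (rule smooth_on_cong[OF op, rotated])
    fix z assume "z \<in> ?T"
    then obtain q where "q \<in> chart_dom c" "q \<in> chart_dom d" "z = coords c q" by blast
    then show "((coords e \<circ> chart_inv d) \<circ> ?f) z = (coords e \<circ> chart_inv c) z" using c d by simp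
  qed
qed

text \<open>Smoothness and openness are local, and near each point of the overlap some chart of
  \<open>A\<close> serves as an intermediate chart.\<close>

lemma smoothly_compatible_local:
  assumes A: "\<forall>a\<in>A. is_chart a" and c: "is_chart c" and d: "is_chart d"
    and ca: "\<forall>a\<in>A. smoothly_compatible c a" and da: "\<forall>a\<in>A. smoothly_compatible d a"
    and cov: "chart_dom c \<inter> chart_dom d \<subseteq> points A"
  shows "smoothly_compatible c d"
proof -
  have half: "open (coords c ` (chart_dom c \<inter> chart_dom d)) \<and>
      smooth_on (coords c ` (chart_dom c \<inter> chart_dom d)) (coords d \<circ> chart_inv c)"
    if c: "is_chart c" and d: "is_chart d"
    and ca: "\<forall>a\<in>A. smoothly_compatible c a" and da: "\<forall>a\<in>A. smoothly_compatible d a"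
    and cov: "chart_dom c \<inter> chart_dom d \<subseteq> points A"
  for c d :: "('a, 'b) chart"
  proof -
    let ?S = "coords c ` (chart_dom c \<inter> chart_dom d)"
    have loc: "\<exists>T. open T \<and> z \<in> T \<and> T \<subseteq> ?S \<and> smooth_on T (coords d \<circ> chart_inv c)" if z: "z \<in> ?S" for z
    proof -
      obtain q where q: "q \<in> chart_dom c" "q \<in> chart_dom d" "z = coords c q" using z by blast
      then obtain a where a: "a \<in> A" "q \<in> chart_dom a" using cov by (auto simp: points_def)
      show ?thesis
        using smoothly_compatible_compose[OF c, of a d] A a(1) ca da d q a(2)
        by (intro exI[of _ "coords c ` (chart_dom c \<inter> chart_dom a \<inter> chart_dom d)"])
          (auto dest: smoothly_compatible_sym)
    qed
    then show ?thesis by (metis open_subopen smooth_on_local)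
  qed
  have "chart_dom d \<inter> chart_dom c \<subseteq> points A" using cov by blast
  then show ?thesis
    using half[OF c d ca da cov] half[OF d c da ca]
    by (simp add: smoothly_compatible_def Let_def Int_commute)
qed

lemma compatible_charts_smooth_structure:
  assumes "compatible_charts A" "points A = S"
  shows "compatible_charts (smooth_structure S A)" "A \<subseteq> smooth_structure S A"
    "points (smooth_structure S A) = S"
proof -
  have A: "\<forall>a\<in>A. is_chart a" using assms by (simp add: compatible_charts_def)
  show sub: "A \<subseteq> smooth_structure S A"
    using assms by (auto simp: smooth_structure_def compatible_charts_def points_def)
  show "points (smooth_structure S A) = S"
    using sub assms(2) by (auto simp: smooth_structure_def points_def)
  show "compatible_charts (smooth_structure S A)"
    unfolding compatible_charts_def
  proof (intro conjI ballI)
    fix c assume c: "c \<in> smooth_structure S A"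
    then show "is_chart c" by (simp add: smooth_structure_def)
    fix d assume d: "d \<in> smooth_structure S A"
    show "smoothly_compatible c d"
      by (rule smoothly_compatible_local[OF A]) (use c d assms(2) in \<open>auto simp: smooth_structure_def\<close>)
  qed
qed

lemma smooth_manifold_compatible: "smooth_manifold A \<Longrightarrow> compatible_charts A"
  unfolding smooth_manifold_def compatible_charts_def smooth_structure_def
  by (smt (verit) mem_Collect_eq)

lemma charts_atD: "c \<in> charts_at A q \<Longrightarrow> c \<in> A" "c \<in> charts_at A q \<Longrightarrow> q \<in> chart_dom c"
  by (auto simp: charts_at_def)

lemma points_iff_charts_at: "q \<in> points A \<longleftrightarrow> charts_at A q \<noteq> {}"
  unfolding points_def charts_at_def by blast

context
  fixes A :: "('a, 'n::finite) chart set"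
  assumes A: "compatible_charts A"
begin

lemma compatible_is_chart: "c \<in> A \<Longrightarrow> is_chart c"
  using A by (simp add: compatible_charts_def)

lemma compatible_pair: "c \<in> A \<Longrightarrow> d \<in> A \<Longrightarrow> smoothly_compatible c d"
  using A by (simp add: compatible_charts_def)

text \<open>\<open>topology\<close> can be unfolded only after its predicate is seen to be stable
  under intersections and unions; intersections use that coordinate maps are injective.\<close>

lemma openin_manifold_topology:
  "openin (manifold_topology A) W \<longleftrightarrow>
    W \<subseteq> points A \<and> (\<forall>c\<in>A. open (coords c ` (W \<inter> chart_dom c)))"
proof -
  have "istopology (\<lambda>W. W \<subseteq> points A \<and> (\<forall>c\<in>A. open (coords c ` (W \<inter> chart_dom c))))"
  proof -
    have 1: "coords c ` (S \<inter> T \<inter> chart_dom c) = coords c ` (S \<inter> chart_dom c) \<inter> coords c ` (T \<inter> chart_dom c)"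
      if "c \<in> A" for c S T
      using compatible_is_chart[OF that] unfolding is_chart_def inj_on_def by blast
    have 2: "coords c ` (\<Union>K \<inter> chart_dom c) = (\<Union>S\<in>K. coords c ` (S \<inter> chart_dom c))" for c :: "('a,'n) chart" and K
      by blast
    show ?thesis
      unfolding istopology_def using 1 2 by (simp add: open_Int open_UN le_infI1 Sup_le_iff)
  qed
  then show ?thesis by (simp add: manifold_topology_def topology_inverse')
qed

lemma topspace_manifold_topology: "topspace (manifold_topology A) = points A"
proof -
  have "chart_dom c \<subseteq> points A" if "c \<in> A" for c using that by (auto simp: points_def)
  then have "openin (manifold_topology A) (points A)"
    unfolding openin_manifold_topology
    using compatible_is_chart by (simp add: Int_absorb1 open_chart_image)
  then show ?thesis
    by (metis openin_manifold_topology openin_subset openin_topspace subset_antisym)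
qed

lemma openin_chart_preimage:
  assumes c: "c \<in> A" and U: "open U"
  shows "openin (manifold_topology A) (chart_dom c \<inter> coords c -` U)"
  unfolding openin_manifold_topology
proof (intro conjI ballI)
  show "chart_dom c \<inter> coords c -` U \<subseteq> points A" using c by (auto simp: points_def)
  fix d assume d: "d \<in> A"
  note cd = compatible_pair[OF d c]
  have "coords d ` (chart_dom c \<inter> coords c -` U \<inter> chart_dom d)
      = coords d ` (chart_dom d \<inter> chart_dom c) \<inter> (coords c \<circ> chart_inv d) -` U"
    using chart_inv_coords[OF compatible_is_chart[OF d]] by auto
  then show "open (coords d ` (chart_dom c \<inter> coords c -` U \<inter> chart_dom d))"
    using continuous_open_preimage[OF smooth_on_imp_continuous_on[OF smoothly_compatibleD(2)[OF cd]]
        smoothly_compatibleD(1)[OF cd] U] by simp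
qed

text \<open>With an arbitrary \<open>g\<close>, one chain rule covers both the cocycle identity of
  transition maps and the chart independence of the tangent map of a smooth map.\<close>

lemma chart_change_has_derivative:
  assumes c: "c \<in> charts_at A q" and d: "d \<in> charts_at A q"
    and G: "(g \<circ> chart_inv d has_derivative G) (at (coords d q))"
  shows "(g \<circ> chart_inv c has_derivative
    (\<lambda>u. G (frechet_derivative (coords d \<circ> chart_inv c) (at (coords c q)) u))) (at (coords c q))"
proof -
  note cd = compatible_pair[OF charts_atD(1)[OF c] charts_atD(1)[OF d]]
  have cc: "is_chart c" "is_chart d" using compatible_is_chart charts_atD(1)[OF c] charts_atD(1)[OF d] by auto
  have q: "coords c q \<in> coords c ` (chart_dom c \<inter> chart_dom d)"
    by (rule imageI) (use c d in \<open>simp add: charts_at_def\<close>)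
  have eq: "chart_inv c (coords c q) = q" using c cc by (simp add: charts_atD)
  have "coords d \<circ> chart_inv c differentiable (at (coords c q))"
    by (rule smooth_on_imp_differentiable[OF smoothly_compatibleD(2)[OF cd] q])
  from diff_chain_at[OF has_derivative_frechet[OF this], of "g \<circ> chart_inv d" G]
  have "((g \<circ> chart_inv d) \<circ> (coords d \<circ> chart_inv c) has_derivative
    (\<lambda>u. G (frechet_derivative (coords d \<circ> chart_inv c) (at (coords c q)) u))) (at (coords c q))"
    using G eq by (simp add: o_def)
  then show ?thesis
    by (rule has_derivative_transform_within_open[OF _ smoothly_compatibleD(1)[OF cd] q])
      (use cc in auto)
qed

lemma transition_has_derivative:
  assumes c: "c \<in> charts_at A q" and d: "d \<in> charts_at A q"
  shows "(coords d \<circ> chart_inv c has_derivative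
    frechet_derivative (coords d \<circ> chart_inv c) (at (coords c q))) (at (coords c q))"
proof -
  note cd = compatible_pair[OF charts_atD(1)[OF c] charts_atD(1)[OF d]]
  have q: "coords c q \<in> coords c ` (chart_dom c \<inter> chart_dom d)"
    by (rule imageI) (use c d in \<open>simp add: charts_at_def\<close>)
  show ?thesis
    by (rule has_derivative_frechet[OF smooth_on_imp_differentiable[OF smoothly_compatibleD(2)[OF cd] q]])
qed

lemma transition_linear:
  assumes c: "c \<in> charts_at A q" and d: "d \<in> charts_at A q"
  shows "linear (frechet_derivative (coords d \<circ> chart_inv c) (at (coords c q)))"
  using transition_has_derivative[OF assms] has_derivative_linear by blast

lemma transition_self:
  assumes c: "c \<in> charts_at A q"
  shows "frechet_derivative (coords c \<circ> chart_inv c) (at (coords c q)) u = u"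
proof -
  have cc: "is_chart c" "q \<in> chart_dom c" using compatible_is_chart charts_atD[OF c] by auto
  have "((\<lambda>x. x) has_derivative (\<lambda>x. x)) (at (coords c q))" by simp
  then have "(coords c \<circ> chart_inv c has_derivative (\<lambda>x. x)) (at (coords c q))"
    by (rule has_derivative_transform_within_open[OF _ open_chart_image[OF cc(1)] imageI[OF cc(2)]])
      (simp add: coords_chart_inv)
  from frechet_derivative_eqI[OF this] show ?thesis by simp
qed

lemma transition_chain:
  assumes "c \<in> charts_at A q" "d \<in> charts_at A q" "e \<in> charts_at A q"
  shows "frechet_derivative (coords e \<circ> chart_inv c) (at (coords c q)) u =
    frechet_derivative (coords e \<circ> chart_inv d) (at (coords d q))
      (frechet_derivative (coords d \<circ> chart_inv c) (at (coords c q)) u)"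
  using frechet_derivative_eqI[OF chart_change_has_derivative[OF assms(1,2) transition_has_derivative[OF assms(2,3)]]]
  by simp

section \<open>Tangent and cotangent vectors in coordinates\<close>

lemma tangent_space_transition:
  "v \<in> tangent_space A q \<Longrightarrow> c \<in> charts_at A q \<Longrightarrow> d \<in> charts_at A q \<Longrightarrow>
   v d = frechet_derivative (coords d \<circ> chart_inv c) (at (coords c q)) (v c)"
  unfolding tangent_space_def by blast

lemma tangent_space_off: "v \<in> tangent_space A q \<Longrightarrow> d \<notin> charts_at A q \<Longrightarrow> v d = 0"
  unfolding tangent_space_def by blast

lemma tangent_spaceI:
  "(\<And>d. d \<notin> charts_at A q \<Longrightarrow> v d = 0) \<Longrightarrow>
   (\<And>c d. c \<in> charts_at A q \<Longrightarrow> d \<in> charts_at A q \<Longrightarrow>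
     v d = frechet_derivative (coords d \<circ> chart_inv c) (at (coords c q)) (v c)) \<Longrightarrow> v \<in> tangent_space A q"
  unfolding tangent_space_def by blast

lemma tangent_of_in_tangent_space:
  "c \<in> charts_at A q \<Longrightarrow> tangent_of A q c u \<in> tangent_space A q"
  by (rule tangent_spaceI) (simp add: tangent_of_def, unfold tangent_of_def, simp add: transition_chain[of c q, symmetric])

lemma tangent_of_chart [simp]: "c \<in> charts_at A q \<Longrightarrow> tangent_of A q c u c = u"
  by (simp add: tangent_of_def transition_self)

lemma tangent_space_eqI:
  "v \<in> tangent_space A q \<Longrightarrow> w \<in> tangent_space A q \<Longrightarrow> c \<in> charts_at A q \<Longrightarrow> v c = w c \<Longrightarrow> v = w"
proof
  fix d
  assume "v \<in> tangent_space A q" "w \<in> tangent_space A q" "c \<in> charts_at A q" "v c = w c"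
  then show "v d = w d"
    using tangent_space_transition[of v q c d] tangent_space_transition[of w q c d]
      tangent_space_off[of v q d] tangent_space_off[of w q d]
    by (cases "d \<in> charts_at A q") auto
qed

lemma tangent_of_coords:
  "c \<in> charts_at A q \<Longrightarrow> v \<in> tangent_space A q \<Longrightarrow> tangent_of A q c (v c) = v"
  using tangent_space_eqI tangent_of_in_tangent_space by (metis tangent_of_chart)

lemma subspace_tangent_space: "subspace (tangent_space A q)"
  unfolding subspace_def
proof (intro conjI ballI allI)
  show "0 \<in> tangent_space A q"
    by (rule tangent_spaceI) (simp_all add: linear_0[OF transition_linear])
next
  fix x y assume x: "x \<in> tangent_space A q" and y: "y \<in> tangent_space A q"
  show "x + y \<in> tangent_space A q"
  proof (rule tangent_spaceI)
    fix c d assume "c \<in> charts_at A q" "d \<in> charts_at A q"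
    then show "(x + y) d = frechet_derivative (coords d \<circ> chart_inv c) (at (coords c q)) ((x + y) c)"
      unfolding plus_fun_def linear_add[OF transition_linear, OF \<open>c \<in> _\<close> \<open>d \<in> _\<close>]
      by (intro arg_cong2[of _ _ _ _ "(+)"] tangent_space_transition x y)
  qed (simp add: tangent_space_off[OF x] tangent_space_off[OF y])
next
  fix x r assume x: "x \<in> tangent_space A q"
  show "r *\<^sub>R x \<in> tangent_space A q"
  proof (rule tangent_spaceI)
    fix c d assume "c \<in> charts_at A q" "d \<in> charts_at A q"
    then show "(r *\<^sub>R x) d = frechet_derivative (coords d \<circ> chart_inv c) (at (coords c q)) ((r *\<^sub>R x) c)"
      unfolding scaleR_fun_def linear_scale[OF transition_linear, OF \<open>c \<in> _\<close> \<open>d \<in> _\<close>]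
      by (intro arg_cong2[of _ _ _ _ "(*\<^sub>R)"] refl tangent_space_transition x)
  qed (simp add: scaleR_fun_def tangent_space_off[OF x])
qed

lemma tangent_of_add:
  "c \<in> charts_at A q \<Longrightarrow> tangent_of A q c (u + v) = tangent_of A q c u + tangent_of A q c v"
  by (rule tangent_space_eqI)
    (auto intro!: tangent_of_in_tangent_space subspace_add[OF subspace_tangent_space])

lemma tangent_of_scale:
  "c \<in> charts_at A q \<Longrightarrow> tangent_of A q c (r *\<^sub>R u) = r *\<^sub>R tangent_of A q c u"
  by (rule tangent_space_eqI)
    (auto intro!: tangent_of_in_tangent_space subspace_scale[OF subspace_tangent_space])

lemma covector_eval:
  assumes c: "c \<in> charts_at A q" and \<xi>: "\<xi> \<in> cotangent_space A q" and w: "w \<in> tangent_space A q"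
  shows "\<xi> w = covec_coords A q c \<xi> \<bullet> w c"
proof -
  have add: "\<xi> (x + y) = \<xi> x + \<xi> y" if "x \<in> tangent_space A q" "y \<in> tangent_space A q" for x y
    using \<xi> that by (simp add: cotangent_space_def linear_over_def)
  have scale: "\<xi> (r *\<^sub>R x) = r * \<xi> x" if "x \<in> tangent_space A q" for r x
    using \<xi> that by (simp add: cotangent_space_def linear_over_def)
  \<comment> \<open>\<open>\<xi>\<close> is linear only over \<open>tangent_space A q\<close>;
    composed with \<open>tangent_of\<close> it is linear on all of \<open>real^'n\<close>, where the
    basis expansion applies.\<close>
  define \<phi> where "\<phi> = (\<lambda>u. \<xi> (tangent_of A q c u))"
  have lin: "linear \<phi>"
    unfolding \<phi>_def by (rule linearI)
      (simp_all add: tangent_of_add[OF c] tangent_of_scale[OF c] add scale tangent_of_in_tangent_space[OF c])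
  have "\<phi> (\<Sum>i\<in>UNIV. (w c $ i) *\<^sub>R axis i 1) = (\<Sum>i\<in>UNIV. (w c $ i) * \<phi> (axis i 1))"
    by (simp add: linear_sum[OF lin] linear_scale[OF lin])
  moreover have "(\<Sum>i\<in>UNIV. (w c $ i) *\<^sub>R axis i 1) = w c"
    using basis_expansion[of "w c"] by (simp add: scalar_mult_eq_scaleR)
  ultimately show ?thesis
    using tangent_of_coords[OF c w] by (simp add: covec_coords_def inner_vec_def mult.commute \<phi>_def)
qed

text \<open>The inverse of \<open>gtvec_coords\<close> on \<open>gen_tangent_space A q\<close>. The
  value 0 off the tangent space is the normal form of covectors, without which coordinates would not
  determine them.\<close>

definition gt_of :: "'a \<Rightarrow> ('a, 'n) chart \<Rightarrow> (real^'n) \<times> (real^'n) \<Rightarrow> ('a, 'n) gtvec" where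
  "gt_of q c x = (tangent_of A q c (fst x), \<lambda>w. if w \<in> tangent_space A q then snd x \<bullet> w c else 0)"

lemma gt_of_in: "c \<in> charts_at A q \<Longrightarrow> gt_of q c x \<in> gen_tangent_space A q"
  using subspace_add[OF subspace_tangent_space] subspace_scale[OF subspace_tangent_space]
  by (auto simp: gt_of_def gen_tangent_space_def cotangent_space_def linear_over_def
      tangent_of_in_tangent_space inner_add_right scaleR_fun_def)

lemma gtvec_coords_gt_of: "c \<in> charts_at A q \<Longrightarrow> gtvec_coords A q c (gt_of q c x) = x"
  by (auto simp: gt_of_def gtvec_coords_def covec_coords_def tangent_of_in_tangent_space vec_eq_iff
      inner_axis intro: prod_eqI)

lemma gt_of_gtvec_coords:
  assumes c: "c \<in> charts_at A q" and e: "e \<in> gen_tangent_space A q"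
  shows "gt_of q c (gtvec_coords A q c e) = e"
proof (rule prod_eqI)
  show "fst (gt_of q c (gtvec_coords A q c e)) = fst e"
    using assms by (auto simp: gt_of_def gtvec_coords_def gen_tangent_space_def tangent_of_coords)
  have "snd e \<in> cotangent_space A q" using e by (auto simp: gen_tangent_space_def)
  then show "snd (gt_of q c (gtvec_coords A q c e)) = snd e"
    using covector_eval[OF c] by (auto simp: gt_of_def gtvec_coords_def cotangent_space_def)
qed

lemma gtvec_coords_inj:
  "c \<in> charts_at A q \<Longrightarrow> e \<in> gen_tangent_space A q \<Longrightarrow> f \<in> gen_tangent_space A q \<Longrightarrow>
   gtvec_coords A q c e = gtvec_coords A q c f \<Longrightarrow> e = f"
  using gt_of_gtvec_coords by metis

lemma subspace_gen_tangent_space: "subspace (gen_tangent_space A q)"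
proof -
  have "subspace (cotangent_space A q)"
    unfolding subspace_def cotangent_space_def linear_over_def by (simp add: algebra_simps)
  then show ?thesis
    unfolding gen_tangent_space_def by (rule subspace_Times[OF subspace_tangent_space])
qed

lemma pairing_coords:
  assumes c: "c \<in> charts_at A q" and e: "e \<in> gen_tangent_space A q" "f \<in> gen_tangent_space A q"
  shows "2 * pairing e f = fst (gtvec_coords A q c e) \<bullet> snd (gtvec_coords A q c f)
     + snd (gtvec_coords A q c e) \<bullet> fst (gtvec_coords A q c f)"
  using e covector_eval[OF c, of "snd e" "fst f"] covector_eval[OF c, of "snd f" "fst e"]
  by (auto simp: pairing_def gtvec_coords_def gen_tangent_space_def inner_commute)

end

lemma gtvec_coords_add: "gtvec_coords A q c (e + f) = gtvec_coords A q c e + gtvec_coords A q c f"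
  by (auto simp: gtvec_coords_def covec_coords_def vec_eq_iff)

lemma gtvec_coords_scale: "gtvec_coords A q c (r *\<^sub>R e) = r *\<^sub>R gtvec_coords A q c e"
  by (auto simp: gtvec_coords_def covec_coords_def vec_eq_iff scaleR_fun_def)

lemma gtvec_coords_0: "gtvec_coords A q c 0 = 0"
  by (auto simp: gtvec_coords_def covec_coords_def vec_eq_iff zero_prod_def)

lemma linear_gtvec_coords: "linear (gtvec_coords A q c)"
  by (rule linearI) (simp_all add: gtvec_coords_add gtvec_coords_scale)

section \<open>Lagrangian subspaces\<close>

definition dual_pair :: "'v::real_inner \<times> 'v \<Rightarrow> 'v \<times> 'v \<Rightarrow> real" where
  "dual_pair x y = fst x \<bullet> snd y + snd x \<bullet> fst y"

text \<open>Stated as self-annihilation rather than maximality, so that membership is tested by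
  pairings, which survive limits. \<open>dual_pair\<close> is twice the pairing of the
  fibres.\<close>

definition lagrangian :: "('v::real_inner \<times> 'v) set \<Rightarrow> bool" where
  "lagrangian S \<longleftrightarrow> S = {x. \<forall>y\<in>S. dual_pair x y = 0}"

lemma dual_pair_sym: "dual_pair x y = dual_pair y x"
  by (simp add: dual_pair_def inner_commute)

text \<open>Interchanging components turns the dual pairing into the Euclidean inner product;
  nondegeneracy and dimension counts are inherited from there.\<close>

lemma dual_pair_swap: "dual_pair x y = prod.swap y \<bullet> x"
  by (simp add: dual_pair_def inner_prod_def inner_commute)

lemma dual_pair_Pair [simp]: "dual_pair (a, b) (c, d) = a \<bullet> d + b \<bullet> c"
  by (simp add: dual_pair_def)

lemma lagrangian_memI: "lagrangian S \<Longrightarrow> (\<And>y. y \<in> S \<Longrightarrow> dual_pair x y = 0) \<Longrightarrow> x \<in> S"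
  unfolding lagrangian_def by blast

lemma lagrangian_isotropic: "lagrangian S \<Longrightarrow> x \<in> S \<Longrightarrow> y \<in> S \<Longrightarrow> dual_pair x y = 0"
  unfolding lagrangian_def by blast

lemma dual_pair_linear:
  "dual_pair (x + y) w = dual_pair x w + dual_pair y w"
  "dual_pair (r *\<^sub>R x) w = r * dual_pair x w"
  "dual_pair w (x + y) = dual_pair w x + dual_pair w y"
  "dual_pair w (r *\<^sub>R x) = r * dual_pair w x"
  by (simp_all add: dual_pair_def inner_add_left inner_add_right algebra_simps)

lemma lagrangian_subspace: "lagrangian S \<Longrightarrow> subspace S"
  unfolding subspace_def
proof (intro conjI ballI allI)
  assume S: "lagrangian S"
  show "0 \<in> S" by (rule lagrangian_memI[OF S]) (simp add: dual_pair_def)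
  show "x + y \<in> S" if "x \<in> S" "y \<in> S" for x y
    by (rule lagrangian_memI[OF S]) (simp add: dual_pair_linear lagrangian_isotropic[OF S] that)
  show "r *\<^sub>R x \<in> S" if "x \<in> S" for x r
    by (rule lagrangian_memI[OF S]) (simp add: dual_pair_linear lagrangian_isotropic[OF S] that)
qed

lemma lagrangian_maximal:
  assumes "lagrangian S" "S \<subseteq> V" "\<And>x y. x \<in> V \<Longrightarrow> y \<in> V \<Longrightarrow> dual_pair x y = 0"
  shows "V = S"
  using assms lagrangian_memI[OF assms(1)] by blast

lemma linear_swap: "linear (prod.swap :: 'a::real_vector \<times> 'a \<Rightarrow> 'a \<times> 'a)"
  by (rule linearI) auto

lemma dim_dual_complement:
  fixes V :: "('v::euclidean_space \<times> 'v) set"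
  assumes "subspace V"
  shows "dim {x. \<forall>y\<in>V. dual_pair x y = 0} + dim V = 2 * DIM('v)"
proof -
  have s: "subspace (prod.swap ` V)" by (rule linear_subspace_image[OF linear_swap assms])
  have "dim {y \<in> UNIV. \<forall>x\<in>prod.swap ` V. orthogonal x y} + dim (prod.swap ` V) = dim (UNIV :: ('v \<times> 'v) set)"
    by (rule dim_subspace_orthogonal_to_vectors[OF s subspace_UNIV]) simp
  moreover have "dim (prod.swap ` V) = dim V"
    by (rule dim_image_eq[OF linear_swap]) (auto simp: inj_on_def)
  ultimately show ?thesis by (simp add: dual_pair_swap orthogonal_def)
qed

lemma dim_lagrangian:
  fixes S :: "('v::euclidean_space \<times> 'v) set"
  assumes "lagrangian S"
  shows "dim S = DIM('v)"
proof -
  have "{x. \<forall>y\<in>S. dual_pair x y = 0} = S"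
    using assms unfolding lagrangian_def by (rule sym)
  then show ?thesis using dim_dual_complement[OF lagrangian_subspace[OF assms]] by simp
qed

text \<open>If \<open>dim V < n\<close>, choose \<open>a\<close> orthogonal to all \<open>X + \<xi>\<close> and \<open>b\<close> of the same length orthogonal to
  all \<open>X - \<xi>\<close>, \<open>(X, \<xi>) \<in> V\<close>; then \<open>(a + b, a - b)\<close> enlarges \<open>V\<close>.\<close>

lemma maximal_isotropic_lagrangian:
  fixes V :: "('v::euclidean_space \<times> 'v) set"
  assumes V: "subspace V" and iso: "\<And>x y. x \<in> V \<Longrightarrow> y \<in> V \<Longrightarrow> dual_pair x y = 0"
    and max: "\<And>W. subspace W \<Longrightarrow> V \<subseteq> W \<Longrightarrow> (\<And>x y. x \<in> W \<Longrightarrow> y \<in> W \<Longrightarrow> dual_pair x y = 0) \<Longrightarrow> W = V"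
  shows "lagrangian V"
proof -
  have "DIM('v) \<le> dim V"
  proof (rule ccontr)
    assume "\<not> DIM('v) \<le> dim V"
    then have small: "dim (f ` V) < DIM('v)" if "linear f" for f :: "'v \<times> 'v \<Rightarrow> 'v"
      using dim_image_le[OF that, of V] by linarith
    have lp: "linear (\<lambda>x :: 'v \<times> 'v. fst x + snd x)" and lm: "linear (\<lambda>x :: 'v \<times> 'v. fst x - snd x)"
      by (auto intro!: linearI simp: algebra_simps)
    obtain a0 where a0: "a0 \<noteq> 0" "\<And>x. x \<in> V \<Longrightarrow> a0 \<bullet> (fst x + snd x) = 0"
      using orthogonal_to_subspace_exists[OF small[OF lp]]
      by (metis (no_types, lifting) imageI orthogonal_def span_base)
    obtain b0 where b0: "b0 \<noteq> 0" "\<And>x. x \<in> V \<Longrightarrow> b0 \<bullet> (fst x - snd x) = 0"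
      using orthogonal_to_subspace_exists[OF small[OF lm]]
      by (metis (no_types, lifting) imageI orthogonal_def span_base)
    \<comment> \<open>Unit length makes
      \<open>dual_pair e e = 2 * (a \<bullet> a - b \<bullet> b)\<close> vanish for the vector
      \<open>e\<close> below.\<close>
    define a b where "a = a0 /\<^sub>R norm a0" and "b = b0 /\<^sub>R norm b0"
    define e where "e = (a + b, a - b)"
    have na: "a \<bullet> a = 1" "b \<bullet> b = 1" using a0(1) b0(1)
      by (simp_all add: a_def b_def power2_norm_eq_inner[symmetric] flip: power2_norm_eq_inner)
    have a: "a \<bullet> (fst x + snd x) = 0" "b \<bullet> (fst x - snd x) = 0" if "x \<in> V" for x
      using a0(2)[OF that] b0(2)[OF that] by (simp_all add: a_def b_def)
    have ex: "dual_pair e x = 0" if "x \<in> V" for x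
      using a[OF that] by (simp add: e_def dual_pair_def algebra_simps inner_commute)
    have ee: "dual_pair e e = 0"
      using na by (simp add: e_def algebra_simps inner_commute)
    \<comment> \<open>Otherwise \<open>a\<close> would be orthogonal to
      \<open>fst e + snd e = 2 *\<^sub>R a\<close>.\<close>
    have "e \<notin> V"
      using a(1)[of e] na by (auto simp: e_def algebra_simps)
    let ?W = "{x + r *\<^sub>R e | x r. x \<in> V}"
    have "subspace ?W"
    proof -
      have "?W = {x + y | x y. x \<in> V \<and> y \<in> span {e}}"
        unfolding span_singleton by blast
      then show ?thesis using subspace_sums[OF V subspace_span] by simp
    qed
    moreover have "V \<subseteq> ?W" by force
    moreover have "dual_pair x y = 0" if x: "x \<in> ?W" and y: "y \<in> ?W" for x y
    proof -
      obtain x' r where x': "x = x' + r *\<^sub>R e" "x' \<in> V" using x by blast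
      obtain y' s where y': "y = y' + s *\<^sub>R e" "y' \<in> V" using y by blast
      have "dual_pair x' y = 0"
        using iso[OF x'(2) y'(2)] ex[OF x'(2), unfolded dual_pair_sym[of e]]
        unfolding y' by (simp add: dual_pair_linear)
      moreover have "dual_pair e y = 0"
        using ex[OF y'(2)] ee
        unfolding y' by (simp add: dual_pair_linear)
      ultimately show ?thesis unfolding x' by (simp add: dual_pair_linear)
    qed
    ultimately have "?W = V" by (rule max)
    moreover have "e \<in> ?W"
      by (rule CollectI, rule exI[of _ 0], rule exI[of _ 1]) (simp add: subspace_0[OF V])
    ultimately show False using \<open>e \<notin> V\<close> by simp
  qed
  moreover define W where "W = {x. \<forall>y\<in>V. dual_pair x y = 0}"
  ultimately have "dim W \<le> dim V" using dim_dual_complement[OF V] unfolding W_def by linarith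
  moreover have "V \<subseteq> W" using iso unfolding W_def by blast
  moreover have "subspace W"
    unfolding subspace_def W_def by (simp add: dual_pair_linear) (simp add: dual_pair_def)
  ultimately have "V = W" using subspace_dim_equal[OF V] by blast
  then show ?thesis unfolding lagrangian_def W_def .
qed

lemma mem_double_orthogonal:
  fixes S :: "'a::euclidean_space set"
  assumes "subspace S" "\<And>y. (\<And>x. x \<in> S \<Longrightarrow> x \<bullet> y = 0) \<Longrightarrow> y \<bullet> u = 0"
  shows "u \<in> S"
proof -
  have "u \<in> orthogonal_comp (orthogonal_comp S)"
    using assms(2) by (auto simp: orthogonal_comp_def orthogonal_def)
  then show ?thesis using orthogonal_comp_self[OF assms(1)] by simp
qed

text \<open>A covector \<open>y\<close> killing every vector part of \<open>S\<close> pairs to 0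
  with all of \<open>S\<close>, so \<open>(0, y) \<in> S\<close>. Hence the pure covectors of
  \<open>S\<close> cut out the space of its vector parts.\<close>

lemma lagrangian_fst_image:
  fixes S :: "('v::euclidean_space \<times> 'v) set"
  assumes S: "lagrangian S" and Y: "\<And>\<zeta>. (0, \<zeta>) \<in> S \<Longrightarrow> \<zeta> \<bullet> Y = 0"
  shows "\<exists>\<kappa>. (Y, \<kappa>) \<in> S"
proof -
  have "Y \<in> fst ` S"
  proof (rule mem_double_orthogonal)
    show "subspace (fst ` S)" by (rule linear_subspace_image[OF linear_fst lagrangian_subspace[OF S]])
    fix y assume "\<And>x. x \<in> fst ` S \<Longrightarrow> x \<bullet> y = 0"
    then have "(0, y) \<in> S"
      by (intro lagrangian_memI[OF S]) (simp add: dual_pair_def inner_commute[of y])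
    then show "y \<bullet> Y = 0" by (rule Y)
  qed
  then show ?thesis by force
qed

text \<open>The backward image of a Lagrangian subspace is again maximal isotropic, whatever the
  rank of \<open>P\<close>: anything that pairs to 0 with it already comes from \<open>S\<close>. So
  one inclusion into an isotropic \<open>E\<close> forces equality.\<close>

lemma lagrangian_backward:
  fixes S :: "('v::euclidean_space \<times> 'v) set"
    and P P' :: "'v \<Rightarrow> 'v"
  assumes S: "lagrangian S" and P: "linear P" and P': "\<And>a w. P' a \<bullet> w = a \<bullet> P w"
    and sub: "\<And>w a. (P w, a) \<in> S \<Longrightarrow> (w, P' a) \<in> E"
    and iso: "\<And>x y. x \<in> E \<Longrightarrow> y \<in> E \<Longrightarrow> dual_pair x y = 0"
  shows "E = {(w, P' a) | w a. (P w, a) \<in> S}"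
proof (intro set_eqI iffI)
  fix x assume x: "x \<in> E"
  obtain w \<eta> where w: "x = (w, \<eta>)" by fastforce
  have P'': "w \<bullet> P' a = P w \<bullet> a" for a w by (metis P' inner_commute)
  have P'lin: "linear P'"
    by (rule linearI; rule vector_eq_rdot[THEN iffD1]) (simp_all add: P' inner_add_left)
  \<comment> \<open>The components are arranged so that \<open>y\<close> is Euclidean orthogonal to
    \<open>?T\<close> precisely when \<open>(P (fst y), snd y)\<close> annihilates \<open>S\<close>,
    hence lies in \<open>S\<close>.\<close>
  let ?T = "(\<lambda>x. (P' (snd x), fst x)) ` S"
  have "(\<eta>, P w) \<in> ?T"
  proof (rule mem_double_orthogonal)
    have "linear (\<lambda>x. (P' (snd x), fst x))"
      by (rule linearI) (simp_all add: linear_add[OF P'lin] linear_scale[OF P'lin])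
    then show "subspace ?T" using linear_subspace_image lagrangian_subspace[OF S] by blast
    fix y assume y: "\<And>x. x \<in> ?T \<Longrightarrow> x \<bullet> y = 0"
    have "(P (fst y), snd y) \<in> S"
    proof (rule lagrangian_memI[OF S])
      fix e assume "e \<in> S"
      then have "(P' (snd e), fst e) \<bullet> y = 0" using y by blast
      then show "dual_pair (P (fst y), snd y) e = 0"
        by (simp add: dual_pair_def inner_prod_def P' inner_commute[of "fst e"] inner_commute[of "P (fst y)"] add.commute)
    qed
    from iso[OF x sub[OF this]] show "y \<bullet> (\<eta>, P w) = 0"
      by (simp add: w P'' inner_prod_def inner_commute)
  qed
  then show "x \<in> {(w, P' a) | w a. (P w, a) \<in> S}" using w by force
next
  fix x assume "x \<in> {(w, P' a) | w a. (P w, a) \<in> S}"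
  then show "x \<in> E" using sub by blast
qed

lemma exists_orthogonal_of_dim_less:
  fixes A R :: "'a::euclidean_space set"
  assumes A: "subspace A" and R: "subspace R" and lt: "dim R < dim A"
  shows "\<exists>f\<in>A. f \<noteq> 0 \<and> (\<forall>\<rho>\<in>R. f \<bullet> \<rho> = 0)"
proof (rule ccontr)
  assume none: "\<not> ?thesis"
  let ?B = "{y \<in> UNIV. \<forall>x\<in>R. orthogonal x y}"
  have B: "subspace ?B" by (auto simp: subspace_def orthogonal_def inner_add_right)
  have "dim ?B + dim R = DIM('a)"
    using dim_subspace_orthogonal_to_vectors[OF R subspace_UNIV] by simp
  moreover have "A \<inter> ?B \<subseteq> {0}"
    using none by (auto simp: orthogonal_def inner_commute)
  then have "dim (A \<inter> ?B) = 0" by (simp add: dim_eq_0)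
  moreover have "dim {x + y |x y. x \<in> A \<and> y \<in> ?B} \<le> DIM('a)" by (rule dim_subset_UNIV)
  ultimately show False using dim_sums_Int[OF A B] lt by linarith
qed

section \<open>The local model of the blowdown map\<close>

text \<open>\<open>z\<close> stands for the coordinates \<open>(x, y)\<close> (with tildes in the paper) on \<open>U\<^sub>i\<close>; \<open>I\<close> indexes the \<open>x\<close>-part.\<close>

definition blowdown_coords :: "'n set \<Rightarrow> 'n \<Rightarrow> real^'n \<Rightarrow> real^'n::finite" where
  "blowdown_coords I i z = (\<chi> l. if l \<in> I - {i} then z $ i * z $ l else z $ l)"

definition blowdown_deriv :: "'n set \<Rightarrow> 'n \<Rightarrow> real^'n \<Rightarrow> real^'n \<Rightarrow> real^'n::finite" where
  "blowdown_deriv I i z w = (\<chi> l. if l \<in> I - {i} then w $ i * z $ l + z $ i * w $ l else w $ l)"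

text \<open>The transpose of \<open>blowdown_deriv I i z\<close>, that is, the pullback of
  covectors. At \<open>z $ i = 0\<close> its \<open>i\<close>-th entry evaluates \<open>a\<close> on
  a spanning vector of the line, and its other entries in \<open>I\<close> vanish.\<close>

definition blowdown_adjoint :: "'n set \<Rightarrow> 'n \<Rightarrow> real^'n \<Rightarrow> real^'n \<Rightarrow> real^'n::finite" where
  "blowdown_adjoint I i z a = (\<chi> l. if l = i then a $ i + (\<Sum>m\<in>I - {i}. z $ m * a $ m)
     else if l \<in> I then z $ i * a $ l else a $ l)"

lemma blowdown_adjoint_works:
  "blowdown_adjoint I i z a \<bullet> w = a \<bullet> blowdown_deriv I i z w"
proof -
  let ?J = "I - {i}"
  have "blowdown_adjoint I i z a \<bullet> w =
      blowdown_adjoint I i z a $ i * w $ i + (\<Sum>l\<in>UNIV - {i}. blowdown_adjoint I i z a $ l * w $ l)"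
    by (simp add: inner_vec_def sum.remove[of UNIV i])
  also have "(\<Sum>l\<in>UNIV - {i}. blowdown_adjoint I i z a $ l * w $ l) =
      (\<Sum>l\<in>UNIV - {i}. a $ l * (if l \<in> ?J then z $ i * w $ l else w $ l))"
    by (rule sum.cong) (auto simp: blowdown_adjoint_def)
  also have "blowdown_adjoint I i z a $ i * w $ i = a $ i * w $ i + (\<Sum>l\<in>?J. a $ l * (w $ i * z $ l))"
    by (simp add: blowdown_adjoint_def algebra_simps sum_distrib_left sum_distrib_right)
  also have "(\<Sum>l\<in>?J. a $ l * (w $ i * z $ l)) = (\<Sum>l\<in>UNIV - {i}. a $ l * (if l \<in> ?J then w $ i * z $ l else 0))"
    by (rule sum.mono_neutral_cong_left) auto
  finally have 1: "blowdown_adjoint I i z a \<bullet> w = a $ i * w $ i + (\<Sum>l\<in>UNIV - {i}.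
      a $ l * (if l \<in> ?J then w $ i * z $ l else 0) + a $ l * (if l \<in> ?J then z $ i * w $ l else w $ l))"
    by (simp add: sum.distrib)
  have "a \<bullet> blowdown_deriv I i z w = a $ i * w $ i + (\<Sum>l\<in>UNIV - {i}. a $ l * blowdown_deriv I i z w $ l)"
    by (simp add: inner_vec_def sum.remove[of UNIV i] blowdown_deriv_def)
  also have "(\<Sum>l\<in>UNIV - {i}. a $ l * blowdown_deriv I i z w $ l) = (\<Sum>l\<in>UNIV - {i}.
      a $ l * (if l \<in> ?J then w $ i * z $ l else 0) + a $ l * (if l \<in> ?J then z $ i * w $ l else w $ l))"
    by (rule sum.cong) (auto simp: blowdown_deriv_def algebra_simps)
  finally show ?thesis using 1 by simp
qed

lemma linear_blowdown_deriv: "linear (blowdown_deriv I i z)"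
  by (rule linearI) (auto simp: blowdown_deriv_def vec_eq_iff algebra_simps)

lemma blowdown_coords_has_derivative:
  fixes i :: "'n::finite"
  shows "(blowdown_coords I i has_derivative blowdown_deriv I i z) (at z)"
  unfolding has_derivative_componentwise_within[of "blowdown_coords I i"] Basis_vec_def
proof clarsimp
  fix l :: 'n
  have nth: "((\<lambda>x. x $ j) has_derivative (\<lambda>x. x $ j)) (at z)" for j
    by (rule bounded_linear_imp_has_derivative[OF bounded_linear_vec_nth])
  show "((\<lambda>x. blowdown_coords I i x \<bullet> axis l 1) has_derivative (\<lambda>x. blowdown_deriv I i z x \<bullet> axis l 1)) (at z)"
    by (cases "l \<in> I - {i}")
      (auto simp: blowdown_coords_def blowdown_deriv_def inner_axis intro!: nth derivative_eq_intros)
qed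

lemma smooth_on_blowdown_coords: "smooth_on UNIV (blowdown_coords I i)"
proof (rule smooth_on_vec[OF open_UNIV])
  fix l
  show "smooth_on UNIV (\<lambda>x. blowdown_coords I i x $ l)"
    using smooth_on_mult[OF open_UNIV smooth_on_bounded_linear[OF bounded_linear_vec_nth[of i]]
        smooth_on_bounded_linear[OF bounded_linear_vec_nth[of l]]]
      smooth_on_bounded_linear[OF bounded_linear_vec_nth[of l], of UNIV]
    by (cases "l \<in> I - {i}") (auto simp: blowdown_coords_def)
qed

text \<open>The component of \<open>X\<close> along the fibre of the projectivised normal bundle, for the line whose
  affine coordinates are \<open>z\<^sub>l\<close>.\<close>

definition fibre_part :: "'n set \<Rightarrow> 'n \<Rightarrow> real^'n \<Rightarrow> real^'n \<Rightarrow> real^'n::finite" where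
  "fibre_part I i z X = (\<chi> l. if l \<in> I - {i} then X $ l - z $ l * X $ i else 0)"

definition off_fibre :: "'n set \<Rightarrow> 'n \<Rightarrow> real^'n \<Rightarrow> real^'n::finite" where
  "off_fibre I i X = (\<chi> l. if l \<in> I - {i} then 0 else X $ l)"

lemma fibre_part_linear:
  "fibre_part I i z (X + Y) = fibre_part I i z X + fibre_part I i z Y"
  "fibre_part I i z (r *\<^sub>R X) = r *\<^sub>R fibre_part I i z X"
  "fibre_part I i z 0 = 0"
  by (auto simp: fibre_part_def vec_eq_iff algebra_simps)

text \<open>\<open>transv\<close> is the dual form of \<open>TN + pr L = TM\<close>: the fibre contains no nonzero conormal covector.\<close>

definition transv :: "'n set \<Rightarrow> ((real^'n) \<times> (real^'n)) set \<Rightarrow> bool" where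
  "transv I S \<longleftrightarrow> (\<forall>\<zeta>. (\<forall>l. l \<notin> I \<longrightarrow> \<zeta> $ l = 0) \<longrightarrow> (0, \<zeta>) \<in> S \<longrightarrow> \<zeta> = 0)"

definition invar :: "'n set \<Rightarrow> ((real^'n) \<times> (real^'n)) set \<Rightarrow> bool" where
  "invar I S \<longleftrightarrow> (\<forall>X \<xi>. (X, \<xi>) \<in> S \<longrightarrow> (\<forall>l\<in>I. X $ l = 0))"

section \<open>Limits in the local model\<close>

lemma directional_difference_tendsto:
  fixes f :: "'a::real_normed_vector \<Rightarrow> 'b::real_normed_vector" and t :: "nat \<Rightarrow> real"
  assumes f: "(f has_derivative D) (at x)" and t: "t \<longlonglongrightarrow> 0" "\<And>n. t n \<noteq> 0"
  shows "(\<lambda>n. (f (x + t n *\<^sub>R d) - f x) /\<^sub>R t n) \<longlonglongrightarrow> D d"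
proof -
  have "((\<lambda>s. f (x + s *\<^sub>R d)) has_derivative (\<lambda>s. D (s *\<^sub>R d))) (at 0)"
    by (rule has_derivative_compose[of "\<lambda>s. x + s *\<^sub>R d" _ _ _ f])
      (use f in \<open>auto intro!: derivative_eq_intros\<close>)
  then have "(\<lambda>s. norm (f (x + s *\<^sub>R d) - f x - D (s *\<^sub>R d)) / norm s) \<midarrow>0\<rightarrow> 0"
    by (simp add: has_derivative_at)
  then have "(\<lambda>n. norm (f (x + t n *\<^sub>R d) - f x - D (t n *\<^sub>R d)) / norm (t n)) \<longlonglongrightarrow> 0"
    by (rule filterlim_compose) (use t in \<open>simp add: filterlim_at\<close>)
  moreover have "norm ((f (x + t n *\<^sub>R d) - f x) /\<^sub>R t n - D d)
      = norm (f (x + t n *\<^sub>R d) - f x - D (t n *\<^sub>R d)) / norm (t n)" for n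
  proof -
    have "D (t n *\<^sub>R d) = t n *\<^sub>R D d" by (rule linear_scale[OF has_derivative_linear[OF f]])
    then have "(f (x + t n *\<^sub>R d) - f x) /\<^sub>R t n - D d = (f (x + t n *\<^sub>R d) - f x - D (t n *\<^sub>R d)) /\<^sub>R t n"
      using t(2)[of n] by (simp add: scaleR_right_diff_distrib)
    then show ?thesis by (simp add: divide_inverse)
  qed
  ultimately have "(\<lambda>n. norm ((f (x + t n *\<^sub>R d) - f x) /\<^sub>R t n - D d)) \<longlonglongrightarrow> 0"
    by simp
  then have "(\<lambda>n. (f (x + t n *\<^sub>R d) - f x) /\<^sub>R t n - D d) \<longlonglongrightarrow> 0"
    by (rule tendsto_norm_zero_cancel)
  then show ?thesis by (simp add: LIM_zero_iff)
qed

lemma blowdown_adjoint_tendsto: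
  assumes "(f \<longlongrightarrow> z) F" "(g \<longlongrightarrow> a) F"
  shows "((\<lambda>x. blowdown_adjoint I i (f x) (g x)) \<longlongrightarrow> blowdown_adjoint I i z a) F"
proof (rule vec_tendstoI)
  fix l
  show "((\<lambda>x. blowdown_adjoint I i (f x) (g x) $ l) \<longlongrightarrow> blowdown_adjoint I i z a $ l) F"
    by (cases "l = i"; cases "l \<in> I") (auto simp: blowdown_adjoint_def intro!: tendsto_intros assms)
qed

lemma fibre_part_tendsto:
  assumes "(f \<longlongrightarrow> z) F" "(g \<longlongrightarrow> a) F"
  shows "((\<lambda>x. fibre_part I i (f x) (g x)) \<longlongrightarrow> fibre_part I i z a) F"
proof (rule vec_tendstoI)
  fix l
  show "((\<lambda>x. fibre_part I i (f x) (g x) $ l) \<longlongrightarrow> fibre_part I i z a $ l) F"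
    by (cases "l \<in> I - {i}") (auto simp: fibre_part_def intro!: tendsto_intros assms)
qed

lemma off_fibre_tendsto:
  assumes "(g \<longlongrightarrow> a) F"
  shows "((\<lambda>x. off_fibre I i (g x)) \<longlongrightarrow> off_fibre I i a) F"
proof (rule vec_tendstoI)
  fix l
  show "((\<lambda>x. off_fibre I i (g x) $ l) \<longlongrightarrow> off_fibre I i a $ l) F"
    by (cases "l \<in> I - {i}") (auto simp: off_fibre_def intro!: tendsto_intros assms)
qed

lemma blowdown_coords_exceptional:
  "z $ i = 0 \<Longrightarrow> blowdown_coords I i z $ l = (if l \<in> I - {i} then 0 else z $ l)"
  by (simp add: blowdown_coords_def)

text \<open>The annihilator of all vector parts together with the tangent directions consists of the
  conormal \<open>y\<close> with \<open>(0, y) \<in> S\<close>, which \<open>transv\<close> makes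
  trivial. The right-hand side is the form in which vectors with prescribed normal components are
  obtained.\<close>

lemma transv_iff:
  assumes S: "lagrangian (S :: ((real^'n::finite) \<times> (real^'n)) set)"
  shows "transv I S \<longleftrightarrow> (\<forall>u. \<exists>X \<xi>. (X, \<xi>) \<in> S \<and> (\<forall>l\<in>I. X $ l = u $ l))"
proof
  assume T: "transv I S"
  show "\<forall>u. \<exists>X \<xi>. (X, \<xi>) \<in> S \<and> (\<forall>l\<in>I. X $ l = u $ l)"
  proof
    fix u :: "real^'n"
    let ?N = "{v :: real^'n. \<forall>l\<in>I. v $ l = 0}"
    let ?W = "{x + y | x y. x \<in> fst ` S \<and> y \<in> ?N}"
    have N: "subspace ?N" by (auto simp: subspace_def)
    have "u \<in> ?W"
    proof (rule mem_double_orthogonal)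
      show "subspace ?W"
        by (rule subspace_sums[OF linear_subspace_image[OF linear_fst lagrangian_subspace[OF S]] N])
      fix y assume y: "\<And>x. x \<in> ?W \<Longrightarrow> x \<bullet> y = 0"
      have 1: "x \<bullet> y = 0" if "x \<in> fst ` S" for x
      proof -
        have "x + 0 \<in> ?W" using that subspace_0[OF N] by blast
        then show ?thesis using y by fastforce
      qed
      have "0 \<in> fst ` S" using subspace_0[OF lagrangian_subspace[OF S]] by force
      then have 2: "x \<bullet> y = 0" if "x \<in> ?N" for x
      proof -
        have "0 + x \<in> ?W" using that \<open>0 \<in> fst ` S\<close> by blast
        then show ?thesis using y by fastforce
      qed
      have "y $ l = 0" if "l \<notin> I" for l
        proof -
        have "(axis l 1 :: real^'n) \<in> ?N" using that by (auto simp: axis_def)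
        from 2[OF this] show ?thesis by (simp add: inner_axis')
      qed
      moreover have "(0, y) \<in> S"
        using 1 by (intro lagrangian_memI[OF S]) (simp add: dual_pair_def inner_commute[of y])
      ultimately have "y = 0" using T by (simp add: transv_def)
      then show "y \<bullet> u = 0" by simp
    qed
    then obtain e y where "e \<in> S" "y \<in> ?N" "u = fst e + y" by blast
    then show "\<exists>X \<xi>. (X, \<xi>) \<in> S \<and> (\<forall>l\<in>I. X $ l = u $ l)"
      by (intro exI[of _ "fst e"] exI[of _ "snd e"]) auto
  qed
next
  assume R: "\<forall>u. \<exists>X \<xi>. (X, \<xi>) \<in> S \<and> (\<forall>l\<in>I. X $ l = u $ l)"
  show "transv I S"
    unfolding transv_def
  proof (intro allI impI)
    fix \<zeta> assume \<zeta>: "\<forall>l. l \<notin> I \<longrightarrow> \<zeta> $ l = 0" "(0, \<zeta>) \<in> S"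
    obtain X \<xi> where X: "(X, \<xi>) \<in> S" "\<forall>l\<in>I. X $ l = \<zeta> $ l" using R by blast
    have "\<zeta> \<bullet> X = 0" using lagrangian_isotropic[OF S \<zeta>(2) X(1)] by simp
    moreover have "\<zeta> \<bullet> X = \<zeta> \<bullet> \<zeta>"
      unfolding inner_vec_def using X(2) \<zeta>(1) by (intro sum.cong) auto
    ultimately show "\<zeta> = 0" by simp
  qed
qed

definition null_seq :: "nat \<Rightarrow> real" where "null_seq n = inverse (real (Suc n))"

lemma null_seq: "null_seq \<longlonglongrightarrow> 0" "null_seq n \<noteq> 0"
  using LIMSEQ_inverse_real_of_nat by (auto simp: null_seq_def[abs_def])

text \<open>First-order data of a section at one point: differentiability at \<open>x\<close> with
  derivative \<open>D\<close>, and membership in the fibres near \<open>x\<close>.\<close>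

definition local_section where
  "local_section L x \<sigma> D \<longleftrightarrow> (\<sigma> has_derivative D) (at x) \<and> (\<forall>\<^sub>F y in nhds x. \<sigma> y \<in> L y)"

text \<open>Every \<open>f\<close> in the limiting fibre is the value of a section, and pairing with
  this section is continuous; so \<open>e0\<close> pairs to 0 with the fibre and belongs to
  it.\<close>

lemma lagrangian_family_closed:
  assumes U: "open U" and lag: "\<And>x. x \<in> U \<Longrightarrow> lagrangian (F x)"
    and sec: "\<And>f. f \<in> F x \<Longrightarrow> \<exists>\<sigma> D. local_section F x \<sigma> D \<and> \<sigma> x = f"
    and x: "x \<in> U" and y: "y \<longlonglongrightarrow> x" and e: "e \<longlonglongrightarrow> e0" and ev: "\<forall>\<^sub>F n in sequentially. e n \<in> F (y n)"
  shows "e0 \<in> F x"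
proof (rule lagrangian_memI[OF lag[OF x]])
  fix f assume "f \<in> F x"
  then obtain \<sigma> D where \<sigma>: "local_section F x \<sigma> D" "\<sigma> x = f" using sec by blast
  have "isCont \<sigma> x" using \<sigma>(1) has_derivative_continuous by (auto simp: local_section_def)
  then have lim: "(\<lambda>n. \<sigma> (y n)) \<longlonglongrightarrow> f" using y \<sigma>(2) isCont_tendsto_compose by metis
  have evU: "\<forall>\<^sub>F n in sequentially. y n \<in> U"
    using y U x by (rule topological_tendstoD)
  have ev\<sigma>: "\<forall>\<^sub>F n in sequentially. \<sigma> (y n) \<in> F (y n)"
    using \<sigma>(1) y by (auto simp: local_section_def intro: eventually_compose_filterlim)
  have "(\<lambda>n. dual_pair (e n) (\<sigma> (y n))) \<longlonglongrightarrow> dual_pair e0 f"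
    unfolding dual_pair_def by (intro tendsto_intros e lim)
  moreover have "\<forall>\<^sub>F n in sequentially. dual_pair (e n) (\<sigma> (y n)) = 0"
    using ev evU ev\<sigma> by eventually_elim (rule lagrangian_isotropic[OF lag])
  then have "(\<lambda>n. dual_pair (e n) (\<sigma> (y n))) \<longlonglongrightarrow> 0" by (rule tendsto_eventually)
  ultimately show "dual_pair e0 f = 0" using LIMSEQ_unique by blast
qed

text \<open>\<open>L\<close> is a Dirac structure in a submanifold chart with image \<open>U\<close>, and \<open>E i\<close> its lift in the chart \<open>U\<^sub>i\<close>.
  \<open>inv\<close> is all that is needed of involutivity.\<close>

locale lift_model =
  fixes I :: "'n::finite set" and U :: "(real^'n) set"
    and L :: "real^'n \<Rightarrow> ((real^'n) \<times> (real^'n)) set"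
    and E :: "'n \<Rightarrow> real^'n \<Rightarrow> ((real^'n) \<times> (real^'n)) set"
  assumes card_I: "card I > 1"
    and open_U: "open U"
    and lag: "x \<in> U \<Longrightarrow> lagrangian (L x)"
    and sec: "x \<in> U \<Longrightarrow> e \<in> L x \<Longrightarrow> \<exists>\<sigma> D. local_section L x \<sigma> D \<and> \<sigma> x = e"
    and inv: "x \<in> U \<Longrightarrow> (Y, \<eta>) \<in> L x \<Longrightarrow> (0, \<zeta>) \<in> L x \<Longrightarrow>
      \<exists>\<sigma> D. local_section L x \<sigma> D \<and> \<sigma> x = (0, \<zeta>) \<and>
        (\<forall>\<zeta>'. (0, \<zeta>') \<in> L x \<longrightarrow> \<zeta>' \<bullet> fst (D Y) = 0)"
    and E_lag: "i \<in> I \<Longrightarrow> blowdown_coords I i z \<in> U \<Longrightarrow> lagrangian (E i z)"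
    and E_closed: "i \<in> I \<Longrightarrow> blowdown_coords I i z \<in> U \<Longrightarrow> \<forall>\<^sub>F n in sequentially. s n \<in> E i (y n) \<Longrightarrow>
      y \<longlonglongrightarrow> z \<Longrightarrow> s \<longlonglongrightarrow> e0 \<Longrightarrow> e0 \<in> E i z"
    and E_off: "i \<in> I \<Longrightarrow> blowdown_coords I i z \<in> U \<Longrightarrow> z $ i \<noteq> 0 \<Longrightarrow>
      (blowdown_deriv I i z w, a) \<in> L (blowdown_coords I i z) \<Longrightarrow> (w, blowdown_adjoint I i z a) \<in> E i z"
begin

lemma L_closed:
  assumes "x \<in> U" "y \<longlonglongrightarrow> x" "e \<longlonglongrightarrow> e0" "\<forall>\<^sub>F n in sequentially. e n \<in> L (y n)"
  shows "e0 \<in> L x"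
  by (rule lagrangian_family_closed[OF open_U lag sec[OF assms(1)] assms])

lemma E_isotropic:
  "i \<in> I \<Longrightarrow> blowdown_coords I i z \<in> U \<Longrightarrow> e \<in> E i z \<Longrightarrow> f \<in> E i z \<Longrightarrow> dual_pair e f = 0"
  by (rule lagrangian_isotropic[OF E_lag])

lemma E_subspace: "i \<in> I \<Longrightarrow> blowdown_coords I i z \<in> U \<Longrightarrow> subspace (E i z)"
  by (rule lagrangian_subspace[OF E_lag])

text \<open>Transport of a section of \<open>L\<close> along the curve \<open>t \<mapsto> x + t d\<close>, which lifts to the curve
  \<open>t \<mapsto> z + t (d off the fibre)\<close> transverse to the exceptional divisor.\<close>

lemma E_along_curve:
  assumes i: "i \<in> I" and z: "z $ i = 0" and x: "x = blowdown_coords I i z" and U: "x \<in> U"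
    and \<sigma>: "local_section L x \<sigma> D" and d: "d $ i = 1" "\<forall>l\<in>I - {i}. d $ l = z $ l"
    and t: "t \<longlonglongrightarrow> 0" "\<And>n. t n \<noteq> 0"
  defines "y \<equiv> \<lambda>n::nat. z + t n *\<^sub>R off_fibre I i d"
    and "s \<equiv> \<lambda>n. \<sigma> (x + t n *\<^sub>R d)"
  shows "\<forall>\<^sub>F n in sequentially.
      ((1 / t n) *\<^sub>R fibre_part I i z (fst (s n)) + off_fibre I i (fst (s n)),
        blowdown_adjoint I i (y n) (snd (s n))) \<in> E i (y n)"
    and "y \<longlonglongrightarrow> z" and "s \<longlonglongrightarrow> \<sigma> x"
    and "(\<lambda>n. (s n - \<sigma> x) /\<^sub>R t n) \<longlonglongrightarrow> D d"
proof -
  have \<sigma>D: "(\<sigma> has_derivative D) (at x)" using \<sigma> by (simp add: local_section_def)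
  show "(\<lambda>n. (s n - \<sigma> x) /\<^sub>R t n) \<longlonglongrightarrow> D d"
    unfolding s_def by (rule directional_difference_tendsto[OF \<sigma>D t])
  have "(\<lambda>n. z + t n *\<^sub>R off_fibre I i d) \<longlonglongrightarrow> z + 0 *\<^sub>R off_fibre I i d"
    by (intro tendsto_intros t)
  then show ylim: "y \<longlonglongrightarrow> z" by (simp add: y_def)
  have "(\<lambda>n. x + t n *\<^sub>R d) \<longlonglongrightarrow> x + 0 *\<^sub>R d" by (intro tendsto_intros t)
  then have xlim: "(\<lambda>n. x + t n *\<^sub>R d) \<longlonglongrightarrow> x" by simp
  then show "s \<longlonglongrightarrow> \<sigma> x"
    unfolding s_def using has_derivative_continuous[OF \<sigma>D] isCont_tendsto_compose by blast
  \<comment> \<open>The lifted curve lies over \<open>x + t d\<close> exactly, not merely to first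
    order, so values of the section along that line can be transported.\<close>
  have bd: "blowdown_coords I i (y n) = x + t n *\<^sub>R d" for n
    using z d x i by (auto simp: blowdown_coords_def y_def off_fibre_def vec_eq_iff)
  have yi: "y n $ i = t n" for n using z d i by (simp add: y_def off_fibre_def)
  \<comment> \<open>For \<open>t n \<noteq> 0\<close> the tangent map is invertible, and the
    preimage of \<open>X\<close> has its fibre component divided by \<open>t n\<close>. This is the
    pole that the next two lemmas treat.\<close>
  have deriv: "blowdown_deriv I i (y n) ((1 / t n) *\<^sub>R fibre_part I i z X + off_fibre I i X) = X" for n X
    using yi[of n] t(2)[of n]
    by (auto simp: blowdown_deriv_def vec_eq_iff fibre_part_def off_fibre_def y_def)
  have "\<forall>\<^sub>F n in sequentially. x + t n *\<^sub>R d \<in> U"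
    using xlim open_U U by (rule topological_tendstoD)
  moreover have "\<forall>\<^sub>F n in sequentially. s n \<in> L (x + t n *\<^sub>R d)"
    using \<sigma> xlim unfolding s_def by (auto simp: local_section_def intro: eventually_compose_filterlim)
  ultimately show "\<forall>\<^sub>F n in sequentially.
      ((1 / t n) *\<^sub>R fibre_part I i z (fst (s n)) + off_fibre I i (fst (s n)),
        blowdown_adjoint I i (y n) (snd (s n))) \<in> E i (y n)"
  proof eventually_elim
    case (elim n)
    show ?case
      by (rule E_off[OF i]) (use elim t(2)[of n] yi[of n] in \<open>simp_all add: bd deriv\<close>)
  qed
qed

text \<open>Multiplying the transported section by \<open>t\<close> leaves only its polar part: the
  covector and the components off the fibre tend to 0.\<close>

lemma E_fibre:
  assumes i: "i \<in> I" and z: "z $ i = 0" and U: "blowdown_coords I i z \<in> U"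
    and e: "(X, \<xi>) \<in> L (blowdown_coords I i z)"
  shows "(fibre_part I i z X, 0) \<in> E i z"
proof -
  let ?x = "blowdown_coords I i z"
  obtain \<sigma> D where \<sigma>: "local_section L ?x \<sigma> D" "\<sigma> ?x = (X, \<xi>)" using sec[OF U e] by blast
  define d where "d = (\<chi> l. if l = i then 1 else z $ l)"
  have d: "d $ i = 1" "\<forall>l\<in>I - {i}. d $ l = z $ l" by (auto simp: d_def)
  note C = E_along_curve[OF i z refl U \<sigma>(1) d null_seq]
  let ?y = "\<lambda>n. z + null_seq n *\<^sub>R off_fibre I i d" and ?s = "\<lambda>n. \<sigma> (?x + null_seq n *\<^sub>R d)"
  let ?e = "\<lambda>n. (fibre_part I i z (fst (?s n)) + null_seq n *\<^sub>R off_fibre I i (fst (?s n)),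
        null_seq n *\<^sub>R blowdown_adjoint I i (?y n) (snd (?s n)))"
  have "\<forall>\<^sub>F n in sequentially. blowdown_coords I i (?y n) \<in> U"
  proof -
    have "isCont (blowdown_coords I i) z"
      using has_derivative_continuous[OF blowdown_coords_has_derivative] .
    then show ?thesis
      using C(2) isCont_tendsto_compose topological_tendstoD[OF _ open_U U] by blast
  qed
  with C(1) have ev: "\<forall>\<^sub>F n in sequentially. ?e n \<in> E i (?y n)"
  proof eventually_elim
    case (elim n)
    from subspace_scale[OF E_subspace[OF i elim(2)] elim(1), of "null_seq n"] show ?case
      using null_seq(2)[of n] by (simp add: scaleR_add_right)
  qed
  have s1: "(\<lambda>n. fst (?s n)) \<longlonglongrightarrow> X" and s2: "(\<lambda>n. snd (?s n)) \<longlonglongrightarrow> \<xi>"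
    using tendsto_fst[OF C(3)] tendsto_snd[OF C(3)] \<sigma>(2) by simp_all
  have "?e \<longlonglongrightarrow> (fibre_part I i z X + 0 *\<^sub>R off_fibre I i X, 0 *\<^sub>R blowdown_adjoint I i z \<xi>)"
    by (intro tendsto_intros fibre_part_tendsto off_fibre_tendsto blowdown_adjoint_tendsto null_seq s1 s2 C(2))
  then have "?e \<longlonglongrightarrow> (fibre_part I i z X, 0)" by simp
  from E_closed[OF i U ev C(2) this] show ?thesis .
qed

text \<open>As the fibre part of \<open>X\<close> vanishes, the polar term is a difference quotient
  of the section and tends to its derivative along \<open>d\<close>. The components of
  \<open>d\<close> outside \<open>I\<close> are free, so that \<open>d = X0 + s *\<^sub>R u\<close>
  can be inserted later.\<close>

lemma E_section:
  assumes i: "i \<in> I" and z: "z $ i = 0" and U: "blowdown_coords I i z \<in> U"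
    and \<sigma>: "local_section L (blowdown_coords I i z) \<sigma> D" "\<sigma> (blowdown_coords I i z) = (X, \<xi>)"
    and X: "fibre_part I i z X = 0"
    and d: "d $ i = 1" "\<forall>l\<in>I - {i}. d $ l = z $ l"
  shows "(fibre_part I i z (fst (D d)) + off_fibre I i X, blowdown_adjoint I i z \<xi>) \<in> E i z"
proof -
  let ?x = "blowdown_coords I i z"
  note C = E_along_curve[OF i z refl U \<sigma>(1) d null_seq]
  let ?y = "\<lambda>n. z + null_seq n *\<^sub>R off_fibre I i d" and ?s = "\<lambda>n. \<sigma> (?x + null_seq n *\<^sub>R d)"
  have s1: "(\<lambda>n. fst (?s n)) \<longlonglongrightarrow> X" and s2: "(\<lambda>n. snd (?s n)) \<longlonglongrightarrow> \<xi>"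
    using tendsto_fst[OF C(3)] tendsto_snd[OF C(3)] \<sigma>(2) by simp_all
  have "(\<lambda>n. fibre_part I i z (fst ((?s n - \<sigma> ?x) /\<^sub>R null_seq n))) \<longlonglongrightarrow> fibre_part I i z (fst (D d))"
    by (intro fibre_part_tendsto tendsto_const tendsto_fst C(4))
  moreover have "fibre_part I i z (fst ((?s n - \<sigma> ?x) /\<^sub>R null_seq n)) = (1 / null_seq n) *\<^sub>R fibre_part I i z (fst (?s n))" for n
    using fibre_part_linear(1)[of I i z "fst (?s n)" "- X"] fibre_part_linear(2)[of I i z "-1" X] X
    by (simp add: \<sigma>(2) fibre_part_linear divide_inverse)
  ultimately have w1: "(\<lambda>n. (1 / null_seq n) *\<^sub>R fibre_part I i z (fst (?s n))) \<longlonglongrightarrow> fibre_part I i z (fst (D d))"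
    by simp
  have "(\<lambda>n. ((1 / null_seq n) *\<^sub>R fibre_part I i z (fst (?s n)) + off_fibre I i (fst (?s n)),
        blowdown_adjoint I i (?y n) (snd (?s n)))) \<longlonglongrightarrow>
      (fibre_part I i z (fst (D d)) + off_fibre I i X, blowdown_adjoint I i z \<xi>)"
    by (intro tendsto_Pair tendsto_add w1 off_fibre_tendsto blowdown_adjoint_tendsto s1 s2 C(2))
  from E_closed[OF i U C(1) C(2) this] show ?thesis .
qed

text \<open>The fibre component of the limit is a derivative of the section and remains unspecified;
  at \<open>z $ i = 0\<close> the tangent map kills it, so \<open>w\<close> still maps to
  \<open>X\<close>.\<close>

lemma E_lift:
  assumes i: "i \<in> I" and z: "z $ i = 0" and U: "blowdown_coords I i z \<in> U"
    and e: "(X, \<xi>) \<in> L (blowdown_coords I i z)" and X: "fibre_part I i z X = 0"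
  shows "\<exists>w. blowdown_deriv I i z w = X \<and> (\<forall>l. l \<notin> I - {i} \<longrightarrow> w $ l = X $ l) \<and> (w, blowdown_adjoint I i z \<xi>) \<in> E i z"
proof -
  let ?x = "blowdown_coords I i z"
  obtain \<sigma> D where \<sigma>: "local_section L ?x \<sigma> D" "\<sigma> ?x = (X, \<xi>)" using sec[OF U e] by blast
  define d where "d = (\<chi> l. if l = i then 1 else z $ l)"
  have d: "d $ i = 1" "\<forall>l\<in>I - {i}. d $ l = z $ l" by (auto simp: d_def)
  let ?w = "fibre_part I i z (fst (D d)) + off_fibre I i X"
  have Xl: "X $ l = z $ l * X $ i" if "l \<in> I - {i}" for l
    using X that by (auto simp: fibre_part_def vec_eq_iff split: if_splits)
  have wl: "?w $ l = X $ l" if "l \<notin> I - {i}" for l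
    using that by (auto simp: fibre_part_def off_fibre_def)
  moreover have "blowdown_deriv I i z ?w = X"
    using Xl wl[of i] wl z by (simp add: blowdown_deriv_def vec_eq_iff)
  moreover have "(?w, blowdown_adjoint I i z \<xi>) \<in> E i z" by (rule E_section[OF i z U \<sigma> X d])
  ultimately show ?thesis by blast
qed

lemma fibre_part_deriv: "z $ i = 0 \<Longrightarrow> fibre_part I i z (blowdown_deriv I i z w) = 0"
  by (auto simp: fibre_part_def blowdown_deriv_def vec_eq_iff)

text \<open>Pullback is adjoint to pushforward, so the forward image is isotropic and by maximality
  only has to contain \<open>L\<close>. On the divisor invariance ensures this: vector parts without
  normal components create no pole.\<close>

lemma forward_model:
  assumes i: "i \<in> I" and U: "blowdown_coords I i z \<in> U"
    and inv: "z $ i = 0 \<Longrightarrow> invar I (L (blowdown_coords I i z))"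
  shows "{(blowdown_deriv I i z w, a) | w a. (w, blowdown_adjoint I i z a) \<in> E i z} = L (blowdown_coords I i z)"
proof (rule lagrangian_maximal[OF lag[OF U]])
  show "L (blowdown_coords I i z) \<subseteq> {(blowdown_deriv I i z w, a) | w a. (w, blowdown_adjoint I i z a) \<in> E i z}"
  proof clarify
    fix X \<xi> assume e: "(X, \<xi>) \<in> L (blowdown_coords I i z)"
    show "\<exists>w a. (X, \<xi>) = (blowdown_deriv I i z w, a) \<and> (w, blowdown_adjoint I i z a) \<in> E i z"
    proof (cases "z $ i = 0")
      case True
      then have "fibre_part I i z X = 0"
        using inv e i by (auto simp: invar_def fibre_part_def vec_eq_iff)
      from E_lift[OF i True U e this] show ?thesis by blast
    next
      case False
      let ?w = "\<chi> l. if l \<in> I - {i} then (X $ l - X $ i * z $ l) / z $ i else X $ l"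
      have "blowdown_deriv I i z ?w = X" using False by (auto simp: blowdown_deriv_def vec_eq_iff)
      moreover from this e have "(?w, blowdown_adjoint I i z \<xi>) \<in> E i z"
        by (intro E_off[OF i U False]) simp
      ultimately show ?thesis by (intro exI[of _ ?w] exI[of _ \<xi>]) simp
    qed
  qed
next
  fix x y
  assume "x \<in> {(blowdown_deriv I i z w, a) | w a. (w, blowdown_adjoint I i z a) \<in> E i z}"
    "y \<in> {(blowdown_deriv I i z w, a) | w a. (w, blowdown_adjoint I i z a) \<in> E i z}"
  then obtain w a w' a' where x: "x = (blowdown_deriv I i z w, a)" "(w, blowdown_adjoint I i z a) \<in> E i z"
    and y: "y = (blowdown_deriv I i z w', a')" "(w', blowdown_adjoint I i z a') \<in> E i z" by blast
  from E_isotropic[OF i U x(2) y(2)] show "dual_pair x y = 0"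
    unfolding x(1) y(1)
    by (simp add: blowdown_adjoint_works inner_commute[of w] inner_commute[of "blowdown_deriv I i z w"])
qed

text \<open>Transversality allows the normal components of a vector part to be prescribed. With
  \<open>i\<close>-th entry 0 and the others given by \<open>u\<close>, its fibre part is
  \<open>u\<close> itself.\<close>

lemma E_vertical:
  assumes i: "i \<in> I" and z: "z $ i = 0" and U: "blowdown_coords I i z \<in> U"
    and T: "transv I (L (blowdown_coords I i z))" and u: "\<And>l. l \<notin> I - {i} \<Longrightarrow> u $ l = 0"
  shows "(u, 0) \<in> E i z"
proof -
  obtain X \<xi> where X: "(X, \<xi>) \<in> L (blowdown_coords I i z)" "\<forall>l\<in>I. X $ l = u $ l"
    using T unfolding transv_iff[OF lag[OF U]] by blast
  have "fibre_part I i z X = u"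
    using X(2) u i by (auto simp: fibre_part_def vec_eq_iff)
  with E_fibre[OF i z U X(1)] show ?thesis by simp
qed

text \<open>\<open>E_lift\<close> lifts each element of the backward image up to a vector along the
  fibre, and \<open>E_vertical\<close> removes this error; \<open>lagrangian_backward\<close> then
  gives equality.\<close>

lemma backward_model:
  assumes i: "i \<in> I" and z: "z $ i = 0" and U: "blowdown_coords I i z \<in> U"
    and T: "transv I (L (blowdown_coords I i z))"
  shows "E i z = {(w, blowdown_adjoint I i z a) | w a. (blowdown_deriv I i z w, a) \<in> L (blowdown_coords I i z)}"
proof (rule lagrangian_backward[OF lag[OF U] linear_blowdown_deriv blowdown_adjoint_works _ E_isotropic[OF i U]])
  fix w a assume e: "(blowdown_deriv I i z w, a) \<in> L (blowdown_coords I i z)"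
  obtain w' where w': "blowdown_deriv I i z w' = blowdown_deriv I i z w"
    "\<forall>l. l \<notin> I - {i} \<longrightarrow> w' $ l = blowdown_deriv I i z w $ l" "(w', blowdown_adjoint I i z a) \<in> E i z"
    using E_lift[OF i z U e fibre_part_deriv[OF z]] by blast
  have "(w - w', 0) \<in> E i z"
    by (rule E_vertical[OF i z U T]) (use w'(2) in \<open>auto simp: blowdown_deriv_def\<close>)
  from subspace_add[OF E_subspace[OF i U] w'(3) this] show "(w, blowdown_adjoint I i z a) \<in> E i z" by simp
qed

end

context lift_model
begin

text \<open>If \<open>0 \<noteq> pr L \<subset> \<nu>\<close> at \<open>x\<close>, take a line inside \<open>pr L\<close> and approach it by the lines through
  \<open>X\<^sub>0 + s u\<close>, where \<open>\<zeta> u = 1\<close> for a conormal \<open>\<zeta>\<close> annihilating \<open>pr L\<close>. Involutivity makes the lift of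
  \<open>\<zeta>\<close> divisible by \<open>s\<close>, and \<open>(0, dx\<^sub>i)\<close> survives in the limit; it pairs nontrivially with the lift of
  \<open>X\<^sub>0\<close>.\<close>

lemma transv_or_invar:
  assumes x: "x \<in> U" "\<And>l. l \<in> I \<Longrightarrow> x $ l = 0"
  shows "transv I (L x) \<or> invar I (L x)"
proof (rule ccontr)
  assume neg: "\<not> (transv I (L x) \<or> invar I (L x))"
  note sub = lagrangian_subspace[OF lag[OF x(1)]]
  obtain \<zeta> where \<zeta>: "\<And>l. l \<notin> I \<Longrightarrow> \<zeta> $ l = 0" "(0, \<zeta>) \<in> L x" "\<zeta> \<noteq> 0"
    using neg by (auto simp: transv_def)
  obtain X1 \<xi>1 i where X1: "(X1, \<xi>1) \<in> L x" "i \<in> I" "X1 $ i \<noteq> 0"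
    using neg by (auto simp: invar_def)
  \<comment> \<open>Normalised so that the entries of \<open>X0\<close> are the affine coordinates
    of its own line in the chart with index \<open>i\<close>.\<close>
  define X0 \<xi>0 where "X0 = X1 /\<^sub>R X1 $ i" and "\<xi>0 = \<xi>1 /\<^sub>R X1 $ i"
  have X0: "(X0, \<xi>0) \<in> L x" "X0 $ i = 1"
    using subspace_scale[OF sub X1(1), of "inverse (X1 $ i)"] X1(3) by (simp_all add: X0_def \<xi>0_def)
  note i = X1(2)
  obtain \<sigma> D where \<sigma>: "local_section L x \<sigma> D" "\<sigma> x = (0, \<zeta>)"
    and D: "\<And>\<zeta>'. (0, \<zeta>') \<in> L x \<Longrightarrow> \<zeta>' \<bullet> fst (D X0) = 0"
    using inv[OF x(1) X0(1) \<zeta>(2)] by blast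
  \<comment> \<open>The form in which involutivity enters: the derivative along \<open>X0\<close> of
    the vector part of the section through \<open>(0, \<zeta>)\<close> is annihilated by all pure
    covectors, hence is a vector part of \<open>L x\<close>.\<close>
  obtain \<kappa> where \<kappa>: "(fst (D X0), \<kappa>) \<in> L x"
    using lagrangian_fst_image[OF lag[OF x(1)] D] by blast
  have linD: "linear D" using \<sigma>(1) has_derivative_linear by (auto simp: local_section_def)
  have \<zeta>X0: "\<zeta> \<bullet> X0 = 0" using lagrangian_isotropic[OF lag[OF x(1)] \<zeta>(2) X0(1)] by simp
  \<comment> \<open>A curve inside the exceptional divisor over the fixed point \<open>x\<close>;
    for \<open>u $ i = 0\<close> it runs through the lines spanned by the normal parts of
    \<open>X0 + s u\<close>.\<close>
  define zz where "zz u s = (\<chi> l. if l \<in> I - {i} then X0 $ l + s * u $ l else x $ l)" for u :: "real^'n" and s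
  have zz_i: "zz u s $ i = 0" for u s using x(2)[OF i] by (simp add: zz_def)
  have zz_x: "blowdown_coords I i (zz u s) = x" for u s
    using x(2) x(2)[OF i] zz_i[of u s] by (auto simp: blowdown_coords_def vec_eq_iff) (simp add: zz_def)
  have zz_lim: "(\<lambda>n. zz u (null_seq n)) \<longlonglongrightarrow> zz u 0" for u
  proof (rule vec_tendstoI)
    fix l
    have "(\<lambda>n. X0 $ l + null_seq n * u $ l) \<longlonglongrightarrow> X0 $ l + 0 * u $ l"
      by (intro tendsto_intros null_seq)
    then show "(\<lambda>n. zz u (null_seq n) $ l) \<longlonglongrightarrow> zz u 0 $ l"
      by (cases "l \<in> I - {i}") (auto simp: zz_def)
  qed
  have zz0: "zz u 0 = zz 0 0" for u by (simp add: zz_def vec_eq_iff)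
  have UU: "blowdown_coords I i (zz u s) \<in> U" for u s using x(1) by (simp add: zz_x)
  \<comment> \<open>At the line of \<open>X0\<close> the fibre part of \<open>X0\<close> is 0 and
    gives nothing. At parameter \<open>s\<close> it is \<open>- s u\<close>, so rescaling before
    \<open>s \<rightarrow> 0\<close> yields every fibre direction in the limit.\<close>
  have vert: "(u, 0) \<in> E i (zz 0 0)" if u: "\<And>l. l \<notin> I - {i} \<Longrightarrow> u $ l = 0" for u
  proof -
    have "(u, 0) \<in> E i (zz u (null_seq n))" for n
    proof -
      have "(fibre_part I i (zz u (null_seq n)) X0, 0) \<in> E i (zz u (null_seq n))"
        by (rule E_fibre[OF i zz_i UU]) (use X0 in \<open>simp add: zz_x\<close>)
      from subspace_scale[OF E_subspace[OF i UU] this, of "- inverse (null_seq n)"]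
      have "((- inverse (null_seq n)) *\<^sub>R fibre_part I i (zz u (null_seq n)) X0, 0) \<in> E i (zz u (null_seq n))"
        by simp
      moreover have "(- inverse (null_seq n)) *\<^sub>R fibre_part I i (zz u (null_seq n)) X0 = u"
        using X0(2) u null_seq(2)[of n] by (auto simp: fibre_part_def zz_def vec_eq_iff)
      ultimately show ?thesis by simp
    qed
    then have "(u, 0) \<in> E i (zz u 0)"
      by (intro E_closed[OF i UU _ zz_lim tendsto_const] always_eventually allI)
    then show ?thesis unfolding zz0[of u] .
  qed
  \<comment> \<open>\<open>\<zeta>\<close> takes the value 1 on \<open>u0\<close>. Subtracting
    \<open>u0 $ i\<close> times \<open>X0\<close>, on which \<open>\<zeta>\<close> vanishes, makes
    the \<open>i\<close>-th entry 0 and preserves this value.\<close>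
  define u0 where "u0 = \<zeta> /\<^sub>R (\<zeta> \<bullet> \<zeta>)"
  define u where "u = (\<chi> l. if l \<in> I then u0 $ l - u0 $ i * X0 $ l else 0)"
  have ui: "u $ i = 0" using X0(2) by (simp add: u_def)
  have \<zeta>u: "\<zeta> \<bullet> u = 1"
  proof -
    have "\<zeta> \<bullet> u = (\<Sum>l\<in>UNIV. \<zeta> $ l * (u0 $ l - u0 $ i * X0 $ l))"
      unfolding inner_vec_def using \<zeta>(1) by (intro sum.cong) (auto simp: u_def)
    also have "\<dots> = \<zeta> \<bullet> (u0 - u0 $ i *\<^sub>R X0)" by (simp add: inner_vec_def)
    also have "\<dots> = 1" using \<zeta>X0 \<zeta>(3) by (simp add: inner_diff_right u0_def)
    finally show ?thesis .
  qed
  \<comment> \<open>Here \<open>\<zeta>\<close> pulls back to \<open>s *\<^sub>R axis i 1\<close>.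
    The vector part coming from \<open>D X0\<close> lies in the lift by \<open>\<kappa>\<close> and
    is subtracted; the rest is divisible by \<open>s\<close>.\<close>
  have lift: "(fibre_part I i (zz u s) (fst (D u)), axis i 1) \<in> E i (zz u s)" if s: "s \<noteq> 0" for s
  proof -
    let ?z = "zz u s"
    have "(fibre_part I i ?z (fst (D (X0 + s *\<^sub>R u))) + off_fibre I i 0, blowdown_adjoint I i ?z \<zeta>) \<in> E i ?z"
    proof (rule E_section[OF i zz_i UU])
      show "local_section L (blowdown_coords I i ?z) \<sigma> D" "\<sigma> (blowdown_coords I i ?z) = (0, \<zeta>)"
        by (simp_all only: zz_x \<sigma>)
    qed (use X0(2) ui in \<open>auto simp: fibre_part_linear zz_def\<close>)
    moreover have "blowdown_adjoint I i ?z \<zeta> = s *\<^sub>R axis i 1"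
    proof -
      have "\<zeta> \<bullet> (X0 + s *\<^sub>R u) = (\<Sum>l\<in>I. \<zeta> $ l * (X0 $ l + s * u $ l))"
        unfolding inner_vec_def using \<zeta>(1) by (simp, intro sum.mono_neutral_right) auto
      also have "\<dots> = \<zeta> $ i + (\<Sum>l\<in>I - {i}. \<zeta> $ l * (X0 $ l + s * u $ l))"
        using X0(2) ui by (simp add: sum.remove[OF _ i])
      also have "(\<Sum>l\<in>I - {i}. \<zeta> $ l * (X0 $ l + s * u $ l)) = (\<Sum>l\<in>I - {i}. ?z $ l * \<zeta> $ l)"
        by (rule sum.cong) (auto simp: zz_def)
      finally have "\<zeta> $ i + (\<Sum>l\<in>I - {i}. ?z $ l * \<zeta> $ l) = s"
        using \<zeta>X0 \<zeta>u by (simp add: inner_add_right)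
      then show ?thesis using \<zeta>(1) zz_i[of u s] by (auto simp: blowdown_adjoint_def vec_eq_iff axis_def)
    qed
    moreover have off0: "off_fibre I i 0 = 0" by (simp add: off_fibre_def vec_eq_iff)
    ultimately have 1: "(fibre_part I i ?z (fst (D X0)) + s *\<^sub>R fibre_part I i ?z (fst (D u)), s *\<^sub>R axis i 1) \<in> E i ?z"
      by (simp add: linear_add[OF linD] linear_scale[OF linD] fibre_part_linear off0)
    have 2: "(fibre_part I i ?z (fst (D X0)), 0) \<in> E i ?z"
      by (rule E_fibre[OF i zz_i UU, where \<xi> = \<kappa>]) (use \<kappa> in \<open>simp add: zz_x\<close>)
    from subspace_diff[OF E_subspace[OF i UU] 1 2]
    have "(s *\<^sub>R fibre_part I i ?z (fst (D u)), s *\<^sub>R axis i 1) \<in> E i ?z" by simp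
    from subspace_scale[OF E_subspace[OF i UU] this, of "inverse s"] s show ?thesis by simp
  qed
  have "(fibre_part I i (zz 0 0) (fst (D u)), axis i 1) \<in> E i (zz u 0)"
  proof (rule E_closed[OF i UU _ zz_lim])
    show "\<forall>\<^sub>F n in sequentially. (fibre_part I i (zz u (null_seq n)) (fst (D u)), axis i 1) \<in> E i (zz u (null_seq n))"
      using lift null_seq by simp
    show "(\<lambda>n. (fibre_part I i (zz u (null_seq n)) (fst (D u)), axis i 1))
        \<longlonglongrightarrow> (fibre_part I i (zz 0 0) (fst (D u)), axis i 1)"
      unfolding zz0[of u, symmetric] by (intro tendsto_intros fibre_part_tendsto zz_lim)
  qed
  then have "(fibre_part I i (zz 0 0) (fst (D u)), axis i 1) \<in> E i (zz 0 0)" by (simp add: zz0[of u])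
  moreover have "(fibre_part I i (zz 0 0) (fst (D u)), 0) \<in> E i (zz 0 0)"
    by (rule vert) (auto simp: fibre_part_def)
  ultimately have dt: "(0, axis i 1) \<in> E i (zz 0 0)"
    using subspace_diff[OF E_subspace[OF i UU]] by fastforce
  \<comment> \<open>\<open>X0\<close> points along its own line and therefore lifts, with
    \<open>w $ i = 1\<close>; this is the entry that \<open>(0, axis i 1)\<close> detects.\<close>
  have "fibre_part I i (zz 0 0) X0 = 0" using X0(2) by (auto simp: fibre_part_def zz_def vec_eq_iff)
  then obtain w where w: "\<forall>l. l \<notin> I - {i} \<longrightarrow> w $ l = X0 $ l"
    "(w, blowdown_adjoint I i (zz 0 0) \<xi>0) \<in> E i (zz 0 0)"
    using E_lift[OF i zz_i UU, of X0 \<xi>0 0 0] X0 by (auto simp: zz_x)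
  from E_isotropic[OF i UU w(2) dt] have "w $ i = 0" by (simp add: inner_axis)
  then show False using w(1) X0(2) by simp
qed

text \<open>Invariance is dual to containing all conormal covectors, and the elements
  \<open>(0, axis l 1)\<close> form constant sequences whose membership passes to the limit.\<close>

lemma invar_closed:
  assumes y: "\<And>n. y n \<in> U" "y \<longlonglongrightarrow> x" "x \<in> U" and inv: "\<And>n. invar I (L (y n))"
  shows "invar I (L x)"
  unfolding invar_def
proof (intro allI impI ballI)
  fix X \<xi> l assume e: "(X, \<xi>) \<in> L x" and l: "l \<in> I"
  have "(0, axis l 1) \<in> L (y n)" for n
    by (rule lagrangian_memI[OF lag[OF y(1)]])
      (use inv[of n] l in \<open>auto simp: invar_def inner_axis'\<close>)
  then have "(0, axis l 1) \<in> L x"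
    using L_closed[OF y(3) y(2) tendsto_const] by simp
  from lagrangian_isotropic[OF lag[OF y(3)] this e] show "X $ l = 0" by (simp add: inner_axis')
qed

section \<open>Transversal points cannot accumulate at an invariant point\<close>

definition normal_part :: "real^'n \<Rightarrow> real^'n" where "normal_part X = (\<chi> l. if l \<in> I then X $ l else 0)"
definition tangent_part :: "real^'n \<Rightarrow> real^'n" where "tangent_part X = (\<chi> l. if l \<in> I then 0 else X $ l)"

lemma normal_tangent_part: "normal_part X + tangent_part X = X"
  by (simp add: normal_part_def tangent_part_def vec_eq_iff)

lemma inner_normal_tangent: "X \<bullet> Y = normal_part X \<bullet> normal_part Y + tangent_part X \<bullet> tangent_part Y"
proof -
  have "X \<bullet> Y = (\<Sum>l\<in>UNIV. normal_part X $ l * normal_part Y $ l + tangent_part X $ l * tangent_part Y $ l)"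
    unfolding inner_vec_def by (rule sum.cong) (auto simp: normal_part_def tangent_part_def)
  then show ?thesis by (simp add: inner_vec_def sum.distrib)
qed

lemma part_simps [simp]:
  "normal_part (normal_part X) = normal_part X" "tangent_part (tangent_part X) = tangent_part X"
  "normal_part (tangent_part X) = 0" "tangent_part (normal_part X) = 0"
  by (simp_all add: normal_part_def tangent_part_def vec_eq_iff)

text \<open>At a transversal point near an invariant point \<open>x\<close>, a suitable line direction \<open>v\<close> makes the
  fibre of the lift far from the fibres over \<open>x\<close>: it contains a unit vector whose swap lies in \<open>L\<^sub>x\<close>
  up to multiples of \<open>\<partial>\<^sub>t\<close>.\<close>

lemma transv_near_invar:
  assumes x: "x \<in> U" and inv: "invar I (L x)"
    and y: "y \<in> U" "\<And>l. l \<in> I \<Longrightarrow> y $ l = 0" and T: "transv I (L y)"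
  shows "\<exists>v. norm v = 1 \<and> tangent_part v = 0 \<and> (\<forall>i\<in>I. v $ i \<noteq> 0 \<longrightarrow>
      (\<exists>c a b. norm (c *\<^sub>R axis i 1 + a, b) = 1 \<and> normal_part a = 0 \<and> normal_part b = 0 \<and> (b, a) \<in> L x \<and>
        (c *\<^sub>R axis i 1 + a, b) \<in> E i (\<chi> l. if l \<in> I - {i} then v $ l / v $ i else y $ l)))"
proof -
  note subx = lagrangian_subspace[OF lag[OF x]]
  have conormal: "(0, \<zeta>) \<in> L x" if "tangent_part \<zeta> = 0" for \<zeta>
  proof (rule lagrangian_memI[OF lag[OF x]], clarsimp)
    fix A \<alpha> assume "(A, \<alpha>) \<in> L x"
    then have "normal_part A = 0" using inv by (auto simp: invar_def normal_part_def vec_eq_iff)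
    then show "\<zeta> \<bullet> A = 0" using that inner_normal_tangent[of \<zeta> A] by simp
  qed
  \<comment> \<open>The elements of \<open>L x\<close> whose covector has no normal part. Since
    \<open>L x\<close> contains conormal covectors, \<open>R\<close> is proper, and a dimension
    count gives a nonzero \<open>f\<close> in \<open>L y\<close> Euclidean orthogonal to
    \<open>R\<close>.\<close>
  define R where "R = {e \<in> L x. normal_part (snd e) = 0}"
  have linn: "linear normal_part" by (rule linearI) (auto simp: normal_part_def vec_eq_iff)
  have R: "subspace R"
    using subx unfolding subspace_def R_def
    by (auto simp: linear_0[OF linn] linear_add[OF linn] linear_scale[OF linn])
  obtain j where j: "j \<in> I" using card_I by (metis card.empty ex_in_conv not_less_zero)
  have "dim R < dim (L y)"
  proof -
    have "tangent_part (axis j 1) = 0" using j by (auto simp: tangent_part_def vec_eq_iff axis_def)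
    then have 1: "(0, axis j 1) \<in> L x" by (rule conormal)
    have "normal_part (axis j 1) $ j = 1" using j by (simp add: normal_part_def)
    then have "normal_part (axis j 1) \<noteq> 0" by auto
    then have 2: "(0, axis j 1) \<notin> R" by (auto simp: R_def)
    have "R \<subseteq> L x" by (auto simp: R_def)
    then have "R \<subset> L x" using 1 2 by blast
    then have "dim R < dim (L x)"
      using R subx by (intro dim_psubset) (simp add: span_eq_iff[THEN iffD2])
    then show ?thesis using dim_lagrangian[OF lag[OF x]] dim_lagrangian[OF lag[OF y(1)]] by simp
  qed
  then obtain f where f: "f \<in> L y" "f \<noteq> 0" "\<And>\<rho>. \<rho> \<in> R \<Longrightarrow> f \<bullet> \<rho> = 0"
    using exists_orthogonal_of_dim_less[OF lagrangian_subspace[OF lag[OF y(1)]] R] by blast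
  obtain X \<xi> where X: "f = (X, \<xi>)" by fastforce
  define a b where "a = tangent_part X" and "b = tangent_part \<xi>"
  \<comment> \<open>Euclidean orthogonality to \<open>R\<close> is annihilation after a swap, and
    \<open>R\<close> together with the conormal covectors makes up \<open>L x\<close>; so the
    swapped tangential part of \<open>f\<close> pairs to 0 with all of \<open>L x\<close>.\<close>
  have ba: "(b, a) \<in> L x"
  proof (rule lagrangian_memI[OF lag[OF x]], clarify)
    fix A \<alpha> assume e: "(A, \<alpha>) \<in> L x"
    then have nA: "normal_part A = 0" using inv by (auto simp: invar_def normal_part_def vec_eq_iff)
    have "(A, \<alpha>) - (0, normal_part \<alpha>) \<in> L x" by (rule subspace_diff[OF subx e conormal]) simp
    then have "(A, tangent_part \<alpha>) \<in> L x" by (simp flip: eq_diff_eq[THEN iffD2, OF normal_tangent_part[of \<alpha>, unfolded add.commute[of "normal_part \<alpha>"]]])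
    then have "(A, tangent_part \<alpha>) \<in> R" by (simp add: R_def)
    then have "X \<bullet> A + \<xi> \<bullet> tangent_part \<alpha> = 0" using f(3) X by fastforce
    then have "tangent_part X \<bullet> tangent_part A + tangent_part \<xi> \<bullet> tangent_part \<alpha> = 0"
      using inner_normal_tangent[of X A] inner_normal_tangent[of \<xi> "tangent_part \<alpha>"] nA by simp
    then show "dual_pair (b, a) (A, \<alpha>) = 0"
      using inner_normal_tangent[of b \<alpha>] inner_normal_tangent[of a A] by (simp add: a_def b_def)
  qed
  have "a \<bullet> b = 0"
    using lagrangian_isotropic[OF lag[OF x] ba ba] by (simp add: inner_commute)
  moreover have "X \<bullet> \<xi> = 0"
    using lagrangian_isotropic[OF lag[OF y(1)] f(1) f(1)] by (simp add: X inner_commute)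
  ultimately have n0: "normal_part X \<bullet> normal_part \<xi> = 0"
    using inner_normal_tangent[of X \<xi>] by (simp add: a_def b_def)
  \<comment> \<open>Otherwise \<open>f\<close> would be a nonzero conormal covector in
    \<open>L y\<close>, which transversality forbids. This keeps the final element nonzero.\<close>
  have ne: "normal_part X \<noteq> 0 \<or> a \<noteq> 0 \<or> b \<noteq> 0"
  proof (rule ccontr)
    assume neg: "\<not> ?thesis"
    then have "X = 0" using normal_tangent_part[of X] by (simp add: a_def)
    then have "(0, \<xi>) \<in> L y" using f(1) X by simp
    moreover have "\<forall>l. l \<notin> I \<longrightarrow> \<xi> $ l = 0" using neg by (simp add: b_def tangent_part_def vec_eq_iff) metis
    ultimately have "\<xi> = 0" using T by (simp add: transv_def)
    then show False using f(2) X \<open>X = 0\<close> by (simp add: zero_prod_def)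
  qed
  \<comment> \<open>The line must contain \<open>normal_part X\<close>, so that
    \<open>(X, \<xi>)\<close> lifts without a pole, and must be killed by \<open>\<xi>\<close>, so
    that the pulled back covector has no \<open>i\<close>-th entry. By \<open>n0\<close> both
    demands agree; if \<open>normal_part X = 0\<close>, the second has a nonzero solution because
    \<open>card I > 1\<close>.\<close>
  obtain v0 c0 where v0: "v0 \<noteq> 0" "tangent_part v0 = 0" "v0 \<bullet> \<xi> = 0" "normal_part X = c0 *\<^sub>R v0"
  proof (cases "normal_part X = 0")
    case False
    have "normal_part X \<bullet> \<xi> = 0" using n0 inner_normal_tangent[of "normal_part X" \<xi>] by simp
    then show ?thesis using that[of "normal_part X" 1] False by simp
  next
    case True
    obtain k where k: "k \<in> I" "k \<noteq> j" using card_I j by (metis card_le_Suc0_iff_eq finite not_less_eq One_nat_def not_le)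
    show ?thesis
    proof (cases "\<xi> $ j = 0")
      case j0: True
      have "tangent_part (axis j 1) = 0" using j by (auto simp: tangent_part_def vec_eq_iff axis_def)
      then show ?thesis using that[of "axis j 1" 0] True j0 by (simp add: inner_axis')
    next
      case False
      let ?v = "\<xi> $ j *\<^sub>R axis k 1 - \<xi> $ k *\<^sub>R axis j 1 :: real^'n"
      have "?v $ k \<noteq> 0" using False k by (simp add: axis_def)
      then have "?v \<noteq> 0" by (metis zero_index)
      moreover have "tangent_part ?v = 0" using j k by (auto simp: tangent_part_def vec_eq_iff axis_def)
      moreover have "?v \<bullet> \<xi> = 0" by (simp add: inner_diff_left inner_axis')
      ultimately show ?thesis using that[of ?v 0] True by simp
    qed
  qed
  define v where "v = v0 /\<^sub>R norm v0"
  have v: "norm v = 1" "tangent_part v = 0" "v \<bullet> \<xi> = 0" "normal_part X = (c0 * norm v0) *\<^sub>R v"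
  proof -
    have "linear tangent_part" by (rule linearI) (auto simp: tangent_part_def vec_eq_iff)
    then show "tangent_part v = 0" using v0(2) by (simp add: v_def linear_scale)
  qed (use v0 in \<open>simp_all add: v_def\<close>)
  show ?thesis
  proof (intro exI[of _ v] conjI v ballI impI)
    fix i assume i: "i \<in> I" and vi: "v $ i \<noteq> 0"
    let ?z = "\<chi> l. if l \<in> I - {i} then v $ l / v $ i else y $ l"
    define c where "c = X $ i"
    have Xv: "X $ l = v $ l / v $ i * c" if "l \<in> I" for l
    proof -
      have "X $ m = (c0 * norm v0) * v $ m" if "m \<in> I" for m
        using v(4) that by (simp add: normal_part_def vec_eq_iff) metis
      then show ?thesis using that i vi by (simp add: c_def)
    qed
    have zi: "?z $ i = 0" using y(2)[OF i] by simp
    have zy: "blowdown_coords I i ?z = y"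
      using y(2) zi by (auto simp: blowdown_coords_def vec_eq_iff)
    have UU: "blowdown_coords I i ?z \<in> U" using zy y by simp
    have XL: "(X, \<xi>) \<in> L (blowdown_coords I i ?z)" unfolding zy using f(1) X by simp
    have "fibre_part I i ?z X = 0"
      using Xv by (auto simp: fibre_part_def vec_eq_iff c_def)
    then obtain w where w: "\<forall>l. l \<notin> I - {i} \<longrightarrow> w $ l = X $ l" "(w, blowdown_adjoint I i ?z \<xi>) \<in> E i ?z"
      using E_lift[OF i zi UU XL] by blast
    \<comment> \<open>Over a transversal point all fibre directions lie in the lift, so the
      unspecified fibre components of \<open>w\<close> can be discarded.\<close>
    have "(w - (c *\<^sub>R axis i 1 + a), 0) \<in> E i ?z"
    proof (rule E_vertical[OF i zi UU])
      show "transv I (L (blowdown_coords I i ?z))" unfolding zy by (rule T)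
    next
      fix l assume l: "l \<notin> I - {i}"
      then have "w $ l = X $ l" using w(1) by blast
      then show "(w - (c *\<^sub>R axis i 1 + a)) $ l = 0"
        using l i by (cases "l = i") (simp_all add: a_def tangent_part_def c_def axis_def)
    qed
    from subspace_diff[OF E_subspace[OF i UU] w(2) this]
    have g: "(c *\<^sub>R axis i 1 + a, blowdown_adjoint I i ?z \<xi>) \<in> E i ?z" by simp
    have "blowdown_adjoint I i ?z \<xi> = b"
    proof -
      have "v $ l = 0" if "l \<notin> I" for l
      proof -
        have "v $ l = tangent_part v $ l" using that by (simp add: tangent_part_def)
        then show ?thesis by (simp add: v(2))
      qed
      then have "v \<bullet> \<xi> = (\<Sum>l\<in>I. v $ l * \<xi> $ l)"
        unfolding inner_vec_def by (simp, intro sum.mono_neutral_right) auto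
      also have "\<dots> = v $ i * \<xi> $ i + (\<Sum>l\<in>I - {i}. v $ l * \<xi> $ l)" by (simp add: sum.remove[OF _ i])
      finally have "\<xi> $ i + (\<Sum>l\<in>I - {i}. v $ l * \<xi> $ l) / v $ i = 0" using v(3) vi by (simp add: field_simps)
      moreover have "(\<Sum>l\<in>I - {i}. ?z $ l * \<xi> $ l) = (\<Sum>l\<in>I - {i}. v $ l * \<xi> $ l) / v $ i"
        unfolding sum_divide_distrib by (rule sum.cong) auto
      ultimately show ?thesis using zi i
        by (auto simp: blowdown_adjoint_def b_def tangent_part_def vec_eq_iff)
    qed
    with g have g: "(c *\<^sub>R axis i 1 + a, b) \<in> E i ?z" by simp
    have ga: "(c *\<^sub>R axis i 1 + a) $ i = c" "a = tangent_part (c *\<^sub>R axis i 1 + a)"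
      using i by (auto simp: a_def tangent_part_def axis_def vec_eq_iff)
    have nz: "(c *\<^sub>R axis i 1 + a, b) \<noteq> 0"
    proof
      assume "(c *\<^sub>R axis i 1 + a, b) = 0"
      then have 0: "c *\<^sub>R axis i 1 + a = 0" "b = 0" by (simp_all add: zero_prod_def)
      then have "c = 0" using ga(1) by simp
      moreover have "a = 0" using 0(1) \<open>c = 0\<close> by simp
      moreover have "normal_part X = 0" using Xv \<open>c = 0\<close> by (auto simp: normal_part_def vec_eq_iff)
      ultimately show False using ne 0 by simp
    qed
    let ?n = "norm (c *\<^sub>R axis i (1::real) + a, b)"
    show "\<exists>c a b. norm (c *\<^sub>R axis i 1 + a, b) = 1 \<and> normal_part a = 0 \<and> normal_part b = 0 \<and> (b, a) \<in> L x \<and>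
        (c *\<^sub>R axis i 1 + a, b) \<in> E i ?z"
    proof (intro exI conjI)
      have eq: "((c / ?n) *\<^sub>R axis i 1 + a /\<^sub>R ?n, b /\<^sub>R ?n) = (c *\<^sub>R axis i 1 + a, b) /\<^sub>R ?n"
        by (simp add: scaleR_add_right divide_inverse mult.commute)
      show "norm ((c / ?n) *\<^sub>R axis i 1 + a /\<^sub>R ?n, b /\<^sub>R ?n) = 1"
        unfolding eq sgn_div_norm[symmetric] norm_sgn using nz by simp
      show "((c / ?n) *\<^sub>R axis i 1 + a /\<^sub>R ?n, b /\<^sub>R ?n) \<in> E i ?z"
        unfolding eq by (rule subspace_scale[OF E_subspace[OF i UU] g])
      show "normal_part (a /\<^sub>R ?n) = 0" "normal_part (b /\<^sub>R ?n) = 0"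
        by (simp_all add: linear_scale[OF linn] a_def b_def)
      show "(b /\<^sub>R ?n, a /\<^sub>R ?n) \<in> L x"
        using subspace_scale[OF subx ba, of "inverse ?n"] by simp
    qed
  qed
qed

text \<open>Each \<open>y n\<close> has its own line and its own unit vector in the lift;
  compactness of two spheres makes both converge along subsequences. The limit is a unit vector in
  the lift over \<open>x\<close> whose swap lies in \<open>L x\<close>, and lifting the swap gives
  an element pairing with it to its squared norm.\<close>

lemma transv_closed:
  assumes y: "\<And>n. y n \<in> U" "\<And>n l. l \<in> I \<Longrightarrow> y n $ l = 0" "y \<longlonglongrightarrow> x" "x \<in> U"
    and T: "\<And>n. transv I (L (y n))"
  shows "\<not> invar I (L x)"
proof
  assume inv: "invar I (L x)"
  have x0: "x $ l = 0" if "l \<in> I" for l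
    using LIMSEQ_unique[OF tendsto_vec_nth[OF y(3)], of l 0] y(2)[OF that] by simp
  let ?z = "\<lambda>i v y. \<chi> l. if l \<in> I - {i} then v $ l / v $ i else (y :: real^'n) $ l"
  have "\<forall>n. \<exists>v. norm v = 1 \<and> tangent_part v = 0 \<and> (\<forall>i\<in>I. v $ i \<noteq> 0 \<longrightarrow>
      (\<exists>c a b. norm (c *\<^sub>R axis i 1 + a, b) = 1 \<and> normal_part a = 0 \<and> normal_part b = 0 \<and> (b, a) \<in> L x \<and>
        (c *\<^sub>R axis i 1 + a, b) \<in> E i (?z i v (y n))))"
    using transv_near_invar[OF y(4) inv y(1) y(2) T] by blast
  then obtain v where v: "\<And>n. norm (v n) = 1" "\<And>n. tangent_part (v n) = 0"
    and H: "\<And>n i. i \<in> I \<Longrightarrow> v n $ i \<noteq> 0 \<Longrightarrow>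
      (\<exists>c a b. norm (c *\<^sub>R axis i 1 + a, b) = 1 \<and> normal_part a = 0 \<and> normal_part b = 0 \<and> (b, a) \<in> L x \<and>
        (c *\<^sub>R axis i 1 + a, b) \<in> E i (?z i (v n) (y n)))"
    by (simp only: choice_iff) blast
  have "\<forall>n. v n \<in> sphere 0 1" using v(1) by simp
  then obtain w r where w: "w \<in> sphere 0 1" "strict_mono r" "(v \<circ> r) \<longlonglongrightarrow> w"
    using compact_sphere[unfolded compact_def] by metis
  have "tangent_part w = 0"
  proof -
    have "w $ l = 0" if "l \<notin> I" for l
    proof -
      have "(\<lambda>n. (v \<circ> r) n $ l) \<longlonglongrightarrow> w $ l" by (rule tendsto_vec_nth[OF w(3)])
      moreover have "(v \<circ> r) n $ l = 0" for n
        using v(2)[of "r n"] that by (auto simp: tangent_part_def vec_eq_iff split: if_splits)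
      ultimately show ?thesis by (simp add: LIMSEQ_const_iff)
    qed
    then show ?thesis by (simp add: tangent_part_def vec_eq_iff)
  qed
  moreover have "w \<noteq> 0" using w(1) by auto
  ultimately obtain i where i: "i \<in> I" and wi: "w $ i \<noteq> 0"
    by (auto simp: tangent_part_def vec_eq_iff split: if_splits)
  have vi: "(\<lambda>n. v (r n) $ i) \<longlonglongrightarrow> w $ i" using tendsto_vec_nth[OF w(3), of i] by simp
  then have "\<forall>\<^sub>F n in sequentially. v (r n) $ i \<noteq> 0" using wi by (rule tendsto_imp_eventually_ne)
  \<comment> \<open>A tail of the subsequence of lines lies in the single blowup chart with index
    \<open>i\<close>, the one containing the limit line.\<close>
  then obtain K where K: "\<And>n. n \<ge> K \<Longrightarrow> v (r n) $ i \<noteq> 0" by (auto simp: eventually_sequentially)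
  define s where "s n = r (n + K)" for n
  have s: "v (s n) $ i \<noteq> 0" for n by (simp add: s_def K)
  have vs: "(\<lambda>n. v (s n)) \<longlonglongrightarrow> w"
    using LIMSEQ_ignore_initial_segment[OF w(3), of K] by (simp add: s_def)
  have ys: "(\<lambda>n. y (s n)) \<longlonglongrightarrow> x"
    using LIMSEQ_ignore_initial_segment[OF LIMSEQ_subseq_LIMSEQ[OF y(3) w(2)], of K] by (simp add: s_def o_def)
  have "\<forall>n. \<exists>c a b. norm (c *\<^sub>R axis i 1 + a, b) = 1 \<and> normal_part a = 0 \<and> normal_part b = 0 \<and> (b, a) \<in> L x \<and>
        (c *\<^sub>R axis i 1 + a, b) \<in> E i (?z i (v (s n)) (y (s n)))"
    using H[OF i s] by blast
  then obtain c a b where g: "\<And>n. norm (c n *\<^sub>R axis i 1 + a n, b n) = 1" "\<And>n. normal_part (a n) = 0"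
      "\<And>n. normal_part (b n) = 0" "\<And>n. (b n, a n) \<in> L x"
      "\<And>n. (c n *\<^sub>R axis i 1 + a n, b n) \<in> E i (?z i (v (s n)) (y (s n)))"
    by (simp only: choice_iff) blast
  define g where "g n = (c n *\<^sub>R axis i 1 + a n, b n)" for n
  have "\<forall>n. g n \<in> sphere 0 1" using g(1) by (simp add: g_def)
  then obtain h r' where h: "h \<in> sphere 0 1" "strict_mono r'" "(g \<circ> r') \<longlonglongrightarrow> h"
    using compact_sphere[unfolded compact_def] by metis
  let ?zz = "?z i w x"
  have zlim: "(\<lambda>n. ?z i (v (s n)) (y (s n))) \<longlonglongrightarrow> ?zz"
  proof (rule vec_tendstoI)
    fix l
    show "(\<lambda>n. ?z i (v (s n)) (y (s n)) $ l) \<longlonglongrightarrow> ?zz $ l"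
      using wi by (cases "l \<in> I - {i}") (auto intro!: tendsto_intros vs ys)
  qed
  have zi: "?zz $ i = 0" using x0[OF i] by simp
  have zx: "blowdown_coords I i ?zz = x" using x0 zi by (auto simp: blowdown_coords_def vec_eq_iff)
  have UU: "blowdown_coords I i ?zz \<in> U" using zx y(4) by simp
  have closed: "e0 \<in> E i ?zz" if "\<And>n. e n \<in> E i (?z i (v (s n)) (y (s n)))" "(e \<circ> q) \<longlonglongrightarrow> e0" "strict_mono q" for e e0 q
    by (rule E_closed[OF i UU _ LIMSEQ_subseq_LIMSEQ[OF zlim that(3)] that(2)]) (use that(1) in simp)
  have hE: "h \<in> E i ?zz"
    by (rule closed[OF _ h(3) h(2)]) (unfold g_def, rule g(5))
  have vert: "(u, 0) \<in> E i ?zz" if u: "\<And>l. l \<notin> I - {i} \<Longrightarrow> u $ l = 0" for u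
  proof (rule closed[of "\<lambda>n. (u, 0)" id])
    fix n
    have zi: "?z i (v (s n)) (y (s n)) $ i = 0" using y(2)[OF i] by simp
    have zy: "blowdown_coords I i (?z i (v (s n)) (y (s n))) = y (s n)"
      using y(2) zi by (auto simp: blowdown_coords_def vec_eq_iff)
    show "(u, 0) \<in> E i (?z i (v (s n)) (y (s n)))"
      by (rule E_vertical[OF i zi]) (use zy y(1) T u in auto)
  qed (auto simp: strict_mono_def o_def)
  have ti: "tangent_part (axis i 1) = 0" using i by (auto simp: tangent_part_def vec_eq_iff axis_def)
  \<comment> \<open>At the invariant point \<open>axis i 1\<close> is a conormal covector in
    \<open>L x\<close> and is its own pullback. Pairing with it kills the
    \<open>\<partial>\<^sub>t\<close> component of the limit \<open>h\<close>, which the swap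
    condition does not control.\<close>
  have dt: "(0, axis i 1) \<in> E i ?zz"
  proof -
    have "(0, axis i 1) \<in> L (blowdown_coords I i ?zz)"
      unfolding zx by (rule lagrangian_memI[OF lag[OF y(4)]])
        (use inv i in \<open>auto simp: invar_def inner_axis'\<close>)
    from E_lift[OF i zi UU this fibre_part_linear(3)] obtain u where
      u: "\<forall>l. l \<notin> I - {i} \<longrightarrow> u $ l = 0" "(u, blowdown_adjoint I i ?zz (axis i 1)) \<in> E i ?zz" by auto
    moreover have "blowdown_adjoint I i ?zz (axis i 1) = axis i 1"
      using zi i by (auto simp: blowdown_adjoint_def axis_def vec_eq_iff)
    moreover have "(u, 0) \<in> E i ?zz" by (rule vert) (use u in auto)
    ultimately show ?thesis using subspace_diff[OF E_subspace[OF i UU] u(2)] by fastforce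
  qed
  have glim: "(\<lambda>n. fst (g (r' n)) $ l) \<longlonglongrightarrow> fst h $ l" "(\<lambda>n. snd (g (r' n)) $ l) \<longlonglongrightarrow> snd h $ l" for l
    using tendsto_vec_nth[OF tendsto_fst[OF h(3)]] tendsto_vec_nth[OF tendsto_snd[OF h(3)]] by simp_all
  have hi: "fst h $ i = 0" using E_isotropic[OF i UU hE dt] by (simp add: dual_pair_def inner_axis)
  have nh: "normal_part (fst h) = 0" "normal_part (snd h) = 0"
  proof -
    have "fst (g n) $ l = 0" if "l \<in> I - {i}" for n l
      using that g(2)[of n] by (auto simp: g_def normal_part_def vec_eq_iff axis_def split: if_splits)
    then have "fst h $ l = 0" if "l \<in> I - {i}" for l
      using that LIMSEQ_unique[OF glim(1)[of l], of 0] by simp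
    then show "normal_part (fst h) = 0" using hi by (auto simp: normal_part_def vec_eq_iff)
    have "snd (g n) $ l = 0" if "l \<in> I" for n l
      using that g(3)[of n] by (auto simp: g_def normal_part_def vec_eq_iff split: if_splits)
    then have "snd h $ l = 0" if "l \<in> I" for l
      using that LIMSEQ_unique[OF glim(2)[of l], of 0] by simp
    then show "normal_part (snd h) = 0" by (auto simp: normal_part_def vec_eq_iff)
  qed
  \<comment> \<open>Membership of the swaps passes to the limit since subspaces are closed;
    \<open>tangent_part\<close> strips the term \<open>c n *\<^sub>R axis i 1\<close>
    beforehand.\<close>
  have "(snd h, fst h) \<in> L x"
  proof -
    have th: "tangent_part (fst h) = fst h" using nh(1) normal_tangent_part[of "fst h"] by simp
    have lim: "(\<lambda>n. (snd (g (r' n)), tangent_part (fst (g (r' n))))) \<longlonglongrightarrow> (snd h, tangent_part (fst h))"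
    proof (rule tendsto_Pair)
      show "(\<lambda>n. snd (g (r' n))) \<longlonglongrightarrow> snd h" using tendsto_snd[OF h(3)] by simp
      show "(\<lambda>n. tangent_part (fst (g (r' n)))) \<longlonglongrightarrow> tangent_part (fst h)"
      proof (rule vec_tendstoI)
        fix l
        show "(\<lambda>n. tangent_part (fst (g (r' n))) $ l) \<longlonglongrightarrow> tangent_part (fst h) $ l"
          using glim(1)[of l] by (simp add: tangent_part_def)
      qed
    qed
    have mem: "(snd (g n), tangent_part (fst (g n))) \<in> L x" for n
    proof -
      have "tangent_part (fst (g n)) = tangent_part (a n)"
        using i by (auto simp: g_def tangent_part_def vec_eq_iff axis_def)
      also have "\<dots> = a n" using normal_tangent_part[of "a n"] g(2)[of n] by simp
      finally show ?thesis using g(4)[of n] by (simp add: g_def)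
    qed
    show ?thesis
      using closed_sequentially[OF closed_subspace[OF lagrangian_subspace[OF lag[OF y(4)]]] _ lim] mem
      unfolding th by simp
  qed
  then have "(snd h, fst h) \<in> L (blowdown_coords I i ?zz)" unfolding zx .
  moreover have "fibre_part I i ?zz (snd h) = 0"
    using nh(2) i by (auto simp: fibre_part_def normal_part_def vec_eq_iff split: if_splits)
  ultimately obtain u where u: "\<forall>l. l \<notin> I - {i} \<longrightarrow> u $ l = snd h $ l"
      "(u, blowdown_adjoint I i ?zz (fst h)) \<in> E i ?zz"
    using E_lift[OF i zi UU] by blast
  have "blowdown_adjoint I i ?zz (fst h) = fst h"
  proof -
    have "fst h $ l = 0" if "l \<in> I" for l
      using nh(1) that by (auto simp: normal_part_def vec_eq_iff split: if_splits)
    then show ?thesis using zi i by (auto simp: blowdown_adjoint_def vec_eq_iff)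
  qed
  with E_isotropic[OF i UU u(2) hE] have "u \<bullet> snd h + fst h \<bullet> fst h = 0"
    by (simp add: dual_pair_def)
  \<comment> \<open>The uncontrolled fibre components of \<open>u\<close> meet only normal entries
    of \<open>snd h\<close>, which are 0; the pairing is thus the squared norm of
    \<open>h\<close>.\<close>
  moreover have "tangent_part u = tangent_part (snd h)"
    using u(1) by (auto simp: tangent_part_def vec_eq_iff)
  then have "u \<bullet> snd h = snd h \<bullet> snd h"
    using nh(2) inner_normal_tangent[of u "snd h"] inner_normal_tangent[of "snd h" "snd h"] by simp
  ultimately have "h \<bullet> h = 0" by (simp add: inner_prod_def add.commute)
  then show False using h(1) by simp
qed

end

section \<open>The smooth structure of the blowup\<close>

text \<open>Serves to cover points off \<open>N\<close>: a submanifold chart there must avoid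
  \<open>N\<close> and have a nowhere vanishing coordinate in \<open>I\<close>, which shrinking and
  shifting arrange. Maximality of the atlas then applies.\<close>

lemma chart_restrict_translate:
  assumes M: "smooth_manifold M" and c: "c \<in> M"
    and W: "openin (manifold_topology M) W" "W \<subseteq> chart_dom c"
  shows "(W, \<lambda>q. coords c q + a) \<in> M"
proof -
  let ?c = "(W, \<lambda>q. coords c q + a)"
  note cM = smooth_manifold_compatible[OF M]
  note cc = compatible_is_chart[OF cM c]
  have openW: "open (coords d ` (W \<inter> chart_dom d))" if "d \<in> M" for d
    using W(1) that by (simp add: openin_manifold_topology[OF cM])
  have img: "(\<lambda>q. coords c q + a) ` T = (+) a ` coords c ` T" for T
    by (auto simp: image_image add.commute)
  have opd: "openin (manifold_topology M) (chart_dom d)" if "d \<in> M" for d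
    using openin_chart_preimage[OF cM that open_UNIV] by simp
  have openWd: "open (coords c ` (W \<inter> chart_dom d))" if "d \<in> M" for d
  proof -
    have "openin (manifold_topology M) (W \<inter> chart_dom d)" using W(1) opd[OF that] by blast
    moreover have "W \<inter> chart_dom d \<inter> chart_dom c = W \<inter> chart_dom d" using W(2) by blast
    ultimately show ?thesis using c by (metis openin_manifold_topology[OF cM])
  qed
  have inj: "inj_on (\<lambda>q. coords c q + a) W"
    using cc W(2) by (auto simp: is_chart_def inj_on_def)
  have ic: "is_chart ?c"
    using inj openW[OF c] W(2) open_translation
    by (auto simp: is_chart_def img Int_absorb2)
  have inv: "chart_inv ?c z = chart_inv c (z - a)" if z: "z \<in> (\<lambda>q. coords c q + a) ` W" for z
  proof -
    obtain q where q: "q \<in> W" "z = coords c q + a" using z by blast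
    then have "chart_inv ?c z = q" using chart_inv_coords[OF ic, of q] by simp
    then show ?thesis using q W(2) chart_inv_coords[OF cc, of q] by auto
  qed
  have "smoothly_compatible ?c d" if d: "d \<in> M" for d
  proof -
    note cd = compatible_pair[OF cM c d]
    note dd = compatible_is_chart[OF cM d]
    let ?S = "(\<lambda>q. coords c q + a) ` (W \<inter> chart_dom d)"
    have S: "open ?S" unfolding img by (rule open_translation[OF openWd[OF d]])
    have "smooth_on ?S ((coords d \<circ> chart_inv c) \<circ> (\<lambda>z. z + - a))"
    proof (rule smooth_on_compose[OF S smoothly_compatibleD(1)[OF cd] _ smoothly_compatibleD(2)[OF cd]])
      show "smooth_on ?S (\<lambda>z. z + - a)"
        by (intro smooth_on_add S smooth_on_const smooth_on_bounded_linear bounded_linear_ident)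
      show "(\<lambda>z. z + - a) ` ?S \<subseteq> coords c ` (chart_dom c \<inter> chart_dom d)" using W(2) by auto
    qed
    then have 1: "smooth_on ?S (coords d \<circ> chart_inv ?c)"
      by (rule smooth_on_cong[OF S, rotated]) (auto simp: inv)
    let ?T = "coords d ` (W \<inter> chart_dom d)"
    have "smooth_on ?T (\<lambda>z. (coords c \<circ> chart_inv d) z + a)"
      by (intro smooth_on_add openW[OF d] smooth_on_const smooth_on_subset[OF smoothly_compatibleD(4)[OF cd]])
        (use W(2) in auto)
    then have 2: "smooth_on ?T (coords ?c \<circ> chart_inv d)" by (simp add: o_def)
    show ?thesis using 1 2 S openW[OF d] by (simp add: smoothly_compatible_def Let_def)
  qed
  moreover have "W \<subseteq> points M" using W(2) c by (auto simp: points_def)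
  ultimately have "?c \<in> smooth_structure (points M) M" using ic by (simp add: smooth_structure_def)
  then show ?thesis using M unfolding smooth_manifold_def by blast
qed

locale submanifold_setting =
  fixes M :: "('a, 'n::finite) chart set" and N :: "'a set" and k :: nat
  assumes M: "smooth_manifold M" and N: "embedded_submanifold M N k"
    and N_closed: "closedin (manifold_topology M) N" and k: "k > 0"
begin

lemmas cM = smooth_manifold_compatible[OF M]

definition sub_chart_at :: "('a, 'n) chart \<Rightarrow> 'n set \<Rightarrow> 'a \<Rightarrow> bool" where
  "sub_chart_at c I q \<longleftrightarrow> submanifold_chart M N k c I \<and> q \<in> chart_dom c"

lemma sub_chart_atD:
  assumes "sub_chart_at c I q"
  shows "c \<in> charts_at M q" "c \<in> M" "is_chart c" "card I = k" "q \<in> chart_dom c" "submanifold_chart M N k c I"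
    "chart_inv c (coords c q) = q"
  using assms compatible_is_chart[OF cM]
  by (auto simp: sub_chart_at_def submanifold_chart_def charts_at_def)

lemma sub_chart_N:
  "submanifold_chart M N k c I \<Longrightarrow> q \<in> chart_dom c \<Longrightarrow> q \<in> N \<longleftrightarrow> (\<forall>l\<in>I. coords c q $ l = 0)"
  by (auto simp: submanifold_chart_def)

lemma sub_chart_exists: "q \<in> N \<Longrightarrow> \<exists>c I. sub_chart_at c I q"
  using N unfolding embedded_submanifold_def sub_chart_at_def by blast

text \<open>A segment from \<open>coords c q\<close> in direction \<open>u\<close> stays in the
  coordinate image of \<open>N\<close> for small parameters, where the normal coordinates of
  \<open>d\<close> vanish; so their difference quotients are 0. This makes \<open>TN\<close>
  independent of the chart.\<close>

lemma transition_preserves_N: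
  assumes c: "sub_chart_at c I q" and d: "sub_chart_at d J q" and q: "q \<in> N"
    and u: "\<forall>l\<in>I. u $ l = 0" and l: "l \<in> J"
  shows "frechet_derivative (coords d \<circ> chart_inv c) (at (coords c q)) u $ l = 0"
proof -
  let ?f = "coords d \<circ> chart_inv c" and ?S = "coords c ` (chart_dom c \<inter> chart_dom d)"
  note cd = compatible_pair[OF cM sub_chart_atD(2)[OF c] sub_chart_atD(2)[OF d]]
  have D: "(?f has_derivative frechet_derivative ?f (at (coords c q))) (at (coords c q))"
    by (rule transition_has_derivative[OF cM sub_chart_atD(1)[OF c] sub_chart_atD(1)[OF d]])
  have zero: "?f z $ l = 0" if z: "z \<in> ?S" "\<forall>l\<in>I. z $ l = 0" for z
  proof -
    obtain p where p: "p \<in> chart_dom c" "p \<in> chart_dom d" "z = coords c p" using z(1) by blast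
    then have "p \<in> N" using sub_chart_N[OF sub_chart_atD(6)[OF c]] z(2) by simp
    then show ?thesis using p sub_chart_N[OF sub_chart_atD(6)[OF d]] l sub_chart_atD(3)[OF c] by simp
  qed
  have cq: "coords c q \<in> ?S" "\<forall>l\<in>I. coords c q $ l = 0"
    using sub_chart_N[OF sub_chart_atD(6)[OF c]] q sub_chart_atD(5)[OF c] sub_chart_atD(5)[OF d] by auto
  have "(\<lambda>n. coords c q + null_seq n *\<^sub>R u) \<longlonglongrightarrow> coords c q + 0 *\<^sub>R u" by (intro tendsto_intros null_seq)
  then have lim: "(\<lambda>n. coords c q + null_seq n *\<^sub>R u) \<longlonglongrightarrow> coords c q" by simp
  have "\<forall>\<^sub>F n in sequentially. coords c q + null_seq n *\<^sub>R u \<in> ?S"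
    using lim smoothly_compatibleD(1)[OF cd] cq(1) by (rule topological_tendstoD)
  then have "\<forall>\<^sub>F n in sequentially. ((?f (coords c q + null_seq n *\<^sub>R u) - ?f (coords c q)) /\<^sub>R null_seq n) $ l = 0"
  proof eventually_elim
    case (elim n)
    then show ?case using zero[OF elim] zero[OF cq] cq(2) u by simp
  qed
  then have "(\<lambda>n. ((?f (coords c q + null_seq n *\<^sub>R u) - ?f (coords c q)) /\<^sub>R null_seq n) $ l) \<longlonglongrightarrow> 0"
    by (rule tendsto_eventually)
  from LIMSEQ_unique[OF tendsto_vec_nth[OF directional_difference_tendsto[OF D null_seq]] this]
  show ?thesis .
qed

abbreviation TN :: "'a \<Rightarrow> ('a, 'n) tvec set" where "TN q \<equiv> submanifold_tangent_space M N k q"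

lemma TN_iff:
  assumes c: "sub_chart_at c I q" and q: "q \<in> N"
  shows "v \<in> TN q \<longleftrightarrow> v \<in> tangent_space M q \<and> (\<forall>l\<in>I. v c $ l = 0)"
proof
  assume "v \<in> TN q"
  then have "v \<in> tangent_space M q" and
    "\<exists>d J. q \<in> chart_dom d \<and> submanifold_chart M N k d J \<and> (\<forall>l\<in>J. v d $ l = 0)"
    unfolding submanifold_tangent_space_def by simp_all
  then obtain d J where v: "v \<in> tangent_space M q" and d: "sub_chart_at d J q" "\<forall>l\<in>J. v d $ l = 0"
    unfolding sub_chart_at_def by metis
  then show "v \<in> tangent_space M q \<and> (\<forall>l\<in>I. v c $ l = 0)"
    using transition_preserves_N[OF d(1) c q d(2)]
      tangent_space_transition[OF cM v sub_chart_atD(1)[OF d(1)] sub_chart_atD(1)[OF c]] by simp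
next
  assume "v \<in> tangent_space M q \<and> (\<forall>l\<in>I. v c $ l = 0)"
  then show "v \<in> TN q"
    unfolding submanifold_tangent_space_def
    by (intro CollectI conjI exI[of _ c] exI[of _ I] sub_chart_atD(5,6)[OF c]) simp_all
qed

lemma subspace_TN: "q \<in> N \<Longrightarrow> subspace (TN q)"
proof -
  assume q: "q \<in> N"
  obtain c I where c: "sub_chart_at c I q" using sub_chart_exists[OF q] by blast
  have eq: "TN q = tangent_space M q \<inter> {v. \<forall>l\<in>I. v c $ l = 0}" using TN_iff[OF c q] by blast
  have sub: "subspace {v :: ('a, 'n) tvec. \<forall>l\<in>I. v c $ l = 0}" by (auto simp: subspace_def)
  show ?thesis unfolding eq by (rule subspace_inter[OF subspace_tangent_space[OF cM] sub])
qed

abbreviation line :: "'a \<Rightarrow> ('a, 'n) tvec \<Rightarrow> ('a, 'n) tvec set set" where "line q v \<equiv> normal_line M N k q v"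

text \<open>Equal lines have proportional normal coordinates, so the ratios in
  \<open>blowup_chart\<close> do not depend on the representative picked by
  \<open>SOME\<close>.\<close>

lemma line_eqD:
  assumes c: "sub_chart_at c I q" and q: "q \<in> N" and eq: "line q v = line q v'"
    and v': "v' \<in> tangent_space M q" "v' \<notin> TN q"
  shows "\<exists>r. r \<noteq> 0 \<and> (\<forall>l\<in>I. v' c $ l = r * v c $ l)"
proof -
  have "normal_class M N k q (1 *\<^sub>R v') \<in> line q v" unfolding eq unfolding normal_line_def by (rule rangeI)
  then obtain r where r: "normal_class M N k q v' = normal_class M N k q (r *\<^sub>R v)"
    unfolding normal_line_def by auto
  have "v' + 0 \<in> normal_class M N k q v'"
    unfolding normal_class_def using subspace_0[OF subspace_TN[OF q]] by blast
  then obtain u where u: "u \<in> TN q" "v' = r *\<^sub>R v + u"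
    unfolding r unfolding normal_class_def by auto
  have "v' c $ l = r * v c $ l" if "l \<in> I" for l
    using u TN_iff[OF c q, of u] that by simp
  moreover have "r \<noteq> 0" using u v'(2) by auto
  ultimately show ?thesis by blast
qed

lemma line_eqI:
  assumes c: "sub_chart_at c I q" and q: "q \<in> N" and r: "r \<noteq> 0" "\<forall>l\<in>I. v' c $ l = r * v c $ l"
    and v: "v \<in> tangent_space M q" "v' \<in> tangent_space M q"
  shows "line q v = line q v'"
proof -
  note T = subspace_TN[OF q]
  have class_eq: "normal_class M N k q x = normal_class M N k q y" if "x - y \<in> TN q" for x y
  proof -
    have "\<exists>u'\<in>TN q. x + u = y + u'" if "u \<in> TN q" for u
      using subspace_add[OF T \<open>x - y \<in> TN q\<close> that] by (intro bexI[of _ "x - y + u"]) simp_all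
    moreover have "\<exists>u'\<in>TN q. y + u = x + u'" if "u \<in> TN q" for u
      using subspace_diff[OF T that \<open>x - y \<in> TN q\<close>] by (intro bexI[of _ "u - (x - y)"]) simp_all
    ultimately show ?thesis unfolding normal_class_def image_def by fast
  qed
  have "v' - r *\<^sub>R v \<in> TN q"
    unfolding TN_iff[OF c q]
    using r(2) subspace_diff[OF subspace_tangent_space[OF cM]] subspace_scale[OF subspace_tangent_space[OF cM]] v
    by simp
  then have "s *\<^sub>R v' - (s * r) *\<^sub>R v \<in> TN q" for s
    using subspace_scale[OF T, of "v' - r *\<^sub>R v" s] by (simp add: scaleR_right_diff_distrib)
  then have eq: "normal_class M N k q (s *\<^sub>R v') = normal_class M N k q ((s * r) *\<^sub>R v)" for s
    by (rule class_eq)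
  have "line q v' = range (\<lambda>s. normal_class M N k q ((s * r) *\<^sub>R v))"
    unfolding normal_line_def eq ..
  also have "\<dots> = range ((\<lambda>s. normal_class M N k q (s *\<^sub>R v)) \<circ> (\<lambda>s. s * r))" by (simp add: o_def)
  also have "\<dots> = line q v"
  proof -
    have "surj (\<lambda>s. s * r)" using r(1) by (intro surjI[of _ "\<lambda>s. s / r"]) simp
    then show ?thesis unfolding normal_line_def by (metis image_comp)
  qed
  finally show ?thesis ..
qed

lemma line_representative:
  assumes "v \<in> tangent_space M q" "v \<notin> TN q"
  defines "w \<equiv> line_representative M N k q (line q v)"
  shows "w \<in> tangent_space M q" "w \<notin> TN q" "line q v = line q w"
  using someI[of "\<lambda>w. w \<in> tangent_space M q - TN q \<and> line q v = line q w" v] assms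
  by (auto simp: w_def line_representative_def)

section \<open>Explicit inverses of the blowup charts\<close>

definition line_vector :: "'n set \<Rightarrow> 'n \<Rightarrow> real^'n \<Rightarrow> real^'n" where
  "line_vector I i z = (\<chi> l. if l = i then 1 else if l \<in> I then z $ l else 0)"

definition blowup_chart_inv :: "('a, 'n) chart \<Rightarrow> 'n set \<Rightarrow> 'n \<Rightarrow> real^'n \<Rightarrow> ('a, 'n) blowup_point" where
  "blowup_chart_inv c I i z =
    (let q = chart_inv c (blowdown_coords I i z) in
     if z $ i = 0 then Inr (q, line q (tangent_of M q c (line_vector I i z))) else Inl q)"

abbreviation BC :: "('a, 'n) chart \<Rightarrow> 'n set \<Rightarrow> 'n \<Rightarrow> (('a, 'n) blowup_point, 'n) chart" where
  "BC c I i \<equiv> blowup_chart M N k c I i"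

lemma Inl_in_BC: "Inl q \<in> chart_dom (BC c I i) \<longleftrightarrow> q \<in> chart_dom c \<and> coords c q $ i \<noteq> 0"
  by (auto simp: blowup_chart_def)

lemma Inr_in_BC: "Inr (q, l) \<in> chart_dom (BC c I i) \<longleftrightarrow>
  (\<exists>v. l = line q v \<and> q \<in> chart_dom c \<and> q \<in> N \<and> v \<in> tangent_space M q \<and> v c $ i \<noteq> 0)"
  by (auto simp: blowup_chart_def)

lemma coords_BC_Inl:
  "coords (BC c I i) (Inl q) = (\<chi> j. if j \<in> I - {i} then coords c q $ j / coords c q $ i else coords c q $ j)"
  by (simp add: blowup_chart_def)

lemma coords_BC_Inr:
  assumes c: "sub_chart_at c I q" and q: "q \<in> N" and i: "i \<in> I"
    and v: "v \<in> tangent_space M q" "v c $ i \<noteq> 0"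
  shows "coords (BC c I i) (Inr (q, line q v)) =
    (\<chi> j. if j \<in> I - {i} then v c $ j / v c $ i else coords c q $ j)"
proof -
  have vT: "v \<notin> TN q" using TN_iff[OF c q] v(2) i by blast
  let ?w = "line_representative M N k q (line q v)"
  note w = line_representative[OF v(1) vT]
  obtain r where r: "r \<noteq> 0" "\<forall>l\<in>I. ?w c $ l = r * v c $ l"
    using line_eqD[OF c q w(3) w(1,2)] by blast
  then show ?thesis using i by (simp add: blowup_chart_def Let_def vec_eq_iff)
qed

context
  fixes c :: "('a, 'n) chart" and I :: "'n set" and i :: 'n
  assumes c: "submanifold_chart M N k c I" and i: "i \<in> I"
begin

lemma c_chart: "is_chart c" "c \<in> M"
  using c compatible_is_chart[OF cM] by (auto simp: submanifold_chart_def)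

lemma c_at: "q \<in> chart_dom c \<Longrightarrow> sub_chart_at c I q"
  using c by (simp add: sub_chart_at_def)

lemma BC_left_inverse:
  assumes b: "b \<in> chart_dom (BC c I i)"
  shows "blowdown b \<in> chart_dom c" "blowdown_coords I i (coords (BC c I i) b) = coords c (blowdown b)"
    "blowup_chart_inv c I i (coords (BC c I i) b) = b" "b \<in> blowup_set M N k"
proof -
  have "blowdown b \<in> chart_dom c \<and> blowdown_coords I i (coords (BC c I i) b) = coords c (blowdown b) \<and>
    blowup_chart_inv c I i (coords (BC c I i) b) = b \<and> b \<in> blowup_set M N k"
  proof (cases b)
    case (Inl q)
    then have q: "q \<in> chart_dom c" "coords c q $ i \<noteq> 0" using b by (auto simp: Inl_in_BC)
    let ?z = "coords (BC c I i) b"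
    have z: "blowdown_coords I i ?z = coords c q" "?z $ i = coords c q $ i"
      unfolding Inl coords_BC_Inl using q by (auto simp: blowdown_coords_def vec_eq_iff)
    have "q \<notin> N" using sub_chart_N[OF c q(1)] q(2) i by auto
    moreover have "q \<in> points M" using q(1) c_chart by (auto simp: points_def)
    ultimately show ?thesis
      using z q c_chart by (auto simp: Inl blowdown_def blowup_chart_inv_def blowup_set_def)
  next
    case (Inr p)
    then obtain q v where p: "p = (q, line q v)" and q: "q \<in> chart_dom c" "q \<in> N"
      and v: "v \<in> tangent_space M q" "v c $ i \<noteq> 0"
      using b by (cases p) (auto simp: Inr_in_BC)
    let ?z = "coords (BC c I i) b"
    note cq = c_at[OF q(1)]
    have q0: "\<forall>l\<in>I. coords c q $ l = 0" using sub_chart_N[OF c q(1)] q(2) by blast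
    have z: "?z = (\<chi> j. if j \<in> I - {i} then v c $ j / v c $ i else coords c q $ j)"
      unfolding Inr p by (rule coords_BC_Inr[OF cq q(2) i v])
    have zi: "?z $ i = 0" and bd: "blowdown_coords I i ?z = coords c q"
      unfolding z using q0 i by (auto simp: blowdown_coords_def vec_eq_iff)
    have "line q v = line q (tangent_of M q c (line_vector I i ?z))"
    proof (rule line_eqI[OF cq q(2) _ _ v(1) tangent_of_in_tangent_space[OF cM sub_chart_atD(1)[OF cq]]])
      show "1 / v c $ i \<noteq> 0" using v(2) by simp
      show "\<forall>l\<in>I. tangent_of M q c (line_vector I i ?z) c $ l = 1 / v c $ i * v c $ l"
        using v(2) unfolding tangent_of_chart[OF cM sub_chart_atD(1)[OF cq]] z by (auto simp: line_vector_def)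
    qed
    moreover have "v \<notin> TN q" using TN_iff[OF cq q(2)] v(2) i by blast
    ultimately show ?thesis
      using zi bd q v sub_chart_atD(7)[OF cq]
      by (auto simp: Inr p blowdown_def blowup_chart_inv_def blowup_set_def projective_normal_bundle_def)
  qed
  then show "blowdown b \<in> chart_dom c" "blowdown_coords I i (coords (BC c I i) b) = coords c (blowdown b)"
    "blowup_chart_inv c I i (coords (BC c I i) b) = b" "b \<in> blowup_set M N k" by simp_all
qed

lemma BC_right_inverse:
  assumes z: "blowdown_coords I i z \<in> coords c ` chart_dom c"
  shows "blowup_chart_inv c I i z \<in> chart_dom (BC c I i)"
    and "coords (BC c I i) (blowup_chart_inv c I i z) = z"
    and "blowdown (blowup_chart_inv c I i z) = chart_inv c (blowdown_coords I i z)"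
proof -
  let ?q = "chart_inv c (blowdown_coords I i z)"
  have q: "?q \<in> chart_dom c" "coords c ?q = blowdown_coords I i z"
    using chart_inv_in_dom[OF z] coords_chart_inv[OF z] by auto
  show "blowdown (blowup_chart_inv c I i z) = ?q"
    by (simp add: blowup_chart_inv_def Let_def blowdown_def)
  have "blowup_chart_inv c I i z \<in> chart_dom (BC c I i) \<and> coords (BC c I i) (blowup_chart_inv c I i z) = z"
  proof (cases "z $ i = 0")
    case False
    then show ?thesis using q
      by (auto simp: blowup_chart_inv_def Let_def Inl_in_BC coords_BC_Inl blowdown_coords_def vec_eq_iff)
  next
    case True
    have "\<forall>l\<in>I. coords c ?q $ l = 0" unfolding q(2) using True by (simp add: blowdown_coords_exceptional)
    then have qN: "?q \<in> N" using sub_chart_N[OF c q(1)] by blast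
    note cq = c_at[OF q(1)]
    let ?v = "tangent_of M ?q c (line_vector I i z)"
    have v: "?v \<in> tangent_space M ?q" "?v c = line_vector I i z"
      by (rule tangent_of_in_tangent_space[OF cM sub_chart_atD(1)[OF cq]])
        (rule tangent_of_chart[OF cM sub_chart_atD(1)[OF cq]])
    have vi: "?v c $ i \<noteq> 0" unfolding v(2) by (simp add: line_vector_def)
    have eq: "blowup_chart_inv c I i z = Inr (?q, line ?q ?v)"
      using True by (simp add: blowup_chart_inv_def Let_def)
    have "Inr (?q, line ?q ?v) \<in> chart_dom (BC c I i)"
      unfolding Inr_in_BC using q(1) qN v(1) vi by blast
    moreover have "coords (BC c I i) (Inr (?q, line ?q ?v)) = z"
      unfolding coords_BC_Inr[OF cq qN i v(1) vi] v(2) q(2)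
      using True by (auto simp: line_vector_def vec_eq_iff blowdown_coords_def)
    ultimately show ?thesis unfolding eq by simp
  qed
  then show "blowup_chart_inv c I i z \<in> chart_dom (BC c I i)"
    "coords (BC c I i) (blowup_chart_inv c I i z) = z" by auto
qed

text \<open>The image is a full preimage, hence open, and the condition
  \<open>blowdown_coords I i z \<in> U\<close> of the local model describes exactly the points of
  the chart.\<close>

lemma BC_image: "coords (BC c I i) ` chart_dom (BC c I i) = blowdown_coords I i -` (coords c ` chart_dom c)"
proof (intro set_eqI iffI)
  fix z assume "z \<in> coords (BC c I i) ` chart_dom (BC c I i)"
  then show "z \<in> blowdown_coords I i -` (coords c ` chart_dom c)" using BC_left_inverse(1,2) by auto
next
  fix z assume "z \<in> blowdown_coords I i -` (coords c ` chart_dom c)"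
  then show "z \<in> coords (BC c I i) ` chart_dom (BC c I i)" using BC_right_inverse by (metis imageI vimageD)
qed

lemma continuous_blowdown_coords: "continuous_on UNIV (blowdown_coords I i)"
  by (rule smooth_on_imp_continuous_on[OF smooth_on_blowdown_coords])

lemma BC_is_chart: "is_chart (BC c I i)"
  unfolding is_chart_def BC_image
  by (intro conjI inj_on_inverseI[of _ "blowup_chart_inv c I i"] BC_left_inverse
      open_vimage open_chart_image c_chart continuous_blowdown_coords)

lemma chart_inv_BC:
  assumes "blowdown_coords I i z \<in> coords c ` chart_dom c"
  shows "chart_inv (BC c I i) z = blowup_chart_inv c I i z"
  using chart_inv_coords[OF BC_is_chart BC_right_inverse(1)[OF assms]] BC_right_inverse(2)[OF assms] by simp

end

text \<open>The target coordinates are ratios of normal coordinates \<open>F l\<close>, which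
  degenerate to 0/0 on the divisor. Each \<open>F l\<close> is smoothly divisible by
  \<open>z $ i\<close>, and the ratios of the quotients \<open>G l\<close> are smooth where
  \<open>G j\<close> is nonzero, which is exactly the overlap.\<close>

lemma BC_compatible_half:
  assumes c: "submanifold_chart M N k c I" and i: "i \<in> I"
    and d: "submanifold_chart M N k d J" and j: "j \<in> J"
  defines "S \<equiv> coords (BC c I i) ` (chart_dom (BC c I i) \<inter> chart_dom (BC d J j))"
  shows "open S \<and> smooth_on S (coords (BC d J j) \<circ> chart_inv (BC c I i))"
proof -
  note cd = compatible_pair[OF cM c_chart(2)[OF c i] c_chart(2)[OF d j]]
  let ?V = "coords c ` (chart_dom c \<inter> chart_dom d)" and ?\<phi> = "coords d \<circ> chart_inv c"
  let ?W = "blowdown_coords I i -` ?V"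
  let ?f = "?\<phi> \<circ> blowdown_coords I i"
  define F where "F l z = ?f z $ l" for l z
  define G where "G l = divided_coord i (F l)" for l
  note bcont = smooth_on_imp_continuous_on[OF smooth_on_blowdown_coords]
  have W: "open ?W" by (rule open_vimage[OF smoothly_compatibleD(1)[OF cd] bcont])
  have "smooth_on ?W ?f"
    by (rule smooth_on_compose[OF W smoothly_compatibleD(1)[OF cd] smooth_on_subset[OF smooth_on_blowdown_coords]
          smoothly_compatibleD(2)[OF cd]]) auto
  then have F: "smooth_on ?W (F l)" for l unfolding F_def by (rule smooth_on_nth[OF W])
  have F0: "F l z = 0" if z: "z \<in> ?W" "z $ i = 0" and l: "l \<in> J" for l z
  proof -
    obtain q where q: "q \<in> chart_dom c" "q \<in> chart_dom d" "blowdown_coords I i z = coords c q" using z(1) by auto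
    have "\<forall>l\<in>I. coords c q $ l = 0" unfolding q(3)[symmetric] using z(2) by (simp add: blowdown_coords_exceptional)
    then have "q \<in> N" using sub_chart_N[OF c q(1)] by blast
    then show ?thesis using sub_chart_N[OF d q(2)] l q c_chart(1)[OF c i] by (simp add: F_def)
  qed
  have G: "smooth_on ?W (G l)" if "l \<in> J" for l
    unfolding G_def by (rule smooth_on_divided_coord[OF W F F0[OF _ _ that]])
  have GF: "F l z = z $ i * G l z" if "z \<in> ?W" "z $ i \<noteq> 0" for l z
    using that by (simp add: G_def divided_coord_def)
  have key: "(blowup_chart_inv c I i z \<in> chart_dom (BC d J j) \<longleftrightarrow> G j z \<noteq> 0) \<and>
      (G j z \<noteq> 0 \<longrightarrow> coords (BC d J j) (blowup_chart_inv c I i z) =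
        (\<chi> l. if l \<in> J - {j} then G l z / G j z else F l z))" if z: "z \<in> ?W" for z
  proof -
    obtain q where q: "q \<in> chart_dom c" "q \<in> chart_dom d" "blowdown_coords I i z = coords c q" using z by auto
    have qi: "chart_inv c (blowdown_coords I i z) = q" using q c_chart(1)[OF c i] by simp
    have Fq: "F l z = coords d q $ l" for l by (simp add: F_def qi)
    show ?thesis
    proof (cases "z $ i = 0")
      case False
      then have eq: "blowup_chart_inv c I i z = Inl q" by (simp add: blowup_chart_inv_def qi)
      show ?thesis
        unfolding eq Inl_in_BC coords_BC_Inl Fq[symmetric] using q(2) False GF[OF z False]
        by (simp add: vec_eq_iff)
    next
      case True
      let ?v = "tangent_of M q c (line_vector I i z)"
      have eq: "blowup_chart_inv c I i z = Inr (q, line q ?v)" using True by (simp add: blowup_chart_inv_def qi)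
      have "\<forall>l\<in>I. coords c q $ l = 0" unfolding q(3)[symmetric] using True by (simp add: blowdown_coords_exceptional)
      then have qN: "q \<in> N" using sub_chart_N[OF c q(1)] by blast
      note cq = c_at[OF c i q(1)] and dq = c_at[OF d j q(2)]
      have v: "?v \<in> tangent_space M q" "?v c = line_vector I i z"
        by (rule tangent_of_in_tangent_space[OF cM sub_chart_atD(1)[OF cq]])
          (rule tangent_of_chart[OF cM sub_chart_atD(1)[OF cq]])
      \<comment> \<open>On the divisor \<open>G l\<close> is the \<open>i\<close>-th partial
        derivative of \<open>F l\<close>. The blowdown sends \<open>axis i 1\<close> to the spanning
        vector of the line, so by the chain rule \<open>G l\<close> is its \<open>l\<close>-th
        coordinate in \<open>d\<close>.\<close>
      have Gv: "G l z = ?v d $ l" if "l \<in> J" for l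
      proof -
        have "blowdown_deriv I i z (axis i 1) = line_vector I i z"
          using True i by (auto simp: blowdown_deriv_def line_vector_def vec_eq_iff axis_def)
        moreover have "(?\<phi> has_derivative frechet_derivative ?\<phi> (at (coords c q))) (at (blowdown_coords I i z))"
          using transition_has_derivative[OF cM sub_chart_atD(1)[OF cq] sub_chart_atD(1)[OF dq]] q(3) by simp
        from diff_chain_at[OF blowdown_coords_has_derivative this]
        have "(F l has_derivative (\<lambda>w. frechet_derivative ?\<phi> (at (coords c q)) (blowdown_deriv I i z w) $ l)) (at z)"
          unfolding F_def
          by (intro bounded_linear.has_derivative[OF bounded_linear_vec_nth]) (simp add: o_def)
        from frechet_derivative_eqI[OF this]
        have "G l z = frechet_derivative ?\<phi> (at (coords c q)) (blowdown_deriv I i z (axis i 1)) $ l"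
          using True by (simp add: G_def divided_coord_def)
        ultimately show ?thesis
          using tangent_space_transition[OF cM v(1) sub_chart_atD(1)[OF cq] sub_chart_atD(1)[OF dq]] v(2) by simp
      qed
      have iff: "blowup_chart_inv c I i z \<in> chart_dom (BC d J j) \<longleftrightarrow> ?v d $ j \<noteq> 0"
      proof
        assume "blowup_chart_inv c I i z \<in> chart_dom (BC d J j)"
        then obtain v' where v': "line q ?v = line q v'" "v' \<in> tangent_space M q" "v' d $ j \<noteq> 0"
          unfolding eq Inr_in_BC by blast
        then have "v' \<notin> TN q" using TN_iff[OF dq qN] j by blast
        from line_eqD[OF dq qN v'(1,2) this] show "?v d $ j \<noteq> 0" using v'(3) j by auto
      next
        assume "?v d $ j \<noteq> 0"
        then show "blowup_chart_inv c I i z \<in> chart_dom (BC d J j)"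
          unfolding eq Inr_in_BC using q(2) qN v(1) by blast
      qed
      show ?thesis
        unfolding iff unfolding eq using coords_BC_Inr[OF dq qN j v(1)] Gv j
        by (auto simp: Fq vec_eq_iff)
    qed
  qed
  have S: "S = ?W \<inter> G j -` (- {0})"
  proof (intro set_eqI iffI)
    fix z assume "z \<in> S"
    then obtain b where b: "b \<in> chart_dom (BC c I i)" "b \<in> chart_dom (BC d J j)" "z = coords (BC c I i) b"
      by (auto simp: S_def)
    have z: "z \<in> ?W" using BC_left_inverse(1,2)[OF c i b(1)] BC_left_inverse(1)[OF d j b(2)] b(3) by simp
    then show "z \<in> ?W \<inter> G j -` (- {0})" using key[OF z] BC_left_inverse(3)[OF c i b(1)] b by simp
  next
    fix z assume z: "z \<in> ?W \<inter> G j -` (- {0})"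
    then have zc: "blowdown_coords I i z \<in> coords c ` chart_dom c" by auto
    show "z \<in> S"
      unfolding S_def using BC_right_inverse[OF c i zc] key[of z] z
      by (intro image_eqI[of _ _ "blowup_chart_inv c I i z"]) simp_all
  qed
  have opS: "open S"
    unfolding S by (intro continuous_open_preimage smooth_on_imp_continuous_on[OF G[OF j]] W) (simp add: open_Compl)
  have GS: "smooth_on S (G l)" if "l \<in> J" for l by (rule smooth_on_subset[OF G[OF that]]) (auto simp: S)
  have FS: "smooth_on S (F l)" for l by (rule smooth_on_subset[OF F]) (auto simp: S)
  have "smooth_on S (\<lambda>z. \<chi> l. if l \<in> J - {j} then G l z / G j z else F l z)"
  proof (rule smooth_on_vec[OF opS])
    fix l
    show "smooth_on S (\<lambda>z. (\<chi> l. if l \<in> J - {j} then G l z / G j z else F l z) $ l)"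
    proof (cases "l \<in> J - {j}")
      case True
      then have "smooth_on S (\<lambda>z. G l z / G j z)"
        by (intro smooth_on_divide[OF opS] GS j) (auto simp: S)
      then show ?thesis using True by simp
    next
      case False
      then show ?thesis using FS[of l] by auto
    qed
  qed
  then have "smooth_on S (coords (BC d J j) \<circ> chart_inv (BC c I i))"
  proof (rule smooth_on_cong[OF opS, rotated])
    fix z assume z: "z \<in> S"
    then have zc: "blowdown_coords I i z \<in> coords c ` chart_dom c" and zW: "z \<in> ?W" "G j z \<noteq> 0" by (auto simp: S)
    show "(\<chi> l. if l \<in> J - {j} then G l z / G j z else F l z) = (coords (BC d J j) \<circ> chart_inv (BC c I i)) z"
      using key[OF zW(1)] zW(2) by (simp add: chart_inv_BC[OF c i zc])
  qed
  with opS show ?thesis ..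
qed

section \<open>The blowup atlas\<close>

definition blowup_atlas :: "(('a, 'n) blowup_point, 'n) chart set" where
  "blowup_atlas = {BC c I i | c I i. submanifold_chart M N k c I \<and> i \<in> I}"

lemma compatible_blowup_atlas: "compatible_charts blowup_atlas"
  unfolding compatible_charts_def
proof (intro conjI ballI)
  fix b assume "b \<in> blowup_atlas"
  then obtain c I i where c: "b = BC c I i" "submanifold_chart M N k c I" "i \<in> I" by (auto simp: blowup_atlas_def)
  then show "is_chart b" by (simp add: BC_is_chart)
  fix b' assume "b' \<in> blowup_atlas"
  then obtain d J j where d: "b' = BC d J j" "submanifold_chart M N k d J" "j \<in> J" by (auto simp: blowup_atlas_def)
  show "smoothly_compatible b b'"
    using BC_compatible_half[OF c(2,3) d(2,3)] BC_compatible_half[OF d(2,3) c(2,3)]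
    by (simp add: c(1) d(1) smoothly_compatible_def Let_def Int_commute)
qed

lemma points_blowup_atlas: "points blowup_atlas = blowup_set M N k"
proof
  show "points blowup_atlas \<subseteq> blowup_set M N k"
    using BC_left_inverse(4) by (auto simp: points_def blowup_atlas_def)
  show "blowup_set M N k \<subseteq> points blowup_atlas"
  proof
    fix b assume b: "b \<in> blowup_set M N k"
    have "\<exists>c I i. submanifold_chart M N k c I \<and> i \<in> I \<and> b \<in> chart_dom (BC c I i)"
    proof (cases b)
      case (Inl q)
      then have q: "q \<in> points M" "q \<notin> N" using b by (auto simp: blowup_set_def)
      obtain c where c: "c \<in> M" "q \<in> chart_dom c" using q(1) by (auto simp: points_def)
      have "k \<le> card (UNIV :: 'n set)" using N by (simp add: embedded_submanifold_def)
      then obtain I :: "'n set" where I: "card I = k" using obtain_subset_with_card_n by metis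
      obtain i where i: "i \<in> I" using I k by (metis card.empty ex_in_conv less_irrefl)
      \<comment> \<open>Shifts the coordinates of \<open>q\<close> to all ones. Away from
        \<open>N\<close> any \<open>k\<close> indices serve as \<open>I\<close>: with
        \<open>N\<close> removed and the \<open>i\<close>-th coordinate nonzero on \<open>W\<close>,
        both sides of the submanifold condition are false.\<close>
      define a :: "real^'n" where "a = (\<chi> l. 1) - coords c q"
      define W where "W = (chart_dom c \<inter> coords c -` {z. (z + a) $ i \<noteq> 0}) - N"
      have "open {z :: real^'n. (z + a) $ i \<noteq> 0}" by (intro open_Collect_neq continuous_intros)
      from openin_chart_preimage[OF cM c(1) this]
      have W: "openin (manifold_topology M) W" "W \<subseteq> chart_dom c"
        unfolding W_def using N_closed by (auto intro: openin_diff)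
      have "(W, \<lambda>q. coords c q + a) \<in> M" by (rule chart_restrict_translate[OF M c(1) W])
      then have "submanifold_chart M N k (W, \<lambda>q. coords c q + a) I"
        using I i by (auto simp: submanifold_chart_def W_def)
      moreover have "Inl q \<in> chart_dom (BC (W, \<lambda>q. coords c q + a) I i)"
        using q c by (simp add: Inl_in_BC W_def a_def)
      ultimately show ?thesis using i Inl by blast
    next
      case (Inr p)
      then obtain q v where p: "p = (q, line q v)" and q: "q \<in> N" and v: "v \<in> tangent_space M q" "v \<notin> TN q"
        using b by (auto simp: blowup_set_def projective_normal_bundle_def)
      obtain c I where c: "sub_chart_at c I q" using sub_chart_exists[OF q] by blast
      obtain i where "i \<in> I" "v c $ i \<noteq> 0" using TN_iff[OF c q] v by blast
      then have "Inr (q, line q v) \<in> chart_dom (BC c I i)"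
        unfolding Inr_in_BC using v(1) q sub_chart_atD(5)[OF c] by blast
      then show ?thesis using Inr p \<open>i \<in> I\<close> sub_chart_atD(6)[OF c] by blast
    qed
    then show "b \<in> points blowup_atlas" unfolding points_def blowup_atlas_def by blast
  qed
qed

abbreviation Bl :: "(('a, 'n) blowup_point, 'n) chart set" where "Bl \<equiv> blowup M N k"

lemma blowup_eq: "Bl = smooth_structure (blowup_set M N k) blowup_atlas"
  by (simp add: blowup_def blowup_atlas_def)

lemmas cB = compatible_charts_smooth_structure(1)[OF compatible_blowup_atlas points_blowup_atlas, folded blowup_eq]
  and atlas_subset = compatible_charts_smooth_structure(2)[OF compatible_blowup_atlas points_blowup_atlas, folded blowup_eq]
  and points_blowup = compatible_charts_smooth_structure(3)[OF compatible_blowup_atlas points_blowup_atlas, folded blowup_eq]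

lemma BC_in_blowup: "submanifold_chart M N k c I \<Longrightarrow> i \<in> I \<Longrightarrow> BC c I i \<in> Bl"
  using atlas_subset unfolding blowup_atlas_def by blast

lemma blowup_cover:
  assumes "b \<in> points Bl"
  shows "\<exists>c I i. submanifold_chart M N k c I \<and> i \<in> I \<and> b \<in> chart_dom (BC c I i)"
  using assms unfolding points_blowup points_blowup_atlas[symmetric] unfolding points_def blowup_atlas_def by blast

end

context submanifold_setting
begin

section \<open>The blowdown as a smooth map\<close>

lemma smooth_map_blowdown: "smooth_map Bl M blowdown"
  unfolding smooth_map_def Let_def
proof (intro conjI ballI)
  show "blowdown ` points Bl \<subseteq> points M"
  proof
    fix q assume "q \<in> blowdown ` points Bl"
    then obtain b where b: "b \<in> points Bl" "q = blowdown b" by blast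
    obtain c I i where c: "submanifold_chart M N k c I" "i \<in> I" "b \<in> chart_dom (BC c I i)"
      using blowup_cover[OF b(1)] by blast
    show "q \<in> points M"
      using BC_left_inverse(1)[OF c] c_chart(2)[OF c(1,2)] unfolding b(2) points_def by blast
  qed
  fix e d assume e: "e \<in> Bl" and d: "d \<in> M"
  let ?S = "coords e ` (chart_dom e \<inter> blowdown -` chart_dom d)"
  note ee = compatible_is_chart[OF cB e]
  have loc: "\<exists>T. open T \<and> z \<in> T \<and> T \<subseteq> ?S \<and> smooth_on T (coords d \<circ> blowdown \<circ> chart_inv e)" if z: "z \<in> ?S" for z
  proof -
    obtain b where b: "b \<in> chart_dom e" "blowdown b \<in> chart_dom d" "z = coords e b" using z by blast
    then have "b \<in> points Bl" using e unfolding points_def by blast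
    then obtain c I i where c: "submanifold_chart M N k c I" "i \<in> I" "b \<in> chart_dom (BC c I i)"
      using blowup_cover by blast
    let ?B = "BC c I i"
    note eB = compatible_pair[OF cB e BC_in_blowup[OF c(1,2)]]
    note cd = compatible_pair[OF cM c_chart(2)[OF c(1,2)] d]
    note cc = c_chart(1)[OF c(1,2)]
    let ?V = "coords c ` (chart_dom c \<inter> chart_dom d)" and ?E = "coords e ` (chart_dom e \<inter> chart_dom ?B)"
    let ?g = "blowdown_coords I i \<circ> (coords ?B \<circ> chart_inv e)"
    let ?T = "?E \<inter> ?g -` ?V"
    have sg: "smooth_on ?E ?g"
      by (rule smooth_on_compose[OF smoothly_compatibleD(1)[OF eB] open_UNIV smoothly_compatibleD(2)[OF eB]
            smooth_on_blowdown_coords]) simp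
    have T: "open ?T"
      by (rule continuous_open_preimage[OF smooth_on_imp_continuous_on[OF sg] smoothly_compatibleD(1)[OF eB]
            smoothly_compatibleD(1)[OF cd]])
    have pt: "?g (coords e p) = coords c (blowdown p)" "blowdown p \<in> chart_dom c"
      if "p \<in> chart_dom e" "p \<in> chart_dom ?B" for p
      using BC_left_inverse(1,2)[OF c(1,2) that(2)] chart_inv_coords[OF ee that(1)] by simp_all
    have Td: "blowdown p \<in> chart_dom d"
      if p: "p \<in> chart_dom e" "p \<in> chart_dom ?B" "?g (coords e p) \<in> ?V" for p
    proof -
      obtain q where "q \<in> chart_dom c" "q \<in> chart_dom d" "coords c q = coords c (blowdown p)"
        using p(3) pt[OF p(1,2)] by auto
      then show ?thesis using chart_inv_coords[OF cc] pt(2)[OF p(1,2)] by metis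
    qed
    have "z \<in> ?T" using b c(3) pt[OF b(1) c(3)] by auto
    moreover have "?T \<subseteq> ?S" using Td by auto
    moreover have "smooth_on ?T ((coords d \<circ> chart_inv c) \<circ> ?g)"
      by (rule smooth_on_compose[OF T smoothly_compatibleD(1)[OF cd] smooth_on_subset[OF sg]
            smoothly_compatibleD(2)[OF cd]]) auto
    then have "smooth_on ?T (coords d \<circ> blowdown \<circ> chart_inv e)"
    proof (rule smooth_on_cong[OF T, rotated])
      fix z assume "z \<in> ?T"
      then obtain p where p: "p \<in> chart_dom e" "p \<in> chart_dom ?B" "z = coords e p" by blast
      then show "((coords d \<circ> chart_inv c) \<circ> ?g) z = (coords d \<circ> blowdown \<circ> chart_inv e) z"
        using pt[OF p(1,2)] chart_inv_coords[OF ee p(1)] chart_inv_coords[OF cc] by simp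
    qed
    ultimately show ?thesis using T by blast
  qed
  show "open ?S" using loc by (metis open_subopen)
  show "smooth_on ?S (coords d \<circ> blowdown \<circ> chart_inv e)" by (rule smooth_on_local) (use loc in blast)
qed

lemma blowdown_coords_expression:
  assumes c: "submanifold_chart M N k c I" and i: "i \<in> I" and b: "b \<in> chart_dom (BC c I i)"
  shows "frechet_derivative (coords c \<circ> blowdown \<circ> chart_inv (BC c I i)) (at (coords (BC c I i) b))
    = blowdown_deriv I i (coords (BC c I i) b)"
proof -
  let ?B = "BC c I i"
  have "(coords c \<circ> blowdown \<circ> chart_inv ?B has_derivative blowdown_deriv I i (coords ?B b)) (at (coords ?B b))"
  proof (rule has_derivative_transform_within_open[OF blowdown_coords_has_derivative
        open_chart_image[OF BC_is_chart[OF c i]] imageI[OF b]])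
    fix z assume "z \<in> coords ?B ` chart_dom ?B"
    then obtain p where p: "p \<in> chart_dom ?B" "z = coords ?B p" by blast
    then show "blowdown_coords I i z = (coords c \<circ> blowdown \<circ> chart_inv ?B) z"
      using BC_left_inverse(2)[OF c i p(1)] chart_inv_coords[OF BC_is_chart[OF c i] p(1)] by simp
  qed
  then show ?thesis by (rule frechet_derivative_eqI)
qed

end

section \<open>Forward and backward images in coordinates\<close>

context
  fixes B :: "('b, 'n::finite) chart set" and A :: "('a, 'n) chart set" and f :: "'b \<Rightarrow> 'a" and b :: 'b
    and c :: "('b, 'n) chart" and d :: "('a, 'n) chart" and P P' :: "real^'n \<Rightarrow> real^'n"
  assumes B: "compatible_charts B" and A: "compatible_charts A" and f: "smooth_map B A f"
    and c: "c \<in> charts_at B b" and d: "d \<in> charts_at A (f b)"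
    and P: "P = frechet_derivative (coords d \<circ> f \<circ> chart_inv c) (at (coords c b))"
    and P': "\<And>a w. P' a \<bullet> w = a \<bullet> P w"
begin

lemma smooth_map_has_derivative:
  assumes e: "e \<in> charts_at B b" and d': "d' \<in> charts_at A (f b)"
  shows "(coords d' \<circ> f \<circ> chart_inv e has_derivative
    frechet_derivative (coords d' \<circ> f \<circ> chart_inv e) (at (coords e b))) (at (coords e b))"
proof (rule has_derivative_frechet)
  have "smooth_on (coords e ` (chart_dom e \<inter> f -` chart_dom d')) (coords d' \<circ> f \<circ> chart_inv e)"
    using f charts_atD(1)[OF e] charts_atD(1)[OF d'] by (simp add: smooth_map_def Let_def)
  then show "coords d' \<circ> f \<circ> chart_inv e differentiable (at (coords e b))"
    by (rule smooth_on_imp_differentiable) (use charts_atD(2)[OF e] charts_atD(2)[OF d'] in auto)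
qed

text \<open>\<open>tangent_map\<close> goes through a chart chosen by \<open>SOME\<close>; the
  transition law of tangent vectors and the chain rule cancel this choice.\<close>

lemma tangent_map_coords_general:
  assumes w: "w \<in> tangent_space B b" and e: "e \<in> charts_at A (f b)"
  shows "tangent_map B A f b w e = frechet_derivative (coords e \<circ> f \<circ> chart_inv c) (at (coords c b)) (w c)"
proof -
  define c0 where "c0 = (SOME c. c \<in> charts_at B b)"
  have c0: "c0 \<in> charts_at B b" unfolding c0_def using c by (rule someI)
  have "tangent_map B A f b w e = frechet_derivative (coords e \<circ> f \<circ> chart_inv c0) (at (coords c0 b)) (w c0)"
    using e by (simp add: tangent_map_def c0_def Let_def)
  also have "frechet_derivative (coords e \<circ> f \<circ> chart_inv c0) (at (coords c0 b)) =
      (\<lambda>u. frechet_derivative (coords e \<circ> f \<circ> chart_inv c) (at (coords c b))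
        (frechet_derivative (coords c \<circ> chart_inv c0) (at (coords c0 b)) u))"
    by (rule frechet_derivative_eqI[OF chart_change_has_derivative[OF B c0 c smooth_map_has_derivative[OF c e]]])
  finally show ?thesis using tangent_space_transition[OF B w c0 c] by simp
qed

lemma tangent_map_coords: "w \<in> tangent_space B b \<Longrightarrow> tangent_map B A f b w d = P (w c)"
  using tangent_map_coords_general[OF _ d] by (simp add: P)

lemma tangent_map_in:
  assumes w: "w \<in> tangent_space B b"
  shows "tangent_map B A f b w \<in> tangent_space A (f b)"
proof (rule tangent_spaceI[OF A])
  show "tangent_map B A f b w e = 0" if "e \<notin> charts_at A (f b)" for e
    using that by (simp add: tangent_map_def Let_def)
  fix e e' assume e: "e \<in> charts_at A (f b)" and e': "e' \<in> charts_at A (f b)"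
  let ?g = "coords e \<circ> f \<circ> chart_inv c" and ?S = "coords c ` (chart_dom c \<inter> f -` chart_dom e)"
  have S: "open ?S" "coords c b \<in> ?S"
    using f charts_atD[OF c] charts_atD[OF e] by (auto simp: smooth_map_def Let_def)
  have cb: "chart_inv c (coords c b) = b"
    using compatible_is_chart[OF B charts_atD(1)[OF c]] charts_atD(2)[OF c] by simp
  have "(coords e' \<circ> chart_inv e has_derivative frechet_derivative (coords e' \<circ> chart_inv e) (at (coords e (f b))))
      (at (?g (coords c b)))"
    using transition_has_derivative[OF A e e'] by (simp add: cb)
  from diff_chain_at[OF smooth_map_has_derivative[OF c e] this]
  have "((coords e' \<circ> chart_inv e) \<circ> ?g has_derivative
    (\<lambda>u. frechet_derivative (coords e' \<circ> chart_inv e) (at (coords e (f b)))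
      (frechet_derivative ?g (at (coords c b)) u))) (at (coords c b))" by (simp add: o_def)
  then have "(coords e' \<circ> f \<circ> chart_inv c has_derivative
    (\<lambda>u. frechet_derivative (coords e' \<circ> chart_inv e) (at (coords e (f b)))
      (frechet_derivative ?g (at (coords c b)) u))) (at (coords c b))"
  proof (rule has_derivative_transform_within_open[OF _ S])
    fix z assume "z \<in> ?S"
    then show "((coords e' \<circ> chart_inv e) \<circ> ?g) z = (coords e' \<circ> f \<circ> chart_inv c) z"
      using compatible_is_chart[OF B charts_atD(1)[OF c]] compatible_is_chart[OF A charts_atD(1)[OF e]] by auto
  qed
  from frechet_derivative_eqI[OF this]
  show "tangent_map B A f b w e' = frechet_derivative (coords e' \<circ> chart_inv e) (at (coords e (f b)))
      (tangent_map B A f b w e)"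
    by (simp add: tangent_map_coords_general[OF w e] tangent_map_coords_general[OF w e'])
qed

lemma cotangent_map_eval:
  assumes \<xi>: "\<xi> \<in> cotangent_space A (f b)" and w: "w \<in> tangent_space B b"
  shows "cotangent_map B A f b \<xi> w = P' (covec_coords A (f b) d \<xi>) \<bullet> w c"
  using w covector_eval[OF A d \<xi> tangent_map_in[OF w]]
  by (simp add: cotangent_map_def tangent_map_coords P')

lemma cotangent_map_in:
  assumes \<xi>: "\<xi> \<in> cotangent_space A (f b)"
  shows "cotangent_map B A f b \<xi> \<in> cotangent_space B b"
proof -
  note S = subspace_tangent_space[OF B, of b]
  have "cotangent_map B A f b \<xi> w = 0" if "w \<notin> tangent_space B b" for w
    using that by (simp add: cotangent_map_def)
  then show ?thesis
    by (simp add: cotangent_space_def linear_over_def cotangent_map_eval[OF \<xi>]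
        subspace_add[OF S] subspace_scale[OF S] inner_add_right)
qed

lemma covec_coords_cotangent_map:
  assumes \<xi>: "\<xi> \<in> cotangent_space A (f b)"
  shows "covec_coords B b c (cotangent_map B A f b \<xi>) = P' (covec_coords A (f b) d \<xi>)"
  by (simp add: covec_coords_def[of B] vec_eq_iff cotangent_map_eval[OF \<xi>]
      tangent_of_in_tangent_space[OF B c] tangent_of_chart[OF B c] inner_axis)

lemma backward_image_in: "backward_image B A f L b \<subseteq> gen_tangent_space B b"
  using cotangent_map_in by (auto simp: backward_image_def gen_tangent_space_def)

lemma forward_image_in: "forward_image B A f L b \<subseteq> gen_tangent_space A (f b)"
  using tangent_map_in by (auto simp: forward_image_def gen_tangent_space_def)

lemma backward_image_coords:
  assumes L: "L (f b) \<subseteq> gen_tangent_space A (f b)"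
  shows "gtvec_coords B b c ` backward_image B A f L b =
    {(w, P' a) | w a. (P w, a) \<in> gtvec_coords A (f b) d ` L (f b)}"
proof (intro set_eqI iffI)
  fix x assume "x \<in> gtvec_coords B b c ` backward_image B A f L b"
  then obtain w \<xi> where w: "w \<in> tangent_space B b" and \<xi>: "\<xi> \<in> cotangent_space A (f b)"
    and e: "(tangent_map B A f b w, \<xi>) \<in> L (f b)" and x: "x = gtvec_coords B b c (w, cotangent_map B A f b \<xi>)"
    by (auto simp: backward_image_def)
  have "x = (w c, P' (covec_coords A (f b) d \<xi>))"
    by (simp add: x gtvec_coords_def covec_coords_cotangent_map[OF \<xi>])
  moreover have "(P (w c), covec_coords A (f b) d \<xi>) = gtvec_coords A (f b) d (tangent_map B A f b w, \<xi>)"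
    by (simp add: gtvec_coords_def tangent_map_coords[OF w])
  ultimately show "x \<in> {(w, P' a) | w a. (P w, a) \<in> gtvec_coords A (f b) d ` L (f b)}" using e by blast
next
  fix x assume "x \<in> {(w, P' a) | w a. (P w, a) \<in> gtvec_coords A (f b) d ` L (f b)}"
  then obtain w a e where x: "x = (w, P' a)" and e: "e \<in> L (f b)" "(P w, a) = gtvec_coords A (f b) d e" by blast
  let ?w = "tangent_of B b c w"
  have w: "?w \<in> tangent_space B b" "?w c = w"
    by (rule tangent_of_in_tangent_space[OF B c]) (rule tangent_of_chart[OF B c])
  have eg: "fst e \<in> tangent_space A (f b)" "snd e \<in> cotangent_space A (f b)"
    using e(1) L by (auto simp: gen_tangent_space_def)
  have "tangent_map B A f b ?w = fst e"
    by (rule tangent_space_eqI[OF A tangent_map_in[OF w(1)] eg(1) d])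
      (use e(2) w in \<open>simp add: tangent_map_coords gtvec_coords_def\<close>)
  then have "(?w, cotangent_map B A f b (snd e)) \<in> backward_image B A f L b"
    using w(1) eg(2) e(1) by (auto simp: backward_image_def)
  moreover have "x = gtvec_coords B b c (?w, cotangent_map B A f b (snd e))"
    using e(2) w(2) by (simp add: x gtvec_coords_def covec_coords_cotangent_map[OF eg(2)])
  ultimately show "x \<in> gtvec_coords B b c ` backward_image B A f L b" by blast
qed

lemma forward_image_coords:
  assumes L: "L b \<subseteq> gen_tangent_space B b"
  shows "gtvec_coords A (f b) d ` forward_image B A f L b =
    {(P w, a) | w a. (w, P' a) \<in> gtvec_coords B b c ` L b}"
proof (intro set_eqI iffI)
  fix x assume "x \<in> gtvec_coords A (f b) d ` forward_image B A f L b"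
  then obtain w \<xi> where w: "w \<in> tangent_space B b" and \<xi>: "\<xi> \<in> cotangent_space A (f b)"
    and e: "(w, cotangent_map B A f b \<xi>) \<in> L b" and x: "x = gtvec_coords A (f b) d (tangent_map B A f b w, \<xi>)"
    by (auto simp: forward_image_def)
  have "x = (P (w c), covec_coords A (f b) d \<xi>)"
    by (simp add: x gtvec_coords_def tangent_map_coords[OF w])
  moreover have "(w c, P' (covec_coords A (f b) d \<xi>)) = gtvec_coords B b c (w, cotangent_map B A f b \<xi>)"
    by (simp add: gtvec_coords_def covec_coords_cotangent_map[OF \<xi>])
  ultimately show "x \<in> {(P w, a) | w a. (w, P' a) \<in> gtvec_coords B b c ` L b}" using e by blast
next
  fix x assume "x \<in> {(P w, a) | w a. (w, P' a) \<in> gtvec_coords B b c ` L b}"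
  then obtain w a e where x: "x = (P w, a)" and e: "e \<in> L b" "(w, P' a) = gtvec_coords B b c e" by blast
  have eg: "e \<in> gen_tangent_space B b" using e(1) L by blast
  then have we: "fst e \<in> tangent_space B b" "fst e c = w" using e(2) by (auto simp: gen_tangent_space_def gtvec_coords_def)
  \<comment> \<open>The coordinate vector \<open>a\<close> has to be realised by an actual covector
    before membership in \<open>forward_image\<close> can be claimed.\<close>
  define \<xi> where "\<xi> = snd (gt_of A (f b) d (0, a))"
  have g: "gt_of A (f b) d (0, a) \<in> gen_tangent_space A (f b)" by (rule gt_of_in[OF A d])
  then have \<xi>: "\<xi> \<in> cotangent_space A (f b)" by (auto simp: \<xi>_def gen_tangent_space_def)
  have \<xi>a: "covec_coords A (f b) d \<xi> = a"
    using arg_cong[OF gtvec_coords_gt_of[OF A d, of "(0, a)"], of snd] by (simp add: \<xi>_def gtvec_coords_def)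
  have "e = (fst e, cotangent_map B A f b \<xi>)"
  proof (rule gtvec_coords_inj[OF B c eg])
    show "(fst e, cotangent_map B A f b \<xi>) \<in> gen_tangent_space B b"
      using we(1) cotangent_map_in[OF \<xi>] by (simp add: gen_tangent_space_def)
    show "gtvec_coords B b c e = gtvec_coords B b c (fst e, cotangent_map B A f b \<xi>)"
      unfolding e(2)[symmetric] by (simp add: gtvec_coords_def covec_coords_cotangent_map[OF \<xi>] \<xi>a we)
  qed
  then have "(fst e, cotangent_map B A f b \<xi>) \<in> L b" using e(1) by simp
  then have "(tangent_map B A f b (fst e), \<xi>) \<in> forward_image B A f L b"
    using we(1) \<xi> by (auto simp: forward_image_def)
  moreover have "x = gtvec_coords A (f b) d (tangent_map B A f b (fst e), \<xi>)"
    by (simp add: x gtvec_coords_def \<xi>a tangent_map_coords[OF we(1)] we(2))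
  ultimately show "x \<in> gtvec_coords A (f b) d ` forward_image B A f L b" by blast
qed

end

section \<open>Dirac structures in coordinates\<close>

definition coord_fibre ::
  "('a, 'n::finite) chart set \<Rightarrow> ('a, 'n) chart \<Rightarrow> ('a \<Rightarrow> ('a, 'n) gtvec set) \<Rightarrow> real^'n \<Rightarrow>
   ((real^'n) \<times> (real^'n)) set" where
  "coord_fibre A c L z = gtvec_coords A (chart_inv c z) c ` L (chart_inv c z)"

text \<open>An isotropic extension of the coordinate image pulls back to an isotropic extension of
  \<open>V\<close>, since coordinates identify the pairings up to the factor 2; so maximality
  transfers.\<close>

lemma lagrangian_gtvec_coords:
  assumes A: "compatible_charts A" and c: "c \<in> charts_at A q" and V: "maximally_isotropic A q V"
  shows "lagrangian (gtvec_coords A q c ` V)"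
proof (rule maximal_isotropic_lagrangian)
  let ?g = "gtvec_coords A q c"
  have sV: "subspace V" and Vg: "V \<subseteq> gen_tangent_space A q" and iso: "isotropic V"
    using V by (auto simp: maximally_isotropic_def)
  have pair: "dual_pair (?g e) (?g f) = 2 * pairing e f"
    if "e \<in> gen_tangent_space A q" "f \<in> gen_tangent_space A q" for e f
    using pairing_coords[OF A c that] by (simp add: dual_pair_def)
  show "subspace (?g ` V)" by (rule linear_subspace_image[OF linear_gtvec_coords sV])
  show "dual_pair x y = 0" if xy: "x \<in> ?g ` V" "y \<in> ?g ` V" for x y
  proof -
    obtain e f where "e \<in> V" "f \<in> V" "x = ?g e" "y = ?g f" using xy by (elim imageE) simp
    then show ?thesis using pair[of e f] Vg iso by (simp add: subsetD isotropic_def)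
  qed
  fix W assume W: "subspace W" "?g ` V \<subseteq> W" "\<And>x y. x \<in> W \<Longrightarrow> y \<in> W \<Longrightarrow> dual_pair x y = 0"
  let ?W = "{e \<in> gen_tangent_space A q. ?g e \<in> W}"
  have "subspace ?W"
    using W(1) subspace_gen_tangent_space[OF A, of q]
    unfolding subspace_def by (simp add: gtvec_coords_add gtvec_coords_scale gtvec_coords_0)
  moreover have "isotropic ?W"
    unfolding isotropic_def
  proof (intro ballI)
    fix e f assume "e \<in> ?W" "f \<in> ?W"
    then show "pairing e f = 0" using pair[of e f] W(3)[of "?g e" "?g f"] by simp
  qed
  moreover have "V \<subseteq> ?W" using W(2) Vg by blast
  moreover have "?W \<subseteq> gen_tangent_space A q" by blast
  ultimately have WV: "?W = V" using V unfolding maximally_isotropic_def by blast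
  have "x \<in> ?g ` V" if "x \<in> W" for x
  proof -
    have "gt_of A q c x \<in> ?W" using gt_of_in[OF A c] gtvec_coords_gt_of[OF A c] that by simp
    then have "gt_of A q c x \<in> V" unfolding WV .
    then show ?thesis using gtvec_coords_gt_of[OF A c, of x] by (metis imageI)
  qed
  then show "W = ?g ` V" using W(2) by blast
qed

section \<open>Local and global sections of subbundles\<close>

lemma smooth_section_add:
  assumes A: "compatible_charts A" and W: "openin (manifold_topology A) W"
    and s: "smooth_section A W s" and t: "smooth_section A W t"
  shows "smooth_section A W (\<lambda>q. s q + t q)"
  unfolding smooth_section_def
proof (intro conjI ballI)
  show "s q + t q \<in> gen_tangent_space A q" if "q \<in> W" for q
    using s t that by (auto simp: smooth_section_def intro: subspace_add[OF subspace_gen_tangent_space[OF A]])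
  fix c assume c: "c \<in> A"
  have "open (coords c ` (W \<inter> chart_dom c))" using W c by (simp add: openin_manifold_topology[OF A])
  then show "smooth_on (coords c ` (W \<inter> chart_dom c))
      (\<lambda>z. gtvec_coords A (chart_inv c z) c (s (chart_inv c z) + t (chart_inv c z)))"
    using s t c by (simp add: gtvec_coords_add smooth_section_def smooth_on_add)
qed

lemma smooth_section_scale:
  assumes A: "compatible_charts A" and W: "openin (manifold_topology A) W" and s: "smooth_section A W s"
  shows "smooth_section A W (\<lambda>q. r *\<^sub>R s q)"
  unfolding smooth_section_def
proof (intro conjI ballI)
  show "r *\<^sub>R s q \<in> gen_tangent_space A q" if "q \<in> W" for q
    using s that by (auto simp: smooth_section_def intro: subspace_scale[OF subspace_gen_tangent_space[OF A]])
  fix c assume c: "c \<in> A"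
  have "open (coords c ` (W \<inter> chart_dom c))" using W c by (simp add: openin_manifold_topology[OF A])
  then show "smooth_on (coords c ` (W \<inter> chart_dom c))
      (\<lambda>z. gtvec_coords A (chart_inv c z) c (r *\<^sub>R s (chart_inv c z)))"
    using s c by (simp add: gtvec_coords_scale smooth_section_def smooth_on_scaleR smooth_on_const)
qed

lemma smooth_section_zero: "compatible_charts A \<Longrightarrow> smooth_section A W (\<lambda>q. 0)"
  by (simp add: smooth_section_def gtvec_coords_0 smooth_on_const subspace_0[OF subspace_gen_tangent_space])

lemma local_section_exists:
  assumes A: "compatible_charts A" and L: "smooth_subbundle A L" and q: "q \<in> points A" and e: "e \<in> L q"
  shows "\<exists>W s. openin (manifold_topology A) W \<and> q \<in> W \<and> smooth_section A W s \<and> s q = e \<and> (\<forall>x\<in>W. s x \<in> L x)"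
proof -
  from L[unfolded smooth_subbundle_def, THEN bspec, OF q] obtain W r s where
    frame: "openin (manifold_topology A) W \<and> q \<in> W \<and> (\<forall>i<(r::nat). smooth_section A W (s i)) \<and>
      (\<forall>x\<in>W. inj_on (\<lambda>i. s i x) {..<r} \<and> independent ((\<lambda>i. s i x) ` {..<r}) \<and>
        L x = span ((\<lambda>i. s i x) ` {..<r}))"
    by (elim exE)
  then have W: "openin (manifold_topology A) W" "q \<in> W"
    and s: "\<And>i. i < r \<Longrightarrow> smooth_section A W (s i)"
    and Ls: "\<And>x. x \<in> W \<Longrightarrow> L x = span ((\<lambda>i. s i x) ` {..<r})"
    by simp_all
  have "e \<in> span ((\<lambda>i. s i q) ` {..<r})" using e Ls[OF W(2)] by simp
  \<comment> \<open>Constant coefficients in the local frame suffice; they are collected by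
    induction over the span at \<open>q\<close>.\<close>
  then have "\<exists>t. smooth_section A W t \<and> t q = e \<and> (\<forall>x\<in>W. t x \<in> L x)"
  proof (induction rule: span_induct_alt)
    case base
    then show ?case
      using smooth_section_zero[OF A] Ls span_zero by (intro exI[of _ "\<lambda>q. 0"]) auto
  next
    case (step a x y)
    then obtain i t where i: "i < r" "x = s i q" and t: "smooth_section A W t" "t q = y" "\<forall>x\<in>W. t x \<in> L x" by blast
    have "a *\<^sub>R s i p + t p \<in> L p" if "p \<in> W" for p
    proof -
      have "s i p \<in> L p" unfolding Ls[OF that] using i(1) by (intro span_base) blast
      moreover have "t p \<in> L p" using t(3) that by blast
      ultimately show ?thesis unfolding Ls[OF that] by (intro span_add span_scale)
    qed
    moreover have "smooth_section A W (\<lambda>p. a *\<^sub>R s i p + t p)"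
      by (intro smooth_section_add[OF A W(1)] smooth_section_scale[OF A W(1)] s[OF i(1)] t(1))
    ultimately show ?case using i(2) t(2) by (intro exI[of _ "\<lambda>p. a *\<^sub>R s i p + t p"]) simp
  qed
  then show ?thesis using W by blast
qed

lemma coord_section:
  assumes A: "compatible_charts A" and c: "c \<in> A" and W: "openin (manifold_topology A) W"
    and s: "smooth_section A W s" "\<And>x. x \<in> W \<Longrightarrow> s x \<in> L x"
    and z: "z \<in> coords c ` (W \<inter> chart_dom c)"
  defines "\<sigma> \<equiv> \<lambda>z. gtvec_coords A (chart_inv c z) c (s (chart_inv c z))"
  shows "local_section (coord_fibre A c L) z \<sigma> (frechet_derivative \<sigma> (at z))"
  unfolding local_section_def
proof
  have "smooth_on (coords c ` (W \<inter> chart_dom c)) \<sigma>" unfolding \<sigma>_def using s(1) c by (simp add: smooth_section_def)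
  from has_derivative_frechet[OF smooth_on_imp_differentiable[OF this z]]
  show "(\<sigma> has_derivative frechet_derivative \<sigma> (at z)) (at z)" .
  have "open (coords c ` (W \<inter> chart_dom c))" using W c by (simp add: openin_manifold_topology[OF A])
  then have "\<forall>\<^sub>F y in nhds z. y \<in> coords c ` (W \<inter> chart_dom c)" using z by (rule eventually_nhds_in_open)
  then show "\<forall>\<^sub>F y in nhds z. \<sigma> y \<in> coord_fibre A c L y"
  proof eventually_elim
    case (elim y)
    then have "chart_inv c y \<in> W" using chart_inv_coords[OF compatible_is_chart[OF A c]] by auto
    then show ?case using s(2) by (simp add: \<sigma>_def coord_fibre_def)
  qed
qed

lemma coord_fibre_sections:
  assumes A: "compatible_charts A" and L: "smooth_subbundle A L" and c: "c \<in> A"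
    and z: "z \<in> coords c ` chart_dom c" and e: "e \<in> coord_fibre A c L z"
  shows "\<exists>\<sigma> D. local_section (coord_fibre A c L) z \<sigma> D \<and> \<sigma> z = e"
proof -
  let ?q = "chart_inv c z"
  have q: "?q \<in> chart_dom c" "coords c ?q = z" using chart_inv_in_dom[OF z] coords_chart_inv[OF z] by auto
  obtain g where g: "g \<in> L ?q" "e = gtvec_coords A ?q c g" using e by (auto simp: coord_fibre_def)
  have "?q \<in> points A" using q(1) c by (auto simp: points_def)
  from local_section_exists[OF A L this g(1)] obtain W s where
    W: "openin (manifold_topology A) W" "?q \<in> W" "smooth_section A W s" "s ?q = g" "\<forall>x\<in>W. s x \<in> L x" by blast
  have "z \<in> coords c ` (W \<inter> chart_dom c)" using q W(2) by (intro image_eqI[of _ _ ?q]) simp_all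
  from coord_section[OF A c W(1,3) W(5)[rule_format] this] show ?thesis using W(4) g(2) by blast
qed

lemma coord_fibre_lagrangian:
  assumes A: "compatible_charts A" and L: "dirac_structure A H L" and c: "c \<in> A" and z: "z \<in> coords c ` chart_dom c"
  shows "lagrangian (coord_fibre A c L z)"
proof -
  have "chart_inv c z \<in> chart_dom c" by (rule chart_inv_in_dom[OF z])
  then have "c \<in> charts_at A (chart_inv c z)" "chart_inv c z \<in> points A" using c by (auto simp: charts_at_def points_def)
  then show ?thesis
    using lagrangian_gtvec_coords[OF A] L by (simp add: coord_fibre_def dirac_structure_def)
qed

text \<open>A local section is multiplied by a bump function and extended by 0. The extension is
  smooth because the bump vanishes in \<open>chart_dom c\<close> off a compact set \<open>K\<close>,
  which is closed since the manifold is Hausdorff.\<close>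

lemma global_section_exists:
  assumes M: "smooth_manifold M" and L: "smooth_subbundle M L"
    and sub: "\<And>q. q \<in> points M \<Longrightarrow> subspace (L q)" and q: "q \<in> points M" and e: "e \<in> L q"
  shows "\<exists>s. section_of M L s \<and> s q = e"
proof -
  note cM = smooth_manifold_compatible[OF M]
  obtain W s where W: "openin (manifold_topology M) W" "q \<in> W" and s: "smooth_section M W s" "s q = e"
    "\<And>x. x \<in> W \<Longrightarrow> s x \<in> L x"
    using local_section_exists[OF cM L q e] by blast
  obtain c where c: "c \<in> M" "q \<in> chart_dom c" using q by (auto simp: points_def)
  note cc = compatible_is_chart[OF cM c(1)]
  have opd: "openin (manifold_topology M) (chart_dom d)" if "d \<in> M" for d
    using openin_chart_preimage[OF cM that open_UNIV] by simp
  let ?W = "W \<inter> chart_dom c"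
  have W': "openin (manifold_topology M) ?W" using W(1) opd[OF c(1)] by blast
  have open_img: "open (coords d ` (V \<inter> chart_dom d))" if "openin (manifold_topology M) V" "d \<in> M" for V d
    using that by (simp add: openin_manifold_topology[OF cM])
  have U: "open (coords c ` ?W)" by (rule open_img[OF W(1) c(1)])
  obtain r where r: "r > 0" "cball (coords c q) r \<subseteq> coords c ` ?W"
    using U W(2) c(2) open_contains_cball by blast
  obtain \<beta> :: "real^'b \<Rightarrow> real" where \<beta>: "smooth_on UNIV \<beta>" "\<beta> (coords c q) = 1" "\<And>x. x \<notin> cball (coords c q) r \<Longrightarrow> \<beta> x = 0"
    using smooth_bump_exists[OF r(1)] by metis
  define K where "K = chart_inv c ` cball (coords c q) r"
  have "compactin (manifold_topology M) K"
    unfolding K_def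
  proof (rule image_compactin[of "top_of_set (coords c ` ?W)"])
    show "compactin (top_of_set (coords c ` ?W)) (cball (coords c q) r)"
      using r(2) by (simp add: compactin_subtopology)
    show "continuous_map (top_of_set (coords c ` ?W)) (manifold_topology M) (chart_inv c)"
      unfolding continuous_map_def
    proof (intro conjI allI impI)
      show "chart_inv c \<in> topspace (top_of_set (coords c ` ?W)) \<rightarrow> topspace (manifold_topology M)"
        using c(1) cc by (auto simp: topspace_manifold_topology[OF cM] points_def)
      fix V assume V: "openin (manifold_topology M) V"
      have eq: "{z \<in> topspace (top_of_set (coords c ` ?W)). chart_inv c z \<in> V} = coords c ` (V \<inter> W \<inter> chart_dom c)"
        using cc by auto
      have "open (coords c ` (V \<inter> W \<inter> chart_dom c))" by (rule open_img[OF openin_Int[OF V W(1)] c(1)])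
      then show "openin (top_of_set (coords c ` ?W)) {z \<in> topspace (top_of_set (coords c ` ?W)). chart_inv c z \<in> V}"
        unfolding eq openin_open_eq[OF U] by auto
    qed
  qed
  then have "closedin (manifold_topology M) K"
    using M compactin_imp_closedin by (auto simp: smooth_manifold_def)
  then have K: "openin (manifold_topology M) (points M - K)"
    by (simp add: closedin_def topspace_manifold_topology[OF cM])
  have outside: "\<beta> (coords c p) = 0" if "p \<in> chart_dom c" "p \<notin> K" for p
  proof (rule \<beta>(3))
    show "coords c p \<notin> cball (coords c q) r"
      using that chart_inv_coords[OF cc that(1)] unfolding K_def by (metis imageI)
  qed
  have KW: "K \<subseteq> ?W" using r(2) cc unfolding K_def by (auto dest!: subsetD[OF r(2)])
  define g where "g p = (if p \<in> ?W then \<beta> (coords c p) *\<^sub>R s p else 0)" for p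
  have gL: "g p \<in> L p" if "p \<in> points M" for p
    using s(3) sub[OF that] by (simp add: g_def subspace_scale subspace_0)
  have "smooth_section M (points M) g"
    unfolding smooth_section_def
  proof (intro conjI ballI)
    show "g p \<in> gen_tangent_space M p" if "p \<in> points M" for p
      using s(1) subspace_0[OF subspace_gen_tangent_space[OF cM]]
      by (auto simp: g_def smooth_section_def intro: subspace_scale[OF subspace_gen_tangent_space[OF cM]])
    fix d assume d: "d \<in> M"
    note dd = compatible_is_chart[OF cM d]
    show "smooth_on (coords d ` (points M \<inter> chart_dom d)) (\<lambda>z. gtvec_coords M (chart_inv d z) d (g (chart_inv d z)))"
    proof (rule smooth_on_local)
      fix z assume "z \<in> coords d ` (points M \<inter> chart_dom d)"
      then obtain p where p: "p \<in> points M" "p \<in> chart_dom d" "z = coords d p" by blast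
      show "\<exists>T. open T \<and> z \<in> T \<and> smooth_on T (\<lambda>z. gtvec_coords M (chart_inv d z) d (g (chart_inv d z)))"
      proof (cases "p \<in> ?W")
        case True
        let ?T = "coords d ` (?W \<inter> chart_dom d)"
        note dc = compatible_pair[OF cM d c(1)]
        have T: "open ?T" by (rule open_img[OF W' d])
        have b: "smooth_on ?T (\<beta> \<circ> (coords c \<circ> chart_inv d))"
          by (rule smooth_on_compose[OF T open_UNIV smooth_on_subset[OF smoothly_compatibleD(2)[OF dc]] \<beta>(1)]) auto
        have "smooth_on (coords d ` (W \<inter> chart_dom d)) (\<lambda>z. gtvec_coords M (chart_inv d z) d (s (chart_inv d z)))"
          using s(1) d by (simp add: smooth_section_def)
        then have "smooth_on ?T (\<lambda>z. gtvec_coords M (chart_inv d z) d (s (chart_inv d z)))"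
          by (rule smooth_on_subset) auto
        from smooth_on_scaleR[OF T b this]
        have "smooth_on ?T (\<lambda>z. gtvec_coords M (chart_inv d z) d (g (chart_inv d z)))"
          by (rule smooth_on_cong[OF T, rotated]) (use dd in \<open>auto simp: g_def gtvec_coords_scale\<close>)
        then show ?thesis using T True p by blast
      next
        case False
        let ?T = "coords d ` ((points M - K) \<inter> chart_dom d)"
        have T: "open ?T" by (rule open_img[OF K d])
        have g0: "g p' = 0" if "p' \<notin> K" for p' using outside that by (simp add: g_def)
        have "smooth_on ?T (\<lambda>z. gtvec_coords M (chart_inv d z) d (g (chart_inv d z)))"
          by (rule smooth_on_cong[OF T _ smooth_on_const[of _ 0]]) (use dd in \<open>auto simp: g0 gtvec_coords_0\<close>)
        moreover have "p \<notin> K" using False KW by blast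
        ultimately show ?thesis using T p by blast
      qed
    qed
  qed
  then have "section_of M L g" using gL by (simp add: section_of_def)
  moreover have "g q = e" using W(2) c(2) s(2) \<beta>(2) by (simp add: g_def)
  ultimately show ?thesis by blast
qed

text \<open>Involutivity applied to sections through \<open>(Y, \<eta>)\<close> and \<open>(0, \<zeta>)\<close>: at the given point the bracket
  has vector part \<open>D Y\<close>, so \<open>\<zeta>' (D Y) = 0\<close> for all covectors \<open>\<zeta>'\<close> in the fibre.\<close>

lemma involutive_coords:
  assumes M: "smooth_manifold M" and L: "dirac_structure M H L" and c: "c \<in> M"
    and z: "z \<in> coords c ` chart_dom c"
    and Y: "(Y, \<eta>) \<in> coord_fibre M c L z" and \<zeta>: "(0, \<zeta>) \<in> coord_fibre M c L z"
  shows "\<exists>\<sigma> D. local_section (coord_fibre M c L) z \<sigma> D \<and> \<sigma> z = (0, \<zeta>) \<and>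
    (\<forall>\<zeta>'. (0, \<zeta>') \<in> coord_fibre M c L z \<longrightarrow> \<zeta>' \<bullet> fst (D Y) = 0)"
proof -
  note cM = smooth_manifold_compatible[OF M]
  let ?q = "chart_inv c z"
  have q: "?q \<in> chart_dom c" "coords c ?q = z" using chart_inv_in_dom[OF z] coords_chart_inv[OF z] by auto
  have qM: "?q \<in> points M" and cq: "c \<in> charts_at M ?q" using q(1) c by (auto simp: points_def charts_at_def)
  have bun: "smooth_subbundle M L" and sub: "\<And>q. q \<in> points M \<Longrightarrow> subspace (L q)"
    and inv: "involutive M H L"
    using L by (auto simp: dirac_structure_def maximally_isotropic_def)
  obtain e1 where e1: "e1 \<in> L ?q" "gtvec_coords M ?q c e1 = (Y, \<eta>)" using Y by (auto simp: coord_fibre_def)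
  obtain e2 where e2: "e2 \<in> L ?q" "gtvec_coords M ?q c e2 = (0, \<zeta>)" using \<zeta> by (auto simp: coord_fibre_def)
  obtain s where s: "section_of M L s" "s ?q = e1" using global_section_exists[OF M bun sub qM e1(1)] by blast
  obtain t where t: "section_of M L t" "t ?q = e2" using global_section_exists[OF M bun sub qM e2(1)] by blast
  define S where "S z = gtvec_coords M (chart_inv c z) c (s (chart_inv c z))" for z
  define T where "T z = gtvec_coords M (chart_inv c z) c (t (chart_inv c z))" for z
  have top: "openin (manifold_topology M) (points M)"
    using topspace_manifold_topology[OF cM] by (metis openin_topspace)
  have zz: "z \<in> coords c ` (points M \<inter> chart_dom c)" using q qM by (intro image_eqI[of _ _ ?q]) simp_all
  have secS: "local_section (coord_fibre M c L) z S (frechet_derivative S (at z))"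
    unfolding S_def by (rule coord_section[OF cM c top _ _ zz]) (use s in \<open>auto simp: section_of_def\<close>)
  have secT: "local_section (coord_fibre M c L) z T (frechet_derivative T (at z))"
    unfolding T_def by (rule coord_section[OF cM c top _ _ zz]) (use t in \<open>auto simp: section_of_def\<close>)
  have dS: "((\<lambda>x. fst (S x)) has_derivative (\<lambda>v. fst (frechet_derivative S (at z) v))) (at z)"
    and dT: "((\<lambda>x. fst (T x)) has_derivative (\<lambda>v. fst (frechet_derivative T (at z) v))) (at z)"
    using secS secT by (auto simp: local_section_def intro: has_derivative_fst)
  have fS: "(\<lambda>x. fst (s (chart_inv c x)) c) = (\<lambda>x. fst (S x))"
    and fT: "(\<lambda>x. fst (t (chart_inv c x)) c) = (\<lambda>x. fst (T x))"
    by (simp_all add: S_def T_def gtvec_coords_def)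
  have Sz: "S z = (Y, \<eta>)" and Tz: "T z = (0, \<zeta>)" using e1 e2 s t by (simp_all add: S_def T_def)
  let ?b = "twisted_bracket M H c s t ?q"
  have bL: "?b \<in> L ?q" using inv s(1) t(1) qM cq by (simp add: involutive_def)
  have "fst ?b c = lie_bracket (\<lambda>x. fst (S x)) (\<lambda>x. fst (T x)) z"
    by (simp add: twisted_bracket_def Let_def q(2) fS fT tangent_of_chart[OF cM cq])
  \<comment> \<open>\<open>T z\<close> has vector part 0, so the term of the Lie bracket that
    differentiates \<open>S\<close> drops out.\<close>
  also have "\<dots> = fst (frechet_derivative T (at z) Y)"
    using linear_0[OF has_derivative_linear[OF dS]]
    by (simp add: lie_bracket_def frechet_derivative_eqI[OF dS] frechet_derivative_eqI[OF dT] Sz Tz)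
  finally have b: "fst (gtvec_coords M ?q c ?b) = fst (frechet_derivative T (at z) Y)"
    by (simp add: gtvec_coords_def)
  have bfib: "gtvec_coords M ?q c ?b \<in> coord_fibre M c L z" using bL by (simp add: coord_fibre_def)
  have "\<zeta>' \<bullet> fst (frechet_derivative T (at z) Y) = 0" if "(0, \<zeta>') \<in> coord_fibre M c L z" for \<zeta>'
    using lagrangian_isotropic[OF coord_fibre_lagrangian[OF cM L c z] that bfib] b by (simp add: dual_pair_def)
  then show ?thesis using secT Tz by blast
qed

section \<open>Lifts of Dirac structures\<close>

locale lifted_dirac = submanifold_setting M N k
  for M :: "('a, 'n::finite) chart set" and N :: "'a set" and k :: nat +
  fixes H :: "('a, 'n) form3" and L :: "'a \<Rightarrow> ('a, 'n) gtvec set"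
    and Lt :: "('a, 'n) blowup_point \<Rightarrow> (('a, 'n) blowup_point, 'n) gtvec set"
  assumes L: "dirac_structure M H L" and lift: "is_lift M H N k L Lt" and codim: "k > 1"
begin

lemma Lt_dirac: "dirac_structure Bl (form3_pullback Bl M blowdown H) Lt"
  using lift by (simp add: is_lift_def)

lemma L_gen: "q \<in> points M \<Longrightarrow> L q \<subseteq> gen_tangent_space M q"
  using L by (simp add: dirac_structure_def maximally_isotropic_def)

lemma Lt_gen: "b \<in> points Bl \<Longrightarrow> Lt b \<subseteq> gen_tangent_space Bl b"
  using Lt_dirac by (simp add: dirac_structure_def maximally_isotropic_def)

context
  fixes c :: "('a, 'n) chart" and I :: "'n set"
  assumes c: "submanifold_chart M N k c I"
begin

abbreviation "F \<equiv> coord_fibre M c L"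
abbreviation "G i \<equiv> coord_fibre Bl (BC c I i) Lt"

lemma c_in_M: "c \<in> M"
  using c by (simp add: submanifold_chart_def)

lemma F_at:
  assumes "q \<in> chart_dom c"
  shows "F (coords c q) = gtvec_coords M q c ` L q"
  using compatible_is_chart[OF cM c_in_M] assms by (simp add: coord_fibre_def)

context
  fixes i :: 'n and b :: "('a, 'n) blowup_point"
  assumes i: "i \<in> I" and b: "b \<in> chart_dom (BC c I i)"
begin

lemma BC_at: "BC c I i \<in> charts_at Bl b"
  using BC_in_blowup[OF c i] b by (simp add: charts_at_def)

lemma b_points: "b \<in> points Bl"
  using BC_left_inverse(4)[OF c i b] by (simp add: points_blowup)

lemma c_at_b: "c \<in> charts_at M (blowdown b)"
  using BC_left_inverse(1)[OF c i b] c_in_M by (simp add: charts_at_def)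

lemma blowdown_b_points: "blowdown b \<in> points M"
  unfolding points_iff_charts_at by (rule ex_in_conv[THEN iffD1], rule exI, rule c_at_b)

lemma F_blowdown: "F (blowdown_coords I i (coords (BC c I i) b)) = gtvec_coords M (blowdown b) c ` L (blowdown b)"
  using F_at[OF BC_left_inverse(1)[OF c i b]] BC_left_inverse(2)[OF c i b] by simp

lemma G_at: "G i (coords (BC c I i) b) = gtvec_coords Bl b (BC c I i) ` Lt b"
  using chart_inv_coords[OF BC_is_chart[OF c i] b] by (simp add: coord_fibre_def)

lemma backward_image_blowdown:
  "gtvec_coords Bl b (BC c I i) ` backward_image Bl M blowdown L b =
    {(w, blowdown_adjoint I i (coords (BC c I i) b) a) | w a.
      (blowdown_deriv I i (coords (BC c I i) b) w, a) \<in> F (blowdown_coords I i (coords (BC c I i) b))}"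
  unfolding F_blowdown
  by (rule backward_image_coords[where f = blowdown and P' = "blowdown_adjoint I i (coords (BC c I i) b)" and L = L,
        OF cB cM smooth_map_blowdown BC_at c_at_b
        blowdown_coords_expression[OF c i b, symmetric] blowdown_adjoint_works L_gen[OF blowdown_b_points]])

lemma forward_image_blowdown:
  "gtvec_coords M (blowdown b) c ` forward_image Bl M blowdown Lt b =
    {(blowdown_deriv I i (coords (BC c I i) b) w, a) | w a.
      (w, blowdown_adjoint I i (coords (BC c I i) b) a) \<in> G i (coords (BC c I i) b)}"
  unfolding G_at
  by (rule forward_image_coords[where f = blowdown and P' = "blowdown_adjoint I i (coords (BC c I i) b)" and L = Lt,
        OF cB cM smooth_map_blowdown BC_at c_at_b
        blowdown_coords_expression[OF c i b, symmetric] blowdown_adjoint_works Lt_gen[OF b_points]])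

text \<open>Coordinates are injective on whole fibres, so the Dirac map conditions can be verified
  in the local model.\<close>

lemma image_blowdown_eqI:
  shows "gtvec_coords Bl b (BC c I i) ` backward_image Bl M blowdown L b = G i (coords (BC c I i) b) \<Longrightarrow>
      Lt b = backward_image Bl M blowdown L b"
    and "gtvec_coords M (blowdown b) c ` forward_image Bl M blowdown Lt b =
      F (blowdown_coords I i (coords (BC c I i) b)) \<Longrightarrow>
      L (blowdown b) = forward_image Bl M blowdown Lt b"
proof -
  have inj1: "inj_on (gtvec_coords Bl b (BC c I i)) (gen_tangent_space Bl b)"
    by (rule inj_onI) (rule gtvec_coords_inj[OF cB BC_at])
  have inj2: "inj_on (gtvec_coords M (blowdown b) c) (gen_tangent_space M (blowdown b))"
    by (rule inj_onI) (rule gtvec_coords_inj[OF cM c_at_b])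
  have sub1: "backward_image Bl M blowdown L b \<subseteq> gen_tangent_space Bl b"
    by (rule backward_image_in[where f = blowdown and P' = "blowdown_adjoint I i (coords (BC c I i) b)" and L = L,
        OF cB cM smooth_map_blowdown BC_at c_at_b
        blowdown_coords_expression[OF c i b, symmetric] blowdown_adjoint_works])
  have sub2: "forward_image Bl M blowdown Lt b \<subseteq> gen_tangent_space M (blowdown b)"
    by (rule forward_image_in[where f = blowdown and P' = "blowdown_adjoint I i (coords (BC c I i) b)" and L = Lt,
        OF cB cM smooth_map_blowdown BC_at c_at_b
        blowdown_coords_expression[OF c i b, symmetric] blowdown_adjoint_works])
  show "Lt b = backward_image Bl M blowdown L b"
    if "gtvec_coords Bl b (BC c I i) ` backward_image Bl M blowdown L b = G i (coords (BC c I i) b)"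
    using that inj_on_image_eq_iff[OF inj1 sub1 Lt_gen[OF b_points]] by (simp add: G_at)
  show "L (blowdown b) = forward_image Bl M blowdown Lt b"
    if "gtvec_coords M (blowdown b) c ` forward_image Bl M blowdown Lt b =
      F (blowdown_coords I i (coords (BC c I i) b))"
    using that inj_on_image_eq_iff[OF inj2 sub2 L_gen[OF blowdown_b_points]] by (simp add: F_blowdown)
qed

end

text \<open>The bridge to the local model. Closedness of the lift comes from its being a smooth
  Lagrangian subbundle; \<open>E_off\<close> is the defining property of a lift, read in
  coordinates.\<close>

lemma lift_model: "lift_model I (coords c ` chart_dom c) F G"
proof
  note cc = compatible_is_chart[OF cM c_in_M]
  show "1 < card I" using c codim by (simp add: submanifold_chart_def)
  show "open (coords c ` chart_dom c)" by (rule open_chart_image[OF cc])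
  show "lagrangian (F x)" if "x \<in> coords c ` chart_dom c" for x
    by (rule coord_fibre_lagrangian[OF cM L c_in_M that])
  show "\<exists>\<sigma> D. local_section F x \<sigma> D \<and> \<sigma> x = e" if "x \<in> coords c ` chart_dom c" "e \<in> F x" for x e
    using coord_fibre_sections[OF cM _ c_in_M that] L by (simp add: dirac_structure_def)
  show "\<exists>\<sigma> D. local_section F x \<sigma> D \<and> \<sigma> x = (0, \<zeta>) \<and> (\<forall>\<zeta>'. (0, \<zeta>') \<in> F x \<longrightarrow> \<zeta>' \<bullet> fst (D Y) = 0)"
    if "x \<in> coords c ` chart_dom c" "(Y, \<eta>) \<in> F x" "(0, \<zeta>) \<in> F x" for x Y \<eta> \<zeta>
    by (rule involutive_coords[OF M L c_in_M that])
  have dom: "z \<in> coords (BC c I i) ` chart_dom (BC c I i)"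
    if "i \<in> I" "blowdown_coords I i z \<in> coords c ` chart_dom c" for i z
    using BC_image[OF c that(1)] that(2) by simp
  show lagG: "lagrangian (G i z)" if "i \<in> I" "blowdown_coords I i z \<in> coords c ` chart_dom c" for i z
    by (rule coord_fibre_lagrangian[OF cB Lt_dirac BC_in_blowup[OF c that(1)] dom[OF that]])
  show "e0 \<in> G i z"
    if i: "i \<in> I" and z: "blowdown_coords I i z \<in> coords c ` chart_dom c"
      and ev: "\<forall>\<^sub>F n in sequentially. s n \<in> G i (y n)" and y: "y \<longlonglongrightarrow> z" and s: "s \<longlonglongrightarrow> e0" for i z s y e0
  proof (rule lagrangian_family_closed[OF open_chart_image[OF BC_is_chart[OF c i]] _ _ dom[OF i z] y s ev])
    show "lagrangian (G i x)" if "x \<in> coords (BC c I i) ` chart_dom (BC c I i)" for x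
      by (rule coord_fibre_lagrangian[OF cB Lt_dirac BC_in_blowup[OF c i] that])
    show "\<exists>\<sigma> D. local_section (G i) z \<sigma> D \<and> \<sigma> z = f" if "f \<in> G i z" for f
      using coord_fibre_sections[OF cB _ BC_in_blowup[OF c i] dom[OF i z] that] Lt_dirac
      by (simp add: dirac_structure_def)
  qed
  show "(w, blowdown_adjoint I i z a) \<in> G i z"
    if i: "i \<in> I" and z: "blowdown_coords I i z \<in> coords c ` chart_dom c" "z $ i \<noteq> 0"
      and e: "(blowdown_deriv I i z w, a) \<in> F (blowdown_coords I i z)" for i z w a
  proof -
    let ?b = "blowup_chart_inv c I i z"
    have b: "?b \<in> chart_dom (BC c I i)" "coords (BC c I i) ?b = z" by (rule BC_right_inverse[OF c i z(1)])+
    \<comment> \<open>A nonzero \<open>i\<close>-th coordinate puts the point off the exceptional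
      divisor, where the lift is prescribed.\<close>
    obtain q where q: "?b = Inl q" using z(2) by (simp add: blowup_chart_inv_def Let_def)
    have "Inl q \<in> blowup_set M N k" using BC_left_inverse(4)[OF c i b(1)] q by simp
    then have "q \<in> points M - N" by (auto simp: blowup_set_def)
    then have "Lt ?b = backward_image Bl M blowdown L ?b" using lift q by (simp add: is_lift_def)
    then show ?thesis
      using backward_image_blowdown[OF i b(1)] G_at[OF i b(1)] e by (auto simp: b(2))
  qed
qed

end

section \<open>Transversal and invariant points of the submanifold\<close>

definition transv_at :: "'a \<Rightarrow> bool" where
  "transv_at q \<longleftrightarrow> {u + v | u v. u \<in> TN q \<and> v \<in> fst ` L q} = tangent_space M q"

definition invar_at :: "'a \<Rightarrow> bool" where
  "invar_at q \<longleftrightarrow> fst ` L q \<subseteq> TN q"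

lemma N_points: "q \<in> N \<Longrightarrow> q \<in> points M"
  using N by (auto simp: embedded_submanifold_def)

lemma fst_L: "q \<in> points M \<Longrightarrow> e \<in> L q \<Longrightarrow> fst e \<in> tangent_space M q"
  using L_gen[of q] by (auto simp: gen_tangent_space_def)

lemma invar_at_iff:
  assumes c: "sub_chart_at c I q" and q: "q \<in> N"
  shows "invar_at q \<longleftrightarrow> invar I (coord_fibre M c L (coords c q))"
proof -
  note Fq = F_at[OF sub_chart_atD(6)[OF c] sub_chart_atD(5)[OF c]]
  have "invar_at q \<longleftrightarrow> (\<forall>e\<in>L q. \<forall>l\<in>I. fst e c $ l = 0)"
    unfolding invar_at_def using TN_iff[OF c q] fst_L[OF N_points[OF q]] by blast
  also have "\<dots> \<longleftrightarrow> invar I (coord_fibre M c L (coords c q))"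
    unfolding invar_def Fq by (force simp: gtvec_coords_def image_iff)
  finally show ?thesis .
qed

lemma lagrangian_at:
  assumes c: "sub_chart_at c I q"
  shows "lagrangian (coord_fibre M c L (coords c q))"
  by (rule coord_fibre_lagrangian[OF cM L sub_chart_atD(2)[OF c] imageI[OF sub_chart_atD(5)[OF c]]])

lemma transv_at_iff:
  assumes c: "sub_chart_at c I q" and q: "q \<in> N"
  shows "transv_at q \<longleftrightarrow> transv I (coord_fibre M c L (coords c q))"
proof -
  note Fq = F_at[OF sub_chart_atD(6)[OF c] sub_chart_atD(5)[OF c]]
  note T = subspace_tangent_space[OF cM, of q]
  let ?R = "\<forall>u. \<exists>e\<in>L q. \<forall>l\<in>I. fst e c $ l = u $ l"
  have "transv_at q \<longleftrightarrow> ?R"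
  proof
    assume t: "transv_at q"
    show ?R
    proof
      fix u
      have "tangent_of M q c u \<in> {u + v | u v. u \<in> TN q \<and> v \<in> fst ` L q}"
        using t tangent_of_in_tangent_space[OF cM sub_chart_atD(1)[OF c]] by (simp add: transv_at_def)
      then obtain x e where x: "x \<in> TN q" "e \<in> L q" "tangent_of M q c u = x + fst e" by blast
      then have "u = x c + fst e c" using tangent_of_chart[OF cM sub_chart_atD(1)[OF c], of u] by simp
      then show "\<exists>e\<in>L q. \<forall>l\<in>I. fst e c $ l = u $ l"
        using x(1,2) TN_iff[OF c q, of x] by (intro bexI[of _ e]) auto
    qed
  next
    assume r: ?R
    show "transv_at q"
      unfolding transv_at_def
    proof (intro set_eqI iffI)
      fix w assume "w \<in> {u + v | u v. u \<in> TN q \<and> v \<in> fst ` L q}"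
      then obtain x e where "x \<in> TN q" "e \<in> L q" "w = x + fst e" by blast
      then show "w \<in> tangent_space M q"
        using subspace_add[OF T] TN_iff[OF c q, of x] fst_L[OF N_points[OF q]] by simp
    next
      fix w assume w: "w \<in> tangent_space M q"
      obtain e where e: "e \<in> L q" "\<forall>l\<in>I. fst e c $ l = w c $ l" using r by blast
      have "w - fst e \<in> TN q"
        unfolding TN_iff[OF c q] using subspace_diff[OF T w fst_L[OF N_points[OF q] e(1)]] e(2) by simp
      moreover have "w = (w - fst e) + fst e" by simp
      ultimately show "w \<in> {u + v | u v. u \<in> TN q \<and> v \<in> fst ` L q}" using e(1) by blast
    qed
  qed
  also have "?R \<longleftrightarrow> transv I (coord_fibre M c L (coords c q))"
    unfolding transv_iff[OF lagrangian_at[OF c]] unfolding Fq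
    by (intro all_cong1) (force simp: gtvec_coords_def image_iff)
  finally show ?thesis .
qed

lemma transv_or_invar_at:
  assumes q: "q \<in> N"
  shows "transv_at q \<or> invar_at q"
proof -
  obtain c I where c: "sub_chart_at c I q" using sub_chart_exists[OF q] by blast
  interpret lm: lift_model I "coords c ` chart_dom c" "coord_fibre M c L" "\<lambda>i. coord_fibre Bl (BC c I i) Lt"
    by (rule lift_model[OF sub_chart_atD(6)[OF c]])
  show ?thesis
    unfolding transv_at_iff[OF c q] invar_at_iff[OF c q]
    by (rule lm.transv_or_invar)
      (use sub_chart_atD(5)[OF c] sub_chart_N[OF sub_chart_atD(6)[OF c]] q in auto)
qed

lemma not_both:
  assumes q: "q \<in> N" and t: "transv_at q" and i: "invar_at q"
  shows False
proof -
  obtain c I where c: "sub_chart_at c I q" using sub_chart_exists[OF q] by blast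
  obtain l where l: "l \<in> I" using sub_chart_atD(4)[OF c] k by (metis card.empty ex_in_conv less_irrefl)
  obtain X \<xi> where X: "(X, \<xi>) \<in> coord_fibre M c L (coords c q)" "\<forall>l\<in>I. X $ l = (\<chi> l. 1) $ l"
    using t unfolding transv_at_iff[OF c q] transv_iff[OF lagrangian_at[OF c]] by blast
  then show False using i l unfolding invar_at_iff[OF c q] invar_def by fastforce
qed

text \<open>Failure would give points of \<open>N\<close> of the opposite type converging to
  \<open>q\<close>. Invariant points can only converge to invariant ones, and transversal points
  cannot converge to an invariant one.\<close>

lemma locally_constant:
  assumes q: "q \<in> N"
  shows "\<exists>O'. openin (manifold_topology M) O' \<and> q \<in> O' \<and> (\<forall>p\<in>O' \<inter> N. transv_at p \<longleftrightarrow> transv_at q)"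
proof (rule ccontr)
  assume neg: "\<not> ?thesis"
  obtain c I where c: "sub_chart_at c I q" using sub_chart_exists[OF q] by blast
  note cs = sub_chart_atD(6)[OF c]
  interpret lm: lift_model I "coords c ` chart_dom c" "coord_fibre M c L" "\<lambda>i. coord_fibre Bl (BC c I i) Lt"
    by (rule lift_model[OF cs])
  have "\<exists>p. p \<in> N \<and> p \<in> chart_dom c \<and> dist (coords c q) (coords c p) < null_seq n \<and> (transv_at p \<longleftrightarrow> \<not> transv_at q)" for n
  proof -
    let ?O = "chart_dom c \<inter> coords c -` ball (coords c q) (null_seq n)"
    have "openin (manifold_topology M) ?O" by (rule openin_chart_preimage[OF cM sub_chart_atD(2)[OF c] open_ball])
    moreover have "q \<in> ?O" using sub_chart_atD(5)[OF c] by (simp add: null_seq_def)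
    ultimately have "\<not> (\<forall>p\<in>?O \<inter> N. transv_at p \<longleftrightarrow> transv_at q)" using neg by blast
    then show ?thesis by auto
  qed
  then obtain p where p: "\<And>n. p n \<in> N" "\<And>n. p n \<in> chart_dom c"
      "\<And>n. dist (coords c q) (coords c (p n)) < null_seq n" "\<And>n. transv_at (p n) \<longleftrightarrow> \<not> transv_at q"
    by metis
  have pc: "sub_chart_at c I (p n)" for n using p(2) cs by (simp add: sub_chart_at_def)
  have lim: "(\<lambda>n. coords c (p n)) \<longlonglongrightarrow> coords c q"
    by (rule tendsto_dist_iff[THEN iffD2], rule tendsto_sandwich[OF _ _ tendsto_const null_seq(1)])
      (use p(3) in \<open>auto simp: dist_commute intro!: always_eventually less_imp_le\<close>)
  have in_U: "coords c (p n) \<in> coords c ` chart_dom c" "coords c q \<in> coords c ` chart_dom c" for n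
    using p(2) sub_chart_atD(5)[OF c] by auto
  show False
  proof (cases "transv_at q")
    case True
    then have "invar_at (p n)" for n using p(4) transv_or_invar_at[OF p(1)] by blast
    then have "invar I (coord_fibre M c L (coords c q))"
      by (intro lm.invar_closed[OF in_U(1) lim in_U(2)]) (simp add: invar_at_iff[OF pc p(1), symmetric])
    then show False using not_both[OF q True] invar_at_iff[OF c q] by simp
  next
    case False
    then have "transv_at (p n)" for n using p(4) by blast
    then have "\<not> invar I (coord_fibre M c L (coords c q))"
      by (intro lm.transv_closed[OF in_U(1) _ lim in_U(2)])
        (use sub_chart_N[OF cs p(2)] p(1) in \<open>auto simp: transv_at_iff[OF pc p(1), symmetric]\<close>)
    then show False using transv_or_invar_at[OF q] False invar_at_iff[OF c q] by simp
  qed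
qed

lemma dichotomy:
  assumes conn: "connectedin (manifold_topology M) N"
  shows "(\<forall>q\<in>N. transv_at q) \<or> (\<forall>q\<in>N. invar_at q)"
proof (rule ccontr)
  assume neg: "\<not> ?thesis"
  \<comment> \<open>The largest open set whose points in \<open>N\<close> all have type
    \<open>t\<close>. The two sets cover \<open>N\<close> and are disjoint on it, so connectedness
    leaves only one type.\<close>
  define E where "E t = \<Union>{W. openin (manifold_topology M) W \<and> (\<forall>p\<in>W \<inter> N. transv_at p \<longleftrightarrow> t)}" for t
  have opE: "openin (manifold_topology M) (E t)" for t unfolding E_def by (rule openin_Union) blast
  have EN: "q \<in> E t \<longleftrightarrow> (transv_at q \<longleftrightarrow> t)" if qN: "q \<in> N" for q t
  proof
    assume "q \<in> E t" then show "transv_at q \<longleftrightarrow> t" using qN unfolding E_def by blast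
  next
    assume t: "transv_at q \<longleftrightarrow> t"
    from locally_constant[OF qN] obtain W where W: "openin (manifold_topology M) W" "q \<in> W"
      "\<forall>p\<in>W \<inter> N. transv_at p \<longleftrightarrow> transv_at q"
      by (elim exE conjE)
    show "q \<in> E t"
      unfolding E_def by (rule UnionI[OF _ W(2)]) (use W(1,3) t in simp)
  qed
  obtain p where "p \<in> N" "\<not> transv_at p" using neg by blast
  then have "E False \<inter> N \<noteq> {}" using EN[of p False] by auto
  moreover obtain p' where "p' \<in> N" "\<not> invar_at p'" using neg by blast
  then have "E True \<inter> N \<noteq> {}" using EN[of p' True] transv_or_invar_at[of p'] by auto
  moreover have "N \<subseteq> E True \<union> E False" "E True \<inter> E False \<inter> N = {}" using EN by auto
  ultimately show False using conn opE unfolding connectedin by meson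
qed

lemma backward_blowdown:
  assumes t: "\<And>q. q \<in> N \<Longrightarrow> transv_at q"
  shows "backward_dirac Bl Lt M L blowdown"
  unfolding backward_dirac_def
proof (intro conjI smooth_map_blowdown ballI)
  fix b assume bp: "b \<in> points Bl"
  show "Lt b = backward_image Bl M blowdown L b"
  proof (cases b)
    case (Inl q)
    then have "q \<in> points M - N" using bp by (auto simp: points_blowup blowup_set_def)
    then show ?thesis using lift Inl by (simp add: is_lift_def)
  next
    case (Inr p)
    then have qN: "blowdown b \<in> N"
      using bp by (auto simp: points_blowup blowup_set_def projective_normal_bundle_def blowdown_def)
    obtain c I i where c: "submanifold_chart M N k c I" and i: "i \<in> I" and b: "b \<in> chart_dom (BC c I i)"
      using blowup_cover[OF bp] by blast
    interpret lm: lift_model I "coords c ` chart_dom c" "coord_fibre M c L" "\<lambda>i. coord_fibre Bl (BC c I i) Lt"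
      by (rule lift_model[OF c])
    note q = BC_left_inverse(1,2)[OF c i b]
    have cq: "sub_chart_at c I (blowdown b)" using c q(1) by (simp add: sub_chart_at_def)
    let ?z = "coords (BC c I i) b"
    have "coords c (blowdown b) $ i = 0" using sub_chart_N[OF c q(1)] qN i by blast
    then have z: "?z $ i = 0" using q(2) by (simp add: blowdown_coords_def vec_eq_iff) (metis)
    have "transv I (coord_fibre M c L (blowdown_coords I i ?z))"
      using t[OF qN] transv_at_iff[OF cq qN] q(2) by simp
    from lm.backward_model[OF i z _ this] show ?thesis
      using q by (intro image_blowdown_eqI(1)[OF c i b]) (simp add: backward_image_blowdown[OF c i b])
  qed
qed

lemma forward_blowdown:
  assumes inv: "\<And>q. q \<in> N \<Longrightarrow> invar_at q"
  shows "forward_dirac Bl Lt M L blowdown"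
  unfolding forward_dirac_def
proof (intro conjI smooth_map_blowdown ballI)
  fix b assume bp: "b \<in> points Bl"
  obtain c I i where c: "submanifold_chart M N k c I" and i: "i \<in> I" and b: "b \<in> chart_dom (BC c I i)"
    using blowup_cover[OF bp] by blast
  interpret lm: lift_model I "coords c ` chart_dom c" "coord_fibre M c L" "\<lambda>i. coord_fibre Bl (BC c I i) Lt"
    by (rule lift_model[OF c])
  note q = BC_left_inverse(1,2)[OF c i b]
  have cq: "sub_chart_at c I (blowdown b)" using c q(1) by (simp add: sub_chart_at_def)
  let ?z = "coords (BC c I i) b"
  have "invar I (coord_fibre M c L (blowdown_coords I i ?z))" if z: "?z $ i = 0"
  proof -
    have "\<forall>l\<in>I. coords c (blowdown b) $ l = 0" using q(2)[symmetric] z by (simp add: blowdown_coords_exceptional)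
    then have qN: "blowdown b \<in> N" using sub_chart_N[OF c q(1)] by blast
    show ?thesis using inv[OF qN] invar_at_iff[OF cq qN] q(2) by simp
  qed
  from lm.forward_model[OF i _ this] show "L (blowdown b) = forward_image Bl M blowdown Lt b"
    using q by (intro image_blowdown_eqI(2)[OF c i b]) (simp add: forward_image_blowdown[OF c i b])
qed

end

theorem theorem5p1:
  fixes M :: "('a, 'n::finite) chart set"
    and H :: "('a, 'n) form3"
    and L :: "'a \<Rightarrow> ('a, 'n) gtvec set"
    and N :: "'a set"
    and k :: nat
    and Lt :: "('a, 'n) blowup_point \<Rightarrow> (('a, 'n) blowup_point, 'n) gtvec set"
  assumes "smooth_manifold M"
    and "closed_form3 M H"
    and "dirac_structure M H L"
    and "embedded_submanifold M N k"
    and "closedin (manifold_topology M) N"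
    and "connectedin (manifold_topology M) N"
    and "k > 1"
    and "is_lift M H N k L Lt"
  shows "(transversal_submanifold M N k L \<or> invariant_submanifold M N k L) \<and>
         (transversal_submanifold M N k L \<longrightarrow>
            backward_dirac (blowup M N k) Lt M L blowdown) \<and>
         (invariant_submanifold M N k L \<longrightarrow>
            forward_dirac (blowup M N k) Lt M L blowdown)"
proof -
  interpret lifted_dirac M N k H L Lt
    by unfold_locales (use assms in auto)
  have t: "transversal_submanifold M N k L \<longleftrightarrow> (\<forall>q\<in>N. transv_at q)"
    by (simp add: transversal_submanifold_def transv_at_def)
  have i: "invariant_submanifold M N k L \<longleftrightarrow> (\<forall>q\<in>N. invar_at q)"
    by (simp add: invariant_submanifold_def invar_at_def)
  show ?thesis
    unfolding t i using dichotomy[OF assms(6)] backward_blowdown forward_blowdown by blast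
qed

end
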